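(* Let $x: M^{2}\to \mathbb{C}^{2}$ be a $2$-dimensional complete Lagrangian self-expander whose squared norm $S$ of the second fundamental form is constant on $M^2$. Then $x(M^{2})$ is a plane $\mathbb{R}^{2}$ through the origin, i.e. a $2$-dimensional real linear subspace of $\mathbb{C}^{2}\cong\mathbb{R}^4$.
   Context: Identify $\mathbb{C}^{2}$ with $\mathbb{R}^{4}$ with its Euclidean inner product $\langle\cdot,\cdot\rangle$ and canonical complex structure $J$. $M^2$ is a smooth connected $2$-dimensional manifold (without boundary), $x:M^2\to\mathbb{C}^2$ is a smooth immersion, and $M^2$ carries the induced Riemannian metric; "complete" means that this induced metric is complete. The immersion is Lagrangian if $J$ maps each tangent plane $dx(T_pM)$ onto the normal space at $p$. For a local orthonormal tangent frame $\{e_1,e_2\}$ put $e_{1^*}=Je_1$, $e_{2^*}=Je_2$ (an orthonormal normal frame), and let $h=\sum_{i,j,p}h^{p^*}_{ij}\,\omega_i\otimes\omega_j\otimes e_{p^*}$ be the second fundamental form, where $\{\omega_1,\omega_2\}$ is the dual coframe. The mean curvature vector is the (unnormalized) trace $\vec H=\sum_{p}H^{p^*}e_{p^*}$ with $H^{p^*}=\sum_i h^{p^*}_{ii}$, and $S=\sum_{i,j,p}(h^{p^*}_{ij})^2$. The immersion $x$ is a self-expander if $\vec H=x^{\perp}$, where $x^\perp$ is the orthogonal projection of the position vector $x$ onto the normal bundle. *)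

theory Defs
  imports "HOL-Analysis.Analysis"
begin

section \<open>Smooth maps and smooth surfaces\<close>

text \<open>\<open>Ck_on\<close> is meant for open \<open>S\<close>; asking for the continuity of the directional derivatives
  is the usual notion because the domain is finite-dimensional.\<close>

primrec Ck_on :: "nat \<Rightarrow> 'a::euclidean_space set \<Rightarrow> ('a \<Rightarrow> 'b::real_normed_vector) \<Rightarrow> bool" where
  "Ck_on 0 S f \<longleftrightarrow> continuous_on S f"
| "Ck_on (Suc k) S f \<longleftrightarrow>
     (\<forall>u\<in>S. f differentiable (at u)) \<and> (\<forall>v. Ck_on k S (\<lambda>u. frechet_derivative f (at u) v))"

definition smooth_on :: "'a::euclidean_space set \<Rightarrow> ('a \<Rightarrow> 'b::real_normed_vector) \<Rightarrow> bool" where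
  "smooth_on S f \<longleftrightarrow> (\<forall>k. Ck_on k S f)"

text \<open>A chart is a pair \<open>(U, \<phi>)\<close>; only the values of \<open>\<phi>\<close> on \<open>U\<close> matter.\<close>

type_synonym 'm chart = "'m set \<times> ('m \<Rightarrow> real^2)"

definition local_rep :: "'m chart \<Rightarrow> ('m \<Rightarrow> 'b) \<Rightarrow> real^2 \<Rightarrow> 'b" where
  "local_rep = (\<lambda>(U, \<phi>) f. f \<circ> inv_into U \<phi>)"

text \<open>The whole type \<open>'m\<close> is the manifold; being Hausdorff and second countable is expressed by
  its type classes.  The atlas need not be maximal.\<close>

definition smooth_surface_atlas ::
  "'m::{t2_space, second_countable_topology} chart set \<Rightarrow> bool" where
  "smooth_surface_atlas A \<longleftrightarrow>
     (\<Union>(U, \<phi>)\<in>A. U) = UNIV \<and>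
     (\<forall>(U, \<phi>)\<in>A. open U \<and> open (\<phi> ` U) \<and> homeomorphism U (\<phi> ` U) \<phi> (inv_into U \<phi>)) \<and>
     (\<forall>(U, \<phi>)\<in>A. \<forall>(V, \<psi>)\<in>A. smooth_on (\<phi> ` (U \<inter> V)) (local_rep (U, \<phi>) \<psi>))"

section \<open>Immersed surfaces in complex 2-space\<close>

text \<open>The library inner product of \<^typ>\<open>complex^2\<close> is the Euclidean one of real 4-space, and
  \<^const>\<open>subspace\<close>, \<^const>\<open>dim\<close> are taken over the reals.\<close>

definition J :: "complex^2 \<Rightarrow> complex^2" where
  "J w = \<i> *s w"

definition smooth_immersion ::
  "'m::{t2_space, second_countable_topology} chart set \<Rightarrow> ('m \<Rightarrow> complex^2) \<Rightarrow> bool" where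
  "smooth_immersion A x \<longleftrightarrow>
     (\<forall>(U, \<phi>)\<in>A. smooth_on (\<phi> ` U) (local_rep (U, \<phi>) x) \<and>
        (\<forall>u\<in>\<phi> ` U. inj (frechet_derivative (local_rep (U, \<phi>) x) (at u))))"

text \<open>In the following definitions \<open>f\<close> is a local representation of the immersion and \<open>u\<close> a
  point of its coordinate domain; tangent vectors of the surface at that point are given by
  their coordinates \<open>v :: real^2\<close>.\<close>

definition tangent_plane :: "(real^2 \<Rightarrow> complex^2) \<Rightarrow> real^2 \<Rightarrow> (complex^2) set" where
  "tangent_plane f u = range (frechet_derivative f (at u))"

definition normal_part :: "(complex^2) set \<Rightarrow> complex^2 \<Rightarrow> complex^2" where
  "normal_part T w = (THE n. n \<in> orthogonal_comp T \<and> w - n \<in> T)"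

lemma normal_part_unique:
  fixes T :: "(complex^2) set"
  assumes "subspace T"
  shows "\<exists>!n. n \<in> orthogonal_comp T \<and> w - n \<in> T"
proof -
  obtain t n where tn: "t \<in> span T" "\<And>y. y \<in> span T \<Longrightarrow> orthogonal n y" "w = t + n"
    using orthogonal_subspace_decomp_exists[of T w] by metis
  have span: "span T = T" using assms by (simp add: span_eq_iff)
  show ?thesis
  proof (rule ex1I[of _ n])
    show "n \<in> orthogonal_comp T \<and> w - n \<in> T"
      using tn span by (auto simp: orthogonal_comp_def orthogonal_commute)
  next
    fix m assume m: "m \<in> orthogonal_comp T \<and> w - m \<in> T"
    have "w - n \<in> T" using tn span by simp
    then have "(w - n) - (w - m) \<in> T" using m assms subspace_diff by blast
    then have d: "m - n \<in> T" by simp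
    have "(m - n) \<bullet> m = 0" "(m - n) \<bullet> n = 0"
      using m d tn(2)[of "m - n"] span
      by (auto simp: orthogonal_comp_def orthogonal_def inner_commute)
    then have "(m - n) \<bullet> (m - n) = 0" by (simp only: inner_diff_right)
    then show "m = n" by simp
  qed
qed

text \<open>The normal component of the ambient derivative, for tangent fields with constant
  coordinates.\<close>

definition second_fund_form ::
  "(real^2 \<Rightarrow> complex^2) \<Rightarrow> real^2 \<Rightarrow> real^2 \<Rightarrow> real^2 \<Rightarrow> complex^2" where
  "second_fund_form f u v w =
     normal_part (tangent_plane f u)
       (frechet_derivative (\<lambda>y. frechet_derivative f (at y) w) (at u) v)"

text \<open>A tangent frame at a point, \<open>e i = df (v i)\<close>, orthonormal for the induced metric.  All
  quantities below are tensorial, so frames at a single point suffice.\<close>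

definition orthonormal_frame :: "(real^2 \<Rightarrow> complex^2) \<Rightarrow> real^2 \<Rightarrow> (2 \<Rightarrow> real^2) \<Rightarrow> bool" where
  "orthonormal_frame f u v \<longleftrightarrow>
     (\<forall>i j. frechet_derivative f (at u) (v i) \<bullet> frechet_derivative f (at u) (v j) =
        (if i = j then 1 else 0))"

definition normal_frame ::
  "(real^2 \<Rightarrow> complex^2) \<Rightarrow> real^2 \<Rightarrow> (2 \<Rightarrow> real^2) \<Rightarrow> 2 \<Rightarrow> complex^2" where
  "normal_frame f u v p = J (frechet_derivative f (at u) (v p))"

definition h_coeff ::
  "(real^2 \<Rightarrow> complex^2) \<Rightarrow> real^2 \<Rightarrow> (2 \<Rightarrow> real^2) \<Rightarrow> 2 \<Rightarrow> 2 \<Rightarrow> 2 \<Rightarrow> real" where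
  "h_coeff f u v p i j = second_fund_form f u (v i) (v j) \<bullet> normal_frame f u v p"

definition mean_curvature_vector ::
  "(real^2 \<Rightarrow> complex^2) \<Rightarrow> real^2 \<Rightarrow> (2 \<Rightarrow> real^2) \<Rightarrow> complex^2" where
  "mean_curvature_vector f u v =
     (\<Sum>p\<in>UNIV. (\<Sum>i\<in>UNIV. h_coeff f u v p i i) *\<^sub>R normal_frame f u v p)"

definition squared_norm_h :: "(real^2 \<Rightarrow> complex^2) \<Rightarrow> real^2 \<Rightarrow> (2 \<Rightarrow> real^2) \<Rightarrow> real" where
  "squared_norm_h f u v = (\<Sum>i\<in>UNIV. \<Sum>j\<in>UNIV. \<Sum>p\<in>UNIV. (h_coeff f u v p i j)\<^sup>2)"

definition lagrangian ::
  "'m::{t2_space, second_countable_topology} chart set \<Rightarrow> ('m \<Rightarrow> complex^2) \<Rightarrow> bool" where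
  "lagrangian A x \<longleftrightarrow>
     (\<forall>(U, \<phi>)\<in>A. \<forall>u\<in>\<phi> ` U.
        J ` tangent_plane (local_rep (U, \<phi>) x) u =
          orthogonal_comp (tangent_plane (local_rep (U, \<phi>) x) u))"

definition self_expander ::
  "'m::{t2_space, second_countable_topology} chart set \<Rightarrow> ('m \<Rightarrow> complex^2) \<Rightarrow> bool" where
  "self_expander A x \<longleftrightarrow>
     (\<forall>(U, \<phi>)\<in>A. \<forall>u\<in>\<phi> ` U. \<forall>v. orthonormal_frame (local_rep (U, \<phi>) x) u v \<longrightarrow>
        mean_curvature_vector (local_rep (U, \<phi>) x) u v =
          normal_part (tangent_plane (local_rep (U, \<phi>) x) u) (local_rep (U, \<phi>) x u))"

definition constant_squared_norm_h ::
  "'m::{t2_space, second_countable_topology} chart set \<Rightarrow> ('m \<Rightarrow> complex^2) \<Rightarrow> bool" where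
  "constant_squared_norm_h A x \<longleftrightarrow>
     (\<exists>c. \<forall>(U, \<phi>)\<in>A. \<forall>u\<in>\<phi> ` U. \<forall>v. orthonormal_frame (local_rep (U, \<phi>) x) u v \<longrightarrow>
        squared_norm_h (local_rep (U, \<phi>) x) u v = c)"

section \<open>Completeness of the induced metric\<close>

text \<open>The library notion \<^const>\<open>piecewise_C1_differentiable_on\<close> is avoided on purpose: it allows
  an unbounded derivative near the break points, so the speed could fail to be integrable and
  \<^const>\<open>integral\<close> would then silently give length 0.\<close>

definition C1_curve_on ::
  "'m::{t2_space, second_countable_topology} chart set \<Rightarrow> real set \<Rightarrow> (real \<Rightarrow> 'm) \<Rightarrow> bool" where
  "C1_curve_on A I c \<longleftrightarrow>
     continuous_on I c \<and>
     (\<forall>(U, \<phi>)\<in>A. \<exists>c'. continuous_on (I \<inter> c -` U) c' \<and>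
        (\<forall>t\<in>I \<inter> c -` U. ((\<phi> \<circ> c) has_vector_derivative c' t) (at t within I \<inter> c -` U)))"

definition piecewise_C1_curve ::
  "'m::{t2_space, second_countable_topology} chart set \<Rightarrow> (real \<Rightarrow> 'm) \<Rightarrow> bool" where
  "piecewise_C1_curve A c \<longleftrightarrow>
     continuous_on {0..1} c \<and>
     (\<exists>B. finite B \<and>
        (\<forall>s t. 0 \<le> s \<and> s < t \<and> t \<le> 1 \<and> {s<..<t} \<inter> B = {} \<longrightarrow> C1_curve_on A {s..t} c))"

text \<open>The length in the induced metric: the velocity of \<open>c\<close> has induced norm
  \<open>norm (dx (c' t)) = norm ((x \<circ> c)' t)\<close>, and the latter exists off a finite set.\<close>

definition induced_length :: "('m \<Rightarrow> complex^2) \<Rightarrow> (real \<Rightarrow> 'm) \<Rightarrow> real" where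
  "induced_length x c = integral {0..1} (\<lambda>t. norm (vector_derivative (x \<circ> c) (at t)))"

definition induced_dist ::
  "'m::{t2_space, second_countable_topology} chart set \<Rightarrow> ('m \<Rightarrow> complex^2) \<Rightarrow> 'm \<Rightarrow> 'm \<Rightarrow> real"
where
  "induced_dist A x p q =
     Inf {induced_length x c | c. piecewise_C1_curve A c \<and> c 0 = p \<and> c 1 = q}"

definition complete_induced_metric ::
  "'m::{t2_space, second_countable_topology} chart set \<Rightarrow> ('m \<Rightarrow> complex^2) \<Rightarrow> bool" where
  "complete_induced_metric A x \<longleftrightarrow>
     (\<forall>s :: nat \<Rightarrow> 'm.
        (\<forall>e>0. \<exists>N. \<forall>m\<ge>N. \<forall>n\<ge>N. induced_dist A x (s m) (s n) < e) \<longrightarrow>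
        (\<exists>p. (\<lambda>n. induced_dist A x (s n) p) \<longlonglongrightarrow> 0))"

end

theory Submission
  imports Defs
begin

text \<open>If \<open>S = 0\<close>, the tangent plane is locally constant, contains the position vector, and
  completeness makes the immersion onto it. Suppose \<open>S > 0\<close>. In an orthonormal frame the Codazzi
  equations, the derivative of \<open>H = x\<^sup>\<bottom>\<close> and \<open>dS = 0\<close> restrict the covariant derivative \<open>\<nabla>h\<close>, and Simons'
  identity turns into \<open>|\<nabla>h|\<^sup>2 \<ge> S + S\<^sup>2/2\<close> together with an upper bound in terms of \<open>S\<close>.
  Differentiating Simons' identity along the tangential part \<open>x\<^sup>T\<close> of the position vector shows that
  \<open>|x\<^sup>T|\<close>, hence \<open>|x|\<close>, is bounded. Then Ekeland's principle, which needs only first derivatives and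
  completeness, applies to \<open>|x|\<^sup>2 + \<sigma>|x\<^sup>T|\<close>: at an almost maximal point \<open>|x\<^sup>T|\<close> is of order \<open>\<sigma>\<close>,
  so \<open>\<nabla>H\<close> is small and, as \<open>\<nabla>h\<close> is not, \<open>h\<close> is nearly umbilic; but then the derivative in the
  direction of \<open>x\<^sup>T\<close> is at least of order \<open>\<sigma>\<close>, a contradiction.\<close>

section \<open>Smooth functions\<close>

text \<open>At a maximum of |x|^2 the first-order condition gives only x^T = 0, while the
  contradiction sits in the Hessian: for S > 0 and x^T = 0 the relations force h_111 = 3 h_122 and
  h_222 = 3 h_112, and then the Hessian of |x|^2 / 2 is at least 1 on e_1. Using this at infinity
  would call for a maximum principle of Omori-Yau type. The term \<sigma>|x^T| avoids that: |x^T| is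
  half the length of the gradient of |x|^2, so its derivative along x^T / |x^T| is that Hessian
  entry, and second-order information is read off from a first derivative. The price is that |x^T|
  has to be bounded beforehand; this is what the derivative of Simons' identity is for. Both
  pointwise estimates, the bound on |x^T| and the choice of \<sigma>, come from compactness rather
  than from explicit constants: the components of h and \<nabla>h lie in a bounded set fixed by S,
  so counterexamples have a convergent subsequence and only the limiting algebra has to be
  examined.\<close>

lemma Ck_on_cong:
  assumes "open S" "\<And>u. u \<in> S \<Longrightarrow> f u = g u" "Ck_on k S f"
  shows "Ck_on k S g"
  using assms(2,3)
proof (induction k arbitrary: f g)
  case 0
  then show ?case by (simp cong: continuous_on_cong)
next
  case (Suc k)
  have tr: "(g has_derivative frechet_derivative f (at u)) (at u)" if "u \<in> S" for u
  proof (rule has_derivative_transform_within_open[OF _ \<open>open S\<close> that])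
    show "(f has_derivative frechet_derivative f (at u)) (at u)"
      using Suc.prems(2) that frechet_derivative_works by auto
  qed (use Suc.prems in auto)
  then have fd: "frechet_derivative g (at u) = frechet_derivative f (at u)" if "u \<in> S" for u
    using frechet_derivative_at that by metis
  have "Ck_on k S (\<lambda>u. frechet_derivative g (at u) v)" for v
    by (rule Suc.IH[of "\<lambda>u. frechet_derivative f (at u) v"]) (use fd Suc.prems in auto)
  then show ?case
    using tr by (auto simp: differentiable_def)
qed

lemma Ck_on_Suc_imp: "Ck_on (Suc k) S f \<Longrightarrow> Ck_on k S f"
proof (induction k arbitrary: f)
  case 0
  then show ?case
    by (auto intro!: continuous_at_imp_continuous_on differentiable_imp_continuous_within)
next
  case (Suc k)
  then show ?case by (metis Ck_on.simps(2))
qed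

lemma Ck_on_SucI:
  assumes "open S"
    and "\<And>u. u \<in> S \<Longrightarrow> (f has_derivative f' u) (at u)" and "\<And>v. Ck_on k S (\<lambda>u. f' u v)"
  shows "Ck_on (Suc k) S f"
proof -
  have "frechet_derivative f (at u) = f' u" if "u \<in> S" for u
    using assms(2)[OF that] frechet_derivative_at by metis
  then have "Ck_on k S (\<lambda>u. frechet_derivative f (at u) v)" for v
    by (intro Ck_on_cong[OF \<open>open S\<close> _ assms(3)[of v]]) simp
  then show ?thesis
    using assms(2) by (auto simp: differentiable_def)
qed

lemma Ck_on_SucD:
  assumes "Ck_on (Suc k) S f" "u \<in> S"
  shows "(f has_derivative frechet_derivative f (at u)) (at u)"
  using assms frechet_derivative_works by auto

lemma Ck_on_const: "open S \<Longrightarrow> Ck_on k S (\<lambda>u. c)"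
proof (induction k arbitrary: c)
  case (Suc k)
  then show ?case
    by (intro Ck_on_SucI[where f' = "\<lambda>u v. 0"]) (auto intro: derivative_eq_intros)
qed auto

lemma Ck_on_add:
  assumes "open S"
  shows "Ck_on k S f \<Longrightarrow> Ck_on k S g \<Longrightarrow> Ck_on k S (\<lambda>u. f u + g u)"
proof (induction k arbitrary: f g)
  case 0
  then show ?case by (simp add: continuous_on_add)
next
  case (Suc k)
  show ?case
    by (rule Ck_on_SucI[OF assms has_derivative_add[OF Ck_on_SucD[OF Suc.prems(1)] Ck_on_SucD[OF Suc.prems(2)]]])
      (use Suc in auto)
qed

lemma Ck_on_bounded_linear:
  assumes "open S" "bounded_linear L"
  shows "Ck_on k S f \<Longrightarrow> Ck_on k S (\<lambda>u. L (f u))"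
proof (induction k arbitrary: f)
  case 0
  then show ?case using assms(2) by (simp add: bounded_linear.continuous_on)
next
  case (Suc k)
  show ?case
    by (rule Ck_on_SucI[OF assms(1) bounded_linear.has_derivative[OF assms(2) Ck_on_SucD[OF Suc.prems]]])
      (use Suc in auto)
qed

lemma Ck_on_bilinear:
  assumes "open S" "bounded_bilinear p"
  shows "Ck_on k S f \<Longrightarrow> Ck_on k S g \<Longrightarrow> Ck_on k S (\<lambda>u. p (f u) (g u))"
proof (induction k arbitrary: f g)
  case 0
  then show ?case using assms(2) by (simp add: bounded_bilinear.continuous_on)
next
  case (Suc k)
  have "Ck_on k S f" "Ck_on k S g" using Suc.prems Ck_on_Suc_imp by blast+
  then show ?case
    by (intro Ck_on_SucI[OF assms(1) bounded_bilinear.FDERIV[OF assms(2) Ck_on_SucD[OF Suc.prems(1)] Ck_on_SucD[OF Suc.prems(2)]]]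
        Ck_on_add[OF assms(1)] Suc.IH) (use Suc.prems in auto)
qed

lemma Ck_on_inverse:
  fixes f :: "'a::euclidean_space \<Rightarrow> real"
  assumes "open S" "\<And>u. u \<in> S \<Longrightarrow> f u \<noteq> 0"
  shows "Ck_on k S f \<Longrightarrow> Ck_on k S (\<lambda>u. inverse (f u))"
proof (induction k)
  case 0
  then show ?case using assms(2) by (auto intro!: continuous_intros)
next
  case (Suc k)
  have inv: "Ck_on k S (\<lambda>u. inverse (f u))" using Suc Ck_on_Suc_imp by blast
  show ?case
  proof (rule Ck_on_SucI[OF assms(1)])
    show "((\<lambda>u. inverse (f u)) has_derivative
        (\<lambda>v. - (inverse (f u) * frechet_derivative f (at u) v * inverse (f u)))) (at u)" if "u \<in> S" for u
      using Deriv.has_derivative_inverse[OF assms(2)[OF that] Ck_on_SucD[OF Suc.prems that]] .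
    show "Ck_on k S (\<lambda>u. - (inverse (f u) * frechet_derivative f (at u) v * inverse (f u)))" for v
      by (rule Ck_on_bounded_linear[OF assms(1) bounded_linear_minus[OF bounded_linear_ident]])
        (use Suc.prems inv in \<open>auto intro!: Ck_on_bilinear[OF assms(1) bounded_bilinear_mult]\<close>)
  qed
qed

lemma Ck_on_sqrt:
  fixes f :: "'a::euclidean_space \<Rightarrow> real"
  assumes "open S" "\<And>u. u \<in> S \<Longrightarrow> f u > 0"
  shows "Ck_on k S f \<Longrightarrow> Ck_on k S (\<lambda>u. sqrt (f u))"
proof (induction k)
  case 0
  then show ?case by (auto intro!: continuous_intros)
next
  case (Suc k)
  have sq: "Ck_on k S (\<lambda>u. sqrt (f u))" using Suc Ck_on_Suc_imp by blast
  have inv: "Ck_on k S (\<lambda>u. inverse (sqrt (f u)))"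
    using assms(2) by (intro Ck_on_inverse[OF assms(1) _ sq]) force
  show ?case
  proof (rule Ck_on_SucI[OF assms(1)])
    show "((\<lambda>u. sqrt (f u)) has_derivative
        (\<lambda>v. frechet_derivative f (at u) v * (1/2 * inverse (sqrt (f u))))) (at u)" if "u \<in> S" for u
      using assms(2)[OF that]
      by (auto intro!: derivative_eq_intros Ck_on_SucD[OF Suc.prems that] simp: field_simps)
    show "Ck_on k S (\<lambda>u. frechet_derivative f (at u) v * (1/2 * inverse (sqrt (f u))))" for v
      using Suc.prems
      by (intro Ck_on_bilinear[OF assms(1) bounded_bilinear_mult] Ck_on_const[OF assms(1)] inv) simp
  qed
qed

lemma smooth_on_const [intro]: "open S \<Longrightarrow> smooth_on S (\<lambda>u. c)"
  by (simp add: smooth_on_def Ck_on_const)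

lemma smooth_on_add [intro]: "open S \<Longrightarrow> smooth_on S f \<Longrightarrow> smooth_on S g \<Longrightarrow> smooth_on S (\<lambda>u. f u + g u)"
  by (simp add: smooth_on_def Ck_on_add)

lemma smooth_on_bounded_linear:
  "open S \<Longrightarrow> bounded_linear L \<Longrightarrow> smooth_on S f \<Longrightarrow> smooth_on S (\<lambda>u. L (f u))"
  by (simp add: smooth_on_def Ck_on_bounded_linear)

lemma smooth_on_bilinear:
  "open S \<Longrightarrow> bounded_bilinear p \<Longrightarrow> smooth_on S f \<Longrightarrow> smooth_on S g \<Longrightarrow> smooth_on S (\<lambda>u. p (f u) (g u))"
  by (simp add: smooth_on_def Ck_on_bilinear)

lemmas smooth_on_mult [intro] = smooth_on_bilinear[OF _ bounded_bilinear_mult]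
lemmas smooth_on_scaleR [intro] = smooth_on_bilinear[OF _ bounded_bilinear_scaleR]
lemmas smooth_on_inner [intro] = smooth_on_bilinear[OF _ bounded_bilinear_inner]
lemmas smooth_on_minus [intro] = smooth_on_bounded_linear[OF _ bounded_linear_minus[OF bounded_linear_ident]]

lemma smooth_on_diff [intro]:
  "open S \<Longrightarrow> smooth_on S f \<Longrightarrow> smooth_on S g \<Longrightarrow> smooth_on S (\<lambda>u. f u - g u)"
  using smooth_on_add[of S f "\<lambda>u. - g u"] smooth_on_minus[of S g] by simp

lemma smooth_on_power2 [intro]:
  fixes f :: "'a::euclidean_space \<Rightarrow> real"
  shows "open S \<Longrightarrow> smooth_on S f \<Longrightarrow> smooth_on S (\<lambda>u. (f u)\<^sup>2)"
  using smooth_on_mult[of S f f] by (simp add: power2_eq_square)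

lemma smooth_on_inverse_sqrt:
  fixes f :: "'a::euclidean_space \<Rightarrow> real"
  assumes "open S" "\<And>u. u \<in> S \<Longrightarrow> f u > 0" "smooth_on S f"
  shows "smooth_on S (\<lambda>u. inverse (sqrt (f u)))"
  unfolding smooth_on_def
proof
  fix k
  have "sqrt (f u) \<noteq> 0" if "u \<in> S" for u using assms(2)[OF that] by simp
  then show "Ck_on k S (\<lambda>u. inverse (sqrt (f u)))"
    using assms by (intro Ck_on_inverse[OF assms(1)] Ck_on_sqrt[OF assms(1)]) (auto simp: smooth_on_def)
qed

lemma smooth_on_has_derivative:
  "smooth_on S f \<Longrightarrow> u \<in> S \<Longrightarrow> (f has_derivative frechet_derivative f (at u)) (at u)"
  unfolding smooth_on_def using Ck_on_SucD by blast

lemma smooth_on_imp_continuous_on: "smooth_on S f \<Longrightarrow> continuous_on S f"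
  unfolding smooth_on_def using Ck_on.simps(1) by blast

lemma smooth_on_frechet_derivative_const:
  "smooth_on S f \<Longrightarrow> smooth_on S (\<lambda>u. frechet_derivative f (at u) v)"
  unfolding smooth_on_def using Ck_on.simps(2) by blast

lemma vec2_decomp: "(w::real^2) = (w $ 1) *\<^sub>R axis 1 1 + (w $ 2) *\<^sub>R axis 2 1"
  by (simp add: vec_eq_iff forall_2 axis_def)

lemma linear_vec2:
  assumes "linear (L :: real^2 \<Rightarrow> 'b::real_vector)"
  shows "L w = (w $ 1) *\<^sub>R L (axis 1 1) + (w $ 2) *\<^sub>R L (axis 2 1)"
  by (subst vec2_decomp) (simp add: linear_add[OF assms] linear_cmul[OF assms])

lemma smooth_on_cong:
  assumes "open S" "\<And>u. u \<in> S \<Longrightarrow> f u = g u" "smooth_on S f"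
  shows "smooth_on S g"
  using assms Ck_on_cong unfolding smooth_on_def by blast

text \<open>The direction varies with the point; in coordinates the derivative is a combination of
  two partial derivatives, each smooth by the definition of smoothness.\<close>

lemma smooth_on_frechet_derivative [intro]:
  fixes f :: "real^2 \<Rightarrow> 'b::real_normed_vector"
  assumes "open S" "smooth_on S f" "smooth_on S v"
  shows "smooth_on S (\<lambda>u. frechet_derivative f (at u) (v u))"
proof (rule smooth_on_cong[OF assms(1)])
  show "(v u $ 1) *\<^sub>R frechet_derivative f (at u) (axis 1 1)
      + (v u $ 2) *\<^sub>R frechet_derivative f (at u) (axis 2 1) = frechet_derivative f (at u) (v u)"
    if "u \<in> S" for u
    using linear_vec2[OF has_derivative_linear[OF smooth_on_has_derivative[OF assms(2) that]], of "v u"] by simp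
  show "smooth_on S (\<lambda>u. (v u $ 1) *\<^sub>R frechet_derivative f (at u) (axis 1 1)
      + (v u $ 2) *\<^sub>R frechet_derivative f (at u) (axis 2 1))"
    using assms by (intro smooth_on_add smooth_on_scaleR smooth_on_frechet_derivative_const
        smooth_on_bounded_linear[OF _ bounded_linear_vec_nth])
qed

text \<open>Two mean value steps, first along \<open>v\<close> and then along \<open>w\<close>, turn
  the second difference into the mixed derivative at a nearby point, and continuity finishes. The
  quotient is chosen for its symmetry: exchanging \<open>v\<close> and \<open>w\<close> only
  reorders its terms.\<close>

lemma mixed_difference_quotient:
  fixes f :: "real^2 \<Rightarrow> real"
  assumes "open S" "smooth_on S f" "u \<in> S" "e > 0"
  shows "\<exists>\<delta>>0. \<forall>r. 0 < r \<and> r < \<delta> \<longrightarrow>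
    \<bar>(f (u + r *\<^sub>R v + r *\<^sub>R w) - f (u + r *\<^sub>R v) - f (u + r *\<^sub>R w) + f u) / r\<^sup>2
      - frechet_derivative (\<lambda>y. frechet_derivative f (at y) v) (at u) w\<bar> < e"
proof -
  define g where "g = (\<lambda>y. frechet_derivative f (at y) v)"
  define G where "G = (\<lambda>y. frechet_derivative g (at y) w)"
  have g: "smooth_on S g" unfolding g_def by (rule smooth_on_frechet_derivative_const[OF assms(2)])
  have "continuous_on S G" unfolding G_def
    by (intro smooth_on_imp_continuous_on smooth_on_frechet_derivative_const g)
  then have "isCont G u" using assms(1,3) continuous_on_eq_continuous_at by blast
  then obtain d where d: "d > 0" "\<And>y. dist y u < d \<Longrightarrow> \<bar>G y - G u\<bar> < e"
    using \<open>e > 0\<close> unfolding continuous_at_eps_delta dist_real_def by metis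
  obtain d' where d': "d' > 0" "ball u d' \<subseteq> S" using assms(1,3) open_contains_ball by blast
  define \<delta> where "\<delta> = min d d' / (norm v + norm w + 1)"
  have \<delta>: "\<delta> > 0" unfolding \<delta>_def using d d' by (simp add: add_nonneg_pos)
  have near: "dist (u + s *\<^sub>R v + t *\<^sub>R w) u < min d d'"
    if "0 \<le> s" "s \<le> r" "0 \<le> t" "t \<le> r" "r < \<delta>" for s t r
  proof -
    have "dist (u + s *\<^sub>R v + t *\<^sub>R w) u = norm (s *\<^sub>R v + t *\<^sub>R w)"
      by (simp add: dist_norm add.assoc)
    also have "\<dots> \<le> s * norm v + t * norm w"
      using norm_triangle_ineq[of "s *\<^sub>R v" "t *\<^sub>R w"] that by simp
    also have "\<dots> \<le> r * (norm v + norm w + 1)"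
      using that mult_right_mono[of s r "norm v"] mult_right_mono[of t r "norm w"] by (simp add: algebra_simps)
    also have "\<dots> < min d d'"
      using that(5) unfolding \<delta>_def
      by (subst (asm) pos_less_divide_eq) (auto simp: add_nonneg_pos)
    finally show ?thesis .
  qed
  have "\<bar>(f (u + r *\<^sub>R v + r *\<^sub>R w) - f (u + r *\<^sub>R v) - f (u + r *\<^sub>R w) + f u) / r\<^sup>2 - G u\<bar> < e"
    if r: "0 < r" "r < \<delta>" for r
  proof -
    have inS: "u + s *\<^sub>R v + t *\<^sub>R w \<in> S" if "0 \<le> s" "s \<le> r" "0 \<le> t" "t \<le> r" for s t
      using near[of s r t] that r d'(2) by (auto simp: mem_ball dist_commute subset_iff)
    have inS0: "u + s *\<^sub>R v \<in> S" if "0 \<le> s" "s \<le> r" for s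
      using inS[of s 0] that r by simp
    define p where "p = (\<lambda>s. f (u + s *\<^sub>R v + r *\<^sub>R w) - f (u + s *\<^sub>R v))"
    have dp: "(p has_real_derivative g (u + s *\<^sub>R v + r *\<^sub>R w) - g (u + s *\<^sub>R v)) (at s)"
      if "0 \<le> s" "s \<le> r" for s
    proof -
      have aux: "((\<lambda>s. f (u + s *\<^sub>R v + z)) has_real_derivative g (u + s *\<^sub>R v + z)) (at s)"
        if "u + s *\<^sub>R v + z \<in> S" for z
      proof -
        have 1: "((\<lambda>s. u + s *\<^sub>R v + z) has_derivative (\<lambda>t. t *\<^sub>R v)) (at s)"
          by (auto intro!: derivative_eq_intros)
        have 2: "(f has_derivative frechet_derivative f (at (u + s *\<^sub>R v + z))) (at (u + s *\<^sub>R v + z))"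
          by (rule smooth_on_has_derivative[OF assms(2) that])
        show ?thesis
          using has_derivative_compose[OF 1 2] linear_cmul[OF has_derivative_linear[OF 2]]
          unfolding has_field_derivative_def g_def by (simp add: mult_commute_abs)
      qed
      show ?thesis unfolding p_def
        using aux[of "r *\<^sub>R w"] aux[of 0] inS[of s r] inS0[of s] that r by (auto intro!: derivative_eq_intros)
    qed
    obtain s where s: "0 < s" "s < r" "p r - p 0 = r * (g (u + s *\<^sub>R v + r *\<^sub>R w) - g (u + s *\<^sub>R v))"
      using MVT2[OF r(1) dp] by auto
    have dq: "((\<lambda>t. g (u + s *\<^sub>R v + t *\<^sub>R w)) has_real_derivative G (u + s *\<^sub>R v + t *\<^sub>R w)) (at t)"
      if "0 \<le> t" "t \<le> r" for t
    proof -
      have 1: "((\<lambda>t. u + s *\<^sub>R v + t *\<^sub>R w) has_derivative (\<lambda>t. t *\<^sub>R w)) (at t)"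
        by (auto intro!: derivative_eq_intros)
      have 2: "(g has_derivative frechet_derivative g (at (u + s *\<^sub>R v + t *\<^sub>R w))) (at (u + s *\<^sub>R v + t *\<^sub>R w))"
        by (rule smooth_on_has_derivative[OF g inS]) (use s that in auto)
      show ?thesis
        using has_derivative_compose[OF 1 2] linear_cmul[OF has_derivative_linear[OF 2]]
        unfolding has_field_derivative_def G_def by (simp add: mult_commute_abs)
    qed
    obtain t where t: "0 < t" "t < r"
      "g (u + s *\<^sub>R v + r *\<^sub>R w) - g (u + s *\<^sub>R v + 0 *\<^sub>R w) = r * G (u + s *\<^sub>R v + t *\<^sub>R w)"
      using MVT2[OF r(1) dq] by auto
    have "p r - p 0 = r\<^sup>2 * G (u + s *\<^sub>R v + t *\<^sub>R w)"
      using s(3) t(3) by (simp add: power2_eq_square)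
    then have "(f (u + r *\<^sub>R v + r *\<^sub>R w) - f (u + r *\<^sub>R v) - f (u + r *\<^sub>R w) + f u) / r\<^sup>2
        = G (u + s *\<^sub>R v + t *\<^sub>R w)"
      using r unfolding p_def by (simp add: field_simps)
    then show ?thesis
      using d(2)[of "u + s *\<^sub>R v + t *\<^sub>R w"] near[of s r t] s t r by simp
  qed
  then show ?thesis using \<delta> unfolding G_def g_def by blast
qed

text \<open>One and the same second difference approximates both iterated derivatives, so it cannot
  be within half their gap of each of them.\<close>

lemma frechet_derivative_symmetric_real:
  fixes f :: "real^2 \<Rightarrow> real"
  assumes "open S" "smooth_on S f" "u \<in> S"
  shows "frechet_derivative (\<lambda>y. frechet_derivative f (at y) v) (at u) w
       = frechet_derivative (\<lambda>y. frechet_derivative f (at y) w) (at u) v" (is "?L = ?R")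
proof (rule ccontr)
  assume "?L \<noteq> ?R"
  define e where "e = \<bar>?L - ?R\<bar> / 2"
  have e: "e > 0" using \<open>?L \<noteq> ?R\<close> unfolding e_def by simp
  obtain d1 where d1: "d1 > 0" "\<And>r. 0 < r \<Longrightarrow> r < d1 \<Longrightarrow>
      \<bar>(f (u + r *\<^sub>R v + r *\<^sub>R w) - f (u + r *\<^sub>R v) - f (u + r *\<^sub>R w) + f u) / r\<^sup>2 - ?L\<bar> < e"
    using mixed_difference_quotient[OF assms e, of v w] by blast
  obtain d2 where d2: "d2 > 0" "\<And>r. 0 < r \<Longrightarrow> r < d2 \<Longrightarrow>
      \<bar>(f (u + r *\<^sub>R w + r *\<^sub>R v) - f (u + r *\<^sub>R w) - f (u + r *\<^sub>R v) + f u) / r\<^sup>2 - ?R\<bar> < e"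
    using mixed_difference_quotient[OF assms e, of w v] by blast
  define r where "r = min d1 d2 / 2"
  have r: "0 < r" "r < d1" "r < d2" using d1 d2 unfolding r_def by auto
  define q where "q = (f (u + r *\<^sub>R v + r *\<^sub>R w) - f (u + r *\<^sub>R v) - f (u + r *\<^sub>R w) + f u) / r\<^sup>2"
  have sw: "u + r *\<^sub>R w + r *\<^sub>R v = u + r *\<^sub>R v + r *\<^sub>R w" by simp
  have "(f (u + r *\<^sub>R w + r *\<^sub>R v) - f (u + r *\<^sub>R w) - f (u + r *\<^sub>R v) + f u) / r\<^sup>2 = q"
    unfolding q_def sw by (rule arg_cong[where f = "\<lambda>t. t / r\<^sup>2"]) linarith
  then have "\<bar>q - ?R\<bar> < e" using d2(2)[OF r(1,3)] by simp
  moreover have "\<bar>q - ?L\<bar> < e" using d1(2)[OF r(1,2)] unfolding q_def .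
  ultimately show False unfolding e_def by (smt (verit) field_sum_of_halves)
qed

lemma frechet_derivative_inner_const:
  assumes "(f has_derivative f') (at u)"
  shows "frechet_derivative (\<lambda>y. f y \<bullet> c) (at u) = (\<lambda>v. f' v \<bullet> c)"
  by (rule sym, rule frechet_derivative_at) (auto intro!: derivative_eq_intros assms)

lemma frechet_derivative_symmetric:
  fixes f :: "real^2 \<Rightarrow> 'b::euclidean_space"
  assumes "open S" "smooth_on S f" "u \<in> S"
  shows "frechet_derivative (\<lambda>y. frechet_derivative f (at y) v) (at u) w
       = frechet_derivative (\<lambda>y. frechet_derivative f (at y) w) (at u) v"
proof (rule euclidean_eqI)
  fix b :: 'b
  have sm: "smooth_on S (\<lambda>y. f y \<bullet> b)"
    by (intro smooth_on_inner assms smooth_on_const)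
  have "frechet_derivative (\<lambda>y. frechet_derivative (\<lambda>y. f y \<bullet> b) (at y) v) (at u) w
    = frechet_derivative (\<lambda>y. frechet_derivative f (at y) v) (at u) w \<bullet> b" for v w
  proof -
    have eq: "frechet_derivative (\<lambda>y. f y \<bullet> b) (at y) v = frechet_derivative f (at y) v \<bullet> b" if "y \<in> S" for y
      using frechet_derivative_inner_const[OF smooth_on_has_derivative[OF assms(2) that]] by simp
    have "((\<lambda>y. frechet_derivative f (at y) v \<bullet> b) has_derivative
        (\<lambda>w. frechet_derivative (\<lambda>y. frechet_derivative f (at y) v) (at u) w \<bullet> b)) (at u)"
      using smooth_on_has_derivative[OF smooth_on_frechet_derivative_const[OF assms(2)] assms(3)]
      by (auto intro!: derivative_eq_intros)
    then have "((\<lambda>y. frechet_derivative (\<lambda>y. f y \<bullet> b) (at y) v) has_derivative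
        (\<lambda>w. frechet_derivative (\<lambda>y. frechet_derivative f (at y) v) (at u) w \<bullet> b)) (at u)"
      by (rule has_derivative_transform_within_open[OF _ assms(1,3)]) (simp add: eq)
    then show ?thesis using frechet_derivative_at by metis
  qed
  then show "frechet_derivative (\<lambda>y. frechet_derivative f (at y) v) (at u) w \<bullet> b
      = frechet_derivative (\<lambda>y. frechet_derivative f (at y) w) (at u) v \<bullet> b"
    using frechet_derivative_symmetric_real[OF assms(1) sm assms(3)] by metis
qed

section \<open>The complex structure\<close>

lemma bounded_linear_J: "bounded_linear J"
proof -
  have "linear J"
    by (rule linearI) (simp_all add: J_def vec_eq_iff algebra_simps)
  then show ?thesis by (simp add: linear_conv_bounded_linear)
qed

lemma J_inner_J [simp]: "J p \<bullet> J q = p \<bullet> q"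
  by (simp add: J_def inner_vec_def inner_complex_def algebra_simps)

lemma inner_J_right: "p \<bullet> J q = - (J p \<bullet> q)"
  by (simp add: J_def inner_vec_def inner_complex_def sum_2)

lemma inner_J_self [simp]: "p \<bullet> J p = 0" "J p \<bullet> p = 0"
  by (simp_all add: J_def inner_vec_def inner_complex_def)

text \<open>\<open>J\<close> is a skew isometry, so \<open>e1\<close>, \<open>e2\<close>,
  \<open>J e1\<close>, \<open>J e2\<close> are orthonormal and, by counting, a basis of real
  4-space.\<close>

lemma lagrangian_parseval:
  fixes p q :: "complex^2"
  assumes n: "e1 \<bullet> e1 = 1" "e2 \<bullet> e2 = 1" "e1 \<bullet> e2 = 0" "e1 \<bullet> J e2 = 0"
  shows "p \<bullet> q = (p \<bullet> e1) * (q \<bullet> e1) + (p \<bullet> e2) * (q \<bullet> e2)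
      + (p \<bullet> J e1) * (q \<bullet> J e1) + (p \<bullet> J e2) * (q \<bullet> J e2)"
proof -
  have m: "e2 \<bullet> e1 = 0" "J e2 \<bullet> e1 = 0" "J e1 \<bullet> e2 = 0" "e2 \<bullet> J e1 = 0"
    using n inner_J_right[of e1 e2] by (simp_all add: inner_commute)
  define B where "B = {e1, e2, J e1, J e2}"
  have ne: "e1 \<noteq> e2" "e1 \<noteq> J e1" "e1 \<noteq> J e2" "e2 \<noteq> J e1" "e2 \<noteq> J e2" "J e1 \<noteq> J e2"
    using n m by (metis J_inner_J inner_J_self zero_neq_one)+
  have card: "card B = 4" unfolding B_def using ne by simp
  have "pairwise orthogonal B"
    unfolding B_def pairwise_def orthogonal_def using n m by (auto simp: inner_commute)
  moreover have "0 \<notin> B" unfolding B_def using n by (auto simp: J_inner_J dest!: sym[of 0])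
      (metis J_inner_J inner_zero_left zero_neq_one)+
  ultimately have indep: "independent B" by (rule pairwise_orthogonal_independent)
  have "DIM(complex^2) = 4" by simp
  then have span: "span B = UNIV"
    using card_ge_dim_independent[of B UNIV] indep card by auto
  define r where "r = q - ((q \<bullet> e1) *\<^sub>R e1 + (q \<bullet> e2) *\<^sub>R e2 + (q \<bullet> J e1) *\<^sub>R J e1 + (q \<bullet> J e2) *\<^sub>R J e2)"
  have "orthogonal r w" if "w \<in> B" for w
    using that n m unfolding B_def r_def orthogonal_def
    by (auto simp: inner_diff_left inner_add_left)
  then have "orthogonal r r" using orthogonal_to_span[of r B r] span by auto
  then have "q = (q \<bullet> e1) *\<^sub>R e1 + (q \<bullet> e2) *\<^sub>R e2 + (q \<bullet> J e1) *\<^sub>R J e1 + (q \<bullet> J e2) *\<^sub>R J e2"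
    unfolding r_def orthogonal_def by simp
  then have "p \<bullet> q = p \<bullet> ((q \<bullet> e1) *\<^sub>R e1 + (q \<bullet> e2) *\<^sub>R e2 + (q \<bullet> J e1) *\<^sub>R J e1 + (q \<bullet> J e2) *\<^sub>R J e2)"
    by simp
  also have "\<dots> = (p \<bullet> e1) * (q \<bullet> e1) + (p \<bullet> e2) * (q \<bullet> e2)
      + (p \<bullet> J e1) * (q \<bullet> J e1) + (p \<bullet> J e2) * (q \<bullet> J e2)"
    by (simp add: inner_add_right mult.commute)
  finally show ?thesis .
qed

section \<open>Derivatives along vector fields\<close>

definition dir_deriv :: "(real^2 \<Rightarrow> real^2) \<Rightarrow> (real^2 \<Rightarrow> 'b) \<Rightarrow> real^2 \<Rightarrow> 'b::real_normed_vector" where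
  "dir_deriv v f u = frechet_derivative f (at u) (v u)"

lemma dir_deriv_eq: "(f has_derivative f') (at u) \<Longrightarrow> dir_deriv v f u = f' (v u)"
  unfolding dir_deriv_def by (metis frechet_derivative_at)

lemma smooth_on_dir_deriv [intro]:
  "open S \<Longrightarrow> smooth_on S v \<Longrightarrow> smooth_on S f \<Longrightarrow> smooth_on S (dir_deriv v f)"
  unfolding dir_deriv_def by (rule smooth_on_frechet_derivative)

lemma dir_deriv_cong:
  assumes "open S" "u \<in> S" "\<And>y. y \<in> S \<Longrightarrow> f y = g y" "smooth_on S f"
  shows "dir_deriv v f u = dir_deriv v g u"
proof -
  have "(f has_derivative frechet_derivative f (at u)) (at u)"
    using smooth_on_has_derivative[OF assms(4,2)] .
  then have "(g has_derivative frechet_derivative f (at u)) (at u)"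
    by (rule has_derivative_transform_within_open[OF _ assms(1,2)]) (rule assms(3))
  then show ?thesis by (simp add: dir_deriv_eq) (simp add: dir_deriv_def)
qed

lemma dir_deriv_const: "dir_deriv v (\<lambda>u. c) u = 0"
  by (rule dir_deriv_eq) simp

lemma dir_deriv_add:
  assumes "smooth_on S f" "smooth_on S g" "u \<in> S"
  shows "dir_deriv v (\<lambda>u. f u + g u) u = dir_deriv v f u + dir_deriv v g u"
  using dir_deriv_eq[OF has_derivative_add[OF smooth_on_has_derivative[OF assms(1,3)] smooth_on_has_derivative[OF assms(2,3)]]]
  by (simp add: dir_deriv_def)

lemma dir_deriv_diff:
  assumes "smooth_on S f" "smooth_on S g" "u \<in> S"
  shows "dir_deriv v (\<lambda>u. f u - g u) u = dir_deriv v f u - dir_deriv v g u"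
  using dir_deriv_eq[OF has_derivative_diff[OF smooth_on_has_derivative[OF assms(1,3)] smooth_on_has_derivative[OF assms(2,3)]]]
  by (simp add: dir_deriv_def)

lemma dir_deriv_minus:
  assumes "smooth_on S f" "u \<in> S"
  shows "dir_deriv v (\<lambda>u. - f u) u = - dir_deriv v f u"
  using dir_deriv_eq[OF has_derivative_minus[OF smooth_on_has_derivative[OF assms]]]
  by (simp add: dir_deriv_def)

lemma dir_deriv_bilinear:
  assumes "bounded_bilinear p" "smooth_on S f" "smooth_on S g" "u \<in> S"
  shows "dir_deriv v (\<lambda>u. p (f u) (g u)) u = p (f u) (dir_deriv v g u) + p (dir_deriv v f u) (g u)"
  using dir_deriv_eq[OF bounded_bilinear.FDERIV[OF assms(1) smooth_on_has_derivative[OF assms(2,4)] smooth_on_has_derivative[OF assms(3,4)]]]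
  by (simp add: dir_deriv_def)

lemmas dir_deriv_inner = dir_deriv_bilinear[OF bounded_bilinear_inner]
lemmas dir_deriv_scaleR = dir_deriv_bilinear[OF bounded_bilinear_scaleR]

lemma dir_deriv_mult:
  fixes f g :: "real^2 \<Rightarrow> real"
  assumes "smooth_on S f" "smooth_on S g" "u \<in> S"
  shows "dir_deriv v (\<lambda>u. f u * g u) u = dir_deriv v f u * g u + f u * dir_deriv v g u"
  using dir_deriv_bilinear[OF bounded_bilinear_mult assms] by simp

lemma dir_deriv_power2:
  fixes f :: "real^2 \<Rightarrow> real"
  assumes "smooth_on S f" "u \<in> S"
  shows "dir_deriv v (\<lambda>u. (f u)\<^sup>2) u = 2 * f u * dir_deriv v f u"
  using dir_deriv_mult[OF assms(1) assms(1) assms(2)] by (simp add: power2_eq_square)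

lemma dir_deriv_J:
  assumes "smooth_on S f" "u \<in> S"
  shows "dir_deriv v (\<lambda>u. J (f u)) u = J (dir_deriv v f u)"
  using dir_deriv_eq[OF bounded_linear.has_derivative[OF bounded_linear_J smooth_on_has_derivative[OF assms]]]
  by (simp add: dir_deriv_def)

text \<open>A product rule for the pairing of the differential of \<open>f\<close> with the field
  \<open>v\<close>. Writing \<open>v\<close> in the two coordinate directions reduces it to products
  of scalar and vector functions, so that no operator-valued map has to be differentiated.\<close>

lemma dir_deriv_dir_deriv:
  fixes f :: "real^2 \<Rightarrow> 'b::euclidean_space"
  assumes "open S" "smooth_on S f" "smooth_on S v" "u \<in> S"
  shows "dir_deriv w (dir_deriv v f) u = frechet_derivative f (at u) (dir_deriv w v u)
      + frechet_derivative (\<lambda>y. frechet_derivative f (at y) (v u)) (at u) (w u)"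
proof -
  define p where "p = (\<lambda>i y. frechet_derivative f (at y) (axis i 1))"
  have ps: "smooth_on S (p i)" for i unfolding p_def by (rule smooth_on_frechet_derivative_const[OF assms(2)])
  have fl: "linear (frechet_derivative f (at y))" if "y \<in> S" for y
    using has_derivative_linear[OF smooth_on_has_derivative[OF assms(2) that]] .
  have fd: "frechet_derivative f (at y) z = (z $ 1) *\<^sub>R p 1 y + (z $ 2) *\<^sub>R p 2 y" if "y \<in> S" for y z
    unfolding p_def by (rule linear_vec2[OF fl[OF that]])
  have vs: "smooth_on S (\<lambda>y. v y $ i)" for i
    by (rule smooth_on_bounded_linear[OF assms(1) bounded_linear_vec_nth assms(3)])
  have dv: "dir_deriv w (\<lambda>y. v y $ i) u = dir_deriv w v u $ i" for i
    using dir_deriv_eq[OF bounded_linear.has_derivative[OF bounded_linear_vec_nth[of i] smooth_on_has_derivative[OF assms(3,4)]]]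
    by (simp add: dir_deriv_def)
  have sm: "smooth_on S (\<lambda>y. (v y $ 1) *\<^sub>R p 1 y)" "smooth_on S (\<lambda>y. (v y $ 2) *\<^sub>R p 2 y)"
    using assms(1) vs ps by auto
  have "dir_deriv w (dir_deriv v f) u = dir_deriv w (\<lambda>y. (v y $ 1) *\<^sub>R p 1 y + (v y $ 2) *\<^sub>R p 2 y) u"
    by (rule dir_deriv_cong[OF assms(1,4)]) (use assms fd in \<open>auto simp: dir_deriv_def[of v]\<close>)
  also have "\<dots> = (v u $ 1) *\<^sub>R dir_deriv w (p 1) u + (dir_deriv w v u $ 1) *\<^sub>R p 1 u
      + ((v u $ 2) *\<^sub>R dir_deriv w (p 2) u + (dir_deriv w v u $ 2) *\<^sub>R p 2 u)"
    by (simp add: dir_deriv_add[OF sm assms(4)] dir_deriv_scaleR[OF vs ps assms(4)] dv)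
  also have "\<dots> = frechet_derivative f (at u) (dir_deriv w v u)
      + ((v u $ 1) *\<^sub>R dir_deriv w (p 1) u + (v u $ 2) *\<^sub>R dir_deriv w (p 2) u)"
    by (simp add: fd[OF assms(4)])
  also have "(v u $ 1) *\<^sub>R dir_deriv w (p 1) u + (v u $ 2) *\<^sub>R dir_deriv w (p 2) u
     = dir_deriv w (\<lambda>y. (v u $ 1) *\<^sub>R p 1 y + (v u $ 2) *\<^sub>R p 2 y) u"
  proof -
    have "smooth_on S (\<lambda>y. (v u $ i) *\<^sub>R p i y)" for i using assms(1) ps by auto
    then show ?thesis
      using assms(1) by (simp add: dir_deriv_add[OF _ _ assms(4)] dir_deriv_const
          dir_deriv_scaleR[OF smooth_on_const ps assms(4)])
  qed
  also have "\<dots> = dir_deriv w (\<lambda>y. frechet_derivative f (at y) (v u)) u"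
    by (rule dir_deriv_cong[OF assms(1,4)])
      (use assms ps in \<open>auto simp: fd intro!: smooth_on_add smooth_on_scaleR\<close>)
  finally show ?thesis by (simp add: dir_deriv_def[of w])
qed

text \<open>The second-derivative terms are symmetric and cancel; only the Lie bracket of the two
  fields survives.\<close>

lemma dir_deriv_commutator:
  fixes f :: "real^2 \<Rightarrow> 'b::euclidean_space"
  assumes "open S" "smooth_on S f" "smooth_on S v" "smooth_on S w" "u \<in> S"
  shows "dir_deriv w (dir_deriv v f) u - dir_deriv v (dir_deriv w f) u
      = frechet_derivative f (at u) (dir_deriv w v u - dir_deriv v w u)"
  using dir_deriv_dir_deriv[OF assms(1,2,3,5), of w] dir_deriv_dir_deriv[OF assms(1,2,4,5), of v]
    frechet_derivative_symmetric[OF assms(1,2,5), of "v u" "w u"]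
    linear_diff[OF has_derivative_linear[OF smooth_on_has_derivative[OF assms(2,5)]]]
  by simp

section \<open>Structure equations in a local orthonormal frame\<close>

text \<open>Isotropy stands for the Lagrangian condition: in real dimension four, an orthonormal
  frame of an isotropic plane is mapped by \<open>J\<close> to a frame of the whole normal
  space.\<close>

locale lagrangian_frame =
  fixes \<Omega> :: "(real^2) set" and X :: "real^2 \<Rightarrow> complex^2" and v :: "2 \<Rightarrow> real^2 \<Rightarrow> real^2"
  assumes open_dom: "open \<Omega>"
    and smooth_X: "smooth_on \<Omega> X"
    and smooth_v: "\<And>i. smooth_on \<Omega> (v i)"
    and orthonormal: "\<And>u i j. u \<in> \<Omega> \<Longrightarrow> dir_deriv (v i) X u \<bullet> dir_deriv (v j) X u = (if i = j then 1 else 0)"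
    and isotropic: "\<And>u i j. u \<in> \<Omega> \<Longrightarrow> dir_deriv (v i) X u \<bullet> J (dir_deriv (v j) X u) = 0"
begin

abbreviation D :: "2 \<Rightarrow> (real^2 \<Rightarrow> 'b) \<Rightarrow> real^2 \<Rightarrow> 'b::real_normed_vector" where
  "D i \<equiv> dir_deriv (v i)"

definition e :: "2 \<Rightarrow> real^2 \<Rightarrow> complex^2" where "e i = D i X"

definition h :: "2 \<Rightarrow> 2 \<Rightarrow> 2 \<Rightarrow> real^2 \<Rightarrow> real" where
  "h i j k u = D i (e j) u \<bullet> J (e k u)"

text \<open>The connection coefficients of the frame: the tangential part of the Euclidean
  derivative is the Levi-Civita connection.\<close>

definition \<omega> :: "2 \<Rightarrow> 2 \<Rightarrow> 2 \<Rightarrow> real^2 \<Rightarrow> real" where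
  "\<omega> i j k u = D i (e j) u \<bullet> e k u"

definition y :: "2 \<Rightarrow> real^2 \<Rightarrow> real" where "y i u = X u \<bullet> e i u"

definition nu :: "2 \<Rightarrow> real^2 \<Rightarrow> real" where "nu i u = X u \<bullet> J (e i u)"

lemma smooth_D: "smooth_on \<Omega> f \<Longrightarrow> smooth_on \<Omega> (D i f)"
  by (intro smooth_on_dir_deriv open_dom smooth_v)

lemma smooth_e: "smooth_on \<Omega> (e i)"
  unfolding e_def by (intro smooth_D smooth_X)

lemma smooth_J: "smooth_on \<Omega> f \<Longrightarrow> smooth_on \<Omega> (\<lambda>u. J (f u))"
  by (rule smooth_on_bounded_linear[OF open_dom bounded_linear_J])

lemma smooth_h: "smooth_on \<Omega> (h i j k)"
  unfolding h_def[abs_def] by (intro smooth_on_inner open_dom smooth_D smooth_e smooth_J)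

lemma smooth_\<omega>: "smooth_on \<Omega> (\<omega> i j k)"
  unfolding \<omega>_def[abs_def] by (intro smooth_on_inner open_dom smooth_D smooth_e)

lemma smooth_y: "smooth_on \<Omega> (y i)"
  unfolding y_def[abs_def] by (intro smooth_on_inner open_dom smooth_X smooth_e)

lemma smooth_nu: "smooth_on \<Omega> (nu i)"
  unfolding nu_def[abs_def] by (intro smooth_on_inner open_dom smooth_X smooth_e smooth_J)

lemma e_inner_e: "u \<in> \<Omega> \<Longrightarrow> e i u \<bullet> e j u = (if i = j then 1 else 0)"
  unfolding e_def by (rule orthonormal)

lemma e_inner_J: "u \<in> \<Omega> \<Longrightarrow> e i u \<bullet> J (e j u) = 0" "u \<in> \<Omega> \<Longrightarrow> J (e j u) \<bullet> e i u = 0"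
  unfolding e_def using isotropic by (simp_all add: inner_commute)

lemma parseval:
  assumes "u \<in> \<Omega>"
  shows "p \<bullet> q = (\<Sum>m\<in>UNIV. (p \<bullet> e m u) * (q \<bullet> e m u) + (p \<bullet> J (e m u)) * (q \<bullet> J (e m u)))"
proof -
  have "e 1 u \<bullet> e 1 u = 1" "e 2 u \<bullet> e 2 u = 1" "e 1 u \<bullet> e 2 u = 0" "e 1 u \<bullet> J (e 2 u) = 0"
    using e_inner_e[OF assms] e_inner_J[OF assms] by auto
  from lagrangian_parseval[OF this, of p q] show ?thesis by (simp add: sum_2)
qed

lemma D_inner:
  assumes "smooth_on \<Omega> f" "smooth_on \<Omega> g" "u \<in> \<Omega>"
  shows "D i (\<lambda>u. f u \<bullet> g u) u = D i f u \<bullet> g u + f u \<bullet> D i g u"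
  using dir_deriv_inner[OF assms] by simp

lemma D_eq_0: "(\<And>u. u \<in> \<Omega> \<Longrightarrow> f u = c) \<Longrightarrow> u \<in> \<Omega> \<Longrightarrow> D i f u = 0"
  using dir_deriv_cong[OF open_dom _ _ smooth_on_const[OF open_dom, of c], of u f "v i"] dir_deriv_const[of "v i" c u]
  by simp

lemma \<omega>_antisym: "u \<in> \<Omega> \<Longrightarrow> \<omega> i k j u = - \<omega> i j k u"
  using D_inner[OF smooth_e smooth_e, of u i j k] D_eq_0[of "\<lambda>u. e j u \<bullet> e k u" "if j = k then 1 else 0" u i] e_inner_e
  by (simp add: \<omega>_def inner_commute)

lemma \<omega>_refl: "u \<in> \<Omega> \<Longrightarrow> \<omega> i j j u = 0"
  using \<omega>_antisym[of u i j j] by simp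

text \<open>Differentiate the isotropy relation and move \<open>J\<close> across the inner product.
  This symmetry is special to Lagrangian surfaces; together with \<open>h_sym_left\<close> it makes
  \<open>h\<close> a symmetric cubic form.\<close>

lemma h_sym_right:
  assumes "u \<in> \<Omega>"
  shows "h i k j u = h i j k u"
proof -
  have "D i (e j) u \<bullet> J (e k u) + e j u \<bullet> J (D i (e k) u) = 0"
    using D_inner[OF smooth_e smooth_J[OF smooth_e] assms, of i j k]
      D_eq_0[of "\<lambda>u. e j u \<bullet> J (e k u)" 0 u i] e_inner_J assms
    by (simp add: dir_deriv_J[OF smooth_e])
  then show ?thesis
    unfolding h_def inner_J_right[of "e j u"] inner_commute[of "J (e j u)"] by simp
qed

lemma D_D_X: "u \<in> \<Omega> \<Longrightarrow> D 1 (e 2) u - D 2 (e 1) u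
    = frechet_derivative X (at u) (D 1 (v 2) u - D 2 (v 1) u)"
  unfolding e_def by (rule dir_deriv_commutator[OF open_dom smooth_X smooth_v smooth_v])

lemma frame_independent:
  assumes "u \<in> \<Omega>"
  shows "\<exists>p q. w = p *\<^sub>R v 1 u + q *\<^sub>R v 2 u"
proof -
  have lin: "linear (frechet_derivative X (at u))"
    using has_derivative_linear[OF smooth_on_has_derivative[OF smooth_X assms]] .
  have ne: "v 1 u \<noteq> v 2 u" using e_inner_e[OF assms, of 1 1] e_inner_e[OF assms, of 1 2]
    by (auto simp: e_def dir_deriv_def)
  have "independent {v 1 u, v 2 u}"
  proof (rule independent_if_scalars_zero)
    fix f x assume z: "(\<Sum>x\<in>{v 1 u, v 2 u}. f x *\<^sub>R x) = 0" and x: "x \<in> {v 1 u, v 2 u}"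
    have "frechet_derivative X (at u) (f (v 1 u) *\<^sub>R v 1 u + f (v 2 u) *\<^sub>R v 2 u) = 0"
      using z ne linear_0[OF lin] by simp
    then have "f (v 1 u) *\<^sub>R e 1 u + f (v 2 u) *\<^sub>R e 2 u = 0"
      by (simp add: linear_add[OF lin] linear_cmul[OF lin] e_def dir_deriv_def)
    then have "(f (v 1 u) *\<^sub>R e 1 u + f (v 2 u) *\<^sub>R e 2 u) \<bullet> e i u = 0" for i by simp
    from this[of 1] this[of 2] show "f x = 0"
      using x by (auto simp: inner_add_left e_inner_e[OF assms])
  qed simp
  then have "span {v 1 u, v 2 u} = UNIV"
    using card_ge_dim_independent[of "{v 1 u, v 2 u}" UNIV] ne by auto
  then have "w \<in> span {v 1 u, v 2 u}" by simp
  then obtain p where "w - p *\<^sub>R v 1 u \<in> span {v 2 u}" using span_breakdown_eq by blast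
  then obtain q where "w - p *\<^sub>R v 1 u = q *\<^sub>R v 2 u" unfolding span_singleton by blast
  then have "w = p *\<^sub>R v 1 u + q *\<^sub>R v 2 u" by (simp add: algebra_simps)
  then show ?thesis by blast
qed

lemma tangent_plane_eq_span:
  assumes "u \<in> \<Omega>"
  shows "w \<in> tangent_plane X u \<longleftrightarrow> (\<exists>p q. w = p *\<^sub>R e 1 u + q *\<^sub>R e 2 u)"
proof -
  have lin: "linear (frechet_derivative X (at u))"
    using has_derivative_linear[OF smooth_on_has_derivative[OF smooth_X assms]] .
  have eq: "frechet_derivative X (at u) (p *\<^sub>R v 1 u + q *\<^sub>R v 2 u) = p *\<^sub>R e 1 u + q *\<^sub>R e 2 u" for p q
    by (simp add: linear_add[OF lin] linear_cmul[OF lin] e_def dir_deriv_def)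
  show ?thesis
  proof
    assume "w \<in> tangent_plane X u"
    then obtain z where z: "w = frechet_derivative X (at u) z" unfolding tangent_plane_def by blast
    obtain p q where "z = p *\<^sub>R v 1 u + q *\<^sub>R v 2 u" using frame_independent[OF assms] by blast
    then show "\<exists>p q. w = p *\<^sub>R e 1 u + q *\<^sub>R e 2 u" using z eq by blast
  next
    assume "\<exists>p q. w = p *\<^sub>R e 1 u + q *\<^sub>R e 2 u"
    then show "w \<in> tangent_plane X u" unfolding tangent_plane_def using eq[symmetric] by blast
  qed
qed

lemma frame_expansion:
  assumes "u \<in> \<Omega>"
  shows "w = ((frechet_derivative X (at u) w) \<bullet> e 1 u) *\<^sub>R v 1 u + ((frechet_derivative X (at u) w) \<bullet> e 2 u) *\<^sub>R v 2 u"
proof -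
  have lin: "linear (frechet_derivative X (at u))"
    using has_derivative_linear[OF smooth_on_has_derivative[OF smooth_X assms]] .
  obtain p q where w: "w = p *\<^sub>R v 1 u + q *\<^sub>R v 2 u" using frame_independent[OF assms] by blast
  have X: "frechet_derivative X (at u) w = p *\<^sub>R e 1 u + q *\<^sub>R e 2 u"
    unfolding w by (simp add: linear_add[OF lin] linear_cmul[OF lin] e_def dir_deriv_def)
  show ?thesis unfolding X using w by (simp add: inner_add_left e_inner_e[OF assms])
qed

text \<open>The differential of \<open>X\<close> sends the Lie bracket of the frame to
  \<open>D 1 (e 2) u - D 2 (e 1) u\<close>, whose tangential coordinates are connection
  coefficients. This is the torsion-free property; it lets iterated derivatives be commuted without
  leaving the frame.\<close>

lemma bracket:
  assumes "u \<in> \<Omega>"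
  shows "D 1 (v 2) u - D 2 (v 1) u = - \<omega> 1 1 2 u *\<^sub>R v 1 u - \<omega> 2 1 2 u *\<^sub>R v 2 u"
proof -
  have "(D 1 (e 2) u - D 2 (e 1) u) \<bullet> e 1 u = - \<omega> 1 1 2 u"
    "(D 1 (e 2) u - D 2 (e 1) u) \<bullet> e 2 u = - \<omega> 2 1 2 u"
    using \<omega>_refl[OF assms] \<omega>_antisym[OF assms, of 1 1 2] by (simp_all add: inner_diff_left \<omega>_def)
  then show ?thesis
    using frame_expansion[OF assms, of "D 1 (v 2) u - D 2 (v 1) u"] D_D_X[OF assms] by simp
qed

lemma commutator:
  fixes f :: "real^2 \<Rightarrow> 'b::euclidean_space"
  assumes "smooth_on \<Omega> f" "u \<in> \<Omega>"
  shows "D 1 (D 2 f) u - D 2 (D 1 f) u = - \<omega> 1 1 2 u *\<^sub>R D 1 f u - \<omega> 2 1 2 u *\<^sub>R D 2 f u"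
proof -
  have lin: "linear (frechet_derivative f (at u))"
    using has_derivative_linear[OF smooth_on_has_derivative[OF assms]] .
  have "D 1 (D 2 f) u - D 2 (D 1 f) u
      = frechet_derivative f (at u) (- \<omega> 1 1 2 u *\<^sub>R v 1 u - \<omega> 2 1 2 u *\<^sub>R v 2 u)"
    using dir_deriv_commutator[OF open_dom assms(1) smooth_v smooth_v assms(2), of 1 2] bracket[OF assms(2)]
    by simp
  then show ?thesis
    by (simp add: linear_diff[OF lin] linear_cmul[OF lin] linear_neg[OF lin] dir_deriv_def[of _ f])
qed

text \<open>The bracket is tangential, so the normal components of \<open>D 1 (e 2) u\<close> and
  \<open>D 2 (e 1) u\<close> agree.\<close>

lemma h_sym_left:
  assumes "u \<in> \<Omega>"
  shows "h j i k u = h i j k u"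
proof -
  have "D 1 (e 2) u - D 2 (e 1) u = - \<omega> 1 1 2 u *\<^sub>R e 1 u - \<omega> 2 1 2 u *\<^sub>R e 2 u"
    using commutator[OF smooth_X assms] unfolding e_def .
  then have "(D 1 (e 2) u - D 2 (e 1) u) \<bullet> J (e k u) = 0"
    by (simp add: inner_diff_left e_inner_J[OF assms])
  then have "h 1 2 k u = h 2 1 k u" by (simp add: h_def inner_diff_left)
  then show ?thesis using exhaust_2[of i] exhaust_2[of j] by auto
qed

lemma D_e_inner_J_D_e:
  assumes "u \<in> \<Omega>"
  shows "D l (e j) u \<bullet> J (D i (e k) u) = (\<Sum>m\<in>UNIV. h l j m u * \<omega> i k m u - \<omega> l j m u * h i k m u)"
proof -
  have "J (D i (e k) u) \<bullet> e m u = - h i k m u" "J (D i (e k) u) \<bullet> J (e m u) = \<omega> i k m u" for m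
    using inner_J_right[of "D i (e k) u" "e m u"] by (simp_all add: h_def \<omega>_def)
  then show ?thesis
    by (subst parseval[OF assms]) (simp add: h_def[symmetric] \<omega>_def[symmetric] algebra_simps)
qed

lemma D_e_inner_D_e:
  assumes "u \<in> \<Omega>"
  shows "D l (e j) u \<bullet> D i (e k) u = (\<Sum>m\<in>UNIV. \<omega> l j m u * \<omega> i k m u + h l j m u * h i k m u)"
  by (subst parseval[OF assms]) (simp add: h_def \<omega>_def)

lemma D_h:
  assumes "u \<in> \<Omega>"
  shows "D i (h l j k) u = D i (D l (e j)) u \<bullet> J (e k u)
     + (\<Sum>m\<in>UNIV. h l j m u * \<omega> i k m u - \<omega> l j m u * h i k m u)"
proof -
  have "h l j k = (\<lambda>u. D l (e j) u \<bullet> J (e k u))" by (simp add: h_def fun_eq_iff)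
  then show ?thesis
    using D_inner[OF smooth_D[OF smooth_e] smooth_J[OF smooth_e] assms, of i l j k]
    by (simp only: dir_deriv_J[OF smooth_e assms] D_e_inner_J_D_e[OF assms])
qed

lemma D_\<omega>:
  assumes "u \<in> \<Omega>"
  shows "D i (\<omega> l j k) u = D i (D l (e j)) u \<bullet> e k u
     + (\<Sum>m\<in>UNIV. \<omega> l j m u * \<omega> i k m u + h l j m u * h i k m u)"
proof -
  have "\<omega> l j k = (\<lambda>u. D l (e j) u \<bullet> e k u)" by (simp add: \<omega>_def fun_eq_iff)
  then show ?thesis
    using D_inner[OF smooth_D[OF smooth_e] smooth_e assms, of i l j k]
    by (simp only: D_e_inner_D_e[OF assms])
qed

text \<open>The ambient space is flat, so second derivatives commute up to the bracket. A normal
  \<open>w\<close> will give the Codazzi equations, a tangential \<open>w\<close> the Gauss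
  equation.\<close>

lemma commutator_e_inner:
  assumes "u \<in> \<Omega>"
  shows "D 1 (D 2 (e j)) u \<bullet> w - D 2 (D 1 (e j)) u \<bullet> w = - \<omega> 1 1 2 u * (D 1 (e j) u \<bullet> w) - \<omega> 2 1 2 u * (D 2 (e j) u \<bullet> w)"
  using arg_cong[OF commutator[OF smooth_e assms, of j], of "\<lambda>z. z \<bullet> w"] by (simp add: inner_diff_left)

lemma codazzi:
  assumes "u \<in> \<Omega>"
  shows "D 1 (h 2 j k) u - D 2 (h 1 j k) u = - \<omega> 1 1 2 u * h 1 j k u - \<omega> 2 1 2 u * h 2 j k u
    + (\<Sum>m\<in>UNIV. h 2 j m u * \<omega> 1 k m u - \<omega> 2 j m u * h 1 k m u)
    - (\<Sum>m\<in>UNIV. h 1 j m u * \<omega> 2 k m u - \<omega> 1 j m u * h 2 k m u)"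
  using commutator_e_inner[OF assms, of j "J (e k u)"] unfolding D_h[OF assms] h_def by linarith

lemma gauss:
  assumes "u \<in> \<Omega>"
  shows "D 1 (\<omega> 2 1 2) u - D 2 (\<omega> 1 1 2) u = - (\<omega> 1 1 2 u)\<^sup>2 - (\<omega> 2 1 2 u)\<^sup>2
    - (h 1 1 1 u * h 2 2 1 u - (h 1 2 1 u)\<^sup>2 + h 1 1 2 u * h 2 2 2 u - (h 1 2 2 u)\<^sup>2)"
  using commutator_e_inner[OF assms, of 1 "e 2 u"] D_\<omega>[OF assms, of 1 2 1 2] D_\<omega>[OF assms, of 2 1 1 2]
  by (simp add: sum_2 \<omega>_def[symmetric] \<omega>_refl[OF assms] \<omega>_antisym[OF assms, of _ 2 1] h_sym_left[OF assms, of 2 1]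
     power2_eq_square)

lemma D_y:
  assumes "u \<in> \<Omega>"
  shows "D i (y j) u = (if i = j then 1 else 0) + (\<Sum>m\<in>UNIV. \<omega> i j m u * y m u + h i j m u * nu m u)"
proof -
  have "D i (y j) u = e i u \<bullet> e j u + X u \<bullet> D i (e j) u"
    unfolding y_def[abs_def] D_inner[OF smooth_X smooth_e assms] e_def[of i] by simp
  also have "X u \<bullet> D i (e j) u = (\<Sum>m\<in>UNIV. \<omega> i j m u * y m u + h i j m u * nu m u)"
    by (subst parseval[OF assms]) (simp add: h_def \<omega>_def y_def nu_def mult.commute)
  finally show ?thesis using e_inner_e[OF assms] by simp
qed

lemma D_nu:
  assumes "u \<in> \<Omega>"
  shows "D i (nu j) u = (\<Sum>m\<in>UNIV. \<omega> i j m u * nu m u - h i j m u * y m u)"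
proof -
  have "D i (nu j) u = X u \<bullet> J (D i (e j) u)"
    unfolding nu_def[abs_def] D_inner[OF smooth_X smooth_J[OF smooth_e] assms] dir_deriv_J[OF smooth_e assms]
    using e_inner_J(1)[OF assms, of i j] by (simp add: e_def[of i])
  also have "\<dots> = (\<Sum>m\<in>UNIV. \<omega> i j m u * nu m u - h i j m u * y m u)"
  proof -
    have "J (D i (e j) u) \<bullet> e m u = - h i j m u" "J (D i (e j) u) \<bullet> J (e m u) = \<omega> i j m u" for m
      using inner_J_right[of "D i (e j) u" "e m u"] by (simp_all add: h_def \<omega>_def)
    then show ?thesis
      by (subst parseval[OF assms]) (simp add: y_def nu_def algebra_simps)
  qed
  finally show ?thesis .
qed

text \<open>Differentiating \<open>e j\<close> also differentiates the coordinates of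
  \<open>v j\<close>, but this contributes a tangential vector, invisible to
  \<open>J (e k u)\<close>. Hence \<open>h\<close> agrees with the coefficient formed from fields
  with frozen coordinates, as in \<open>second_fund_form\<close>.\<close>

lemma D_frechet:
  assumes "u \<in> \<Omega>"
  shows "h i j k u = frechet_derivative (\<lambda>z. frechet_derivative X (at z) (v j u)) (at u) (v i u) \<bullet> J (e k u)"
proof -
  obtain p q where "D i (v j) u = p *\<^sub>R v 1 u + q *\<^sub>R v 2 u" using frame_independent[OF assms] by blast
  moreover have lin: "linear (frechet_derivative X (at u))"
    using has_derivative_linear[OF smooth_on_has_derivative[OF smooth_X assms]] .
  ultimately have "frechet_derivative X (at u) (D i (v j) u) = p *\<^sub>R e 1 u + q *\<^sub>R e 2 u"
    by (simp add: linear_add[OF lin] linear_cmul[OF lin] e_def dir_deriv_def)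
  then have "frechet_derivative X (at u) (D i (v j) u) \<bullet> J (e k u) = 0"
    by (simp add: inner_add_left e_inner_J[OF assms])
  then show ?thesis
    using dir_deriv_dir_deriv[OF open_dom smooth_X smooth_v assms, of "v i" j]
    by (simp add: h_def e_def inner_add_left)
qed

end

section \<open>Self-expanders with constant S in an orthonormal frame\<close>

locale expander_frame = lagrangian_frame +
  fixes S :: real
  assumes expander: "\<And>u p. u \<in> \<Omega> \<Longrightarrow> nu p u = h 1 1 p u + h 2 2 p u"
    and const_norm: "\<And>u. u \<in> \<Omega> \<Longrightarrow> (\<Sum>i\<in>UNIV. \<Sum>j\<in>UNIV. \<Sum>p\<in>UNIV. (h i j p u)\<^sup>2) = S"
begin

text \<open>A symmetric cubic form in two variables has four coefficients; by antisymmetry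
  \<open>g\<close> and \<open>k\<close> determine the whole connection.\<close>

abbreviation "a \<equiv> h 1 1 1"
abbreviation "b \<equiv> h 1 1 2"
abbreviation "c \<equiv> h 1 2 2"
abbreviation "d \<equiv> h 2 2 2"
abbreviation "g \<equiv> \<omega> 1 1 2"
abbreviation "k \<equiv> \<omega> 2 1 2"

lemma h_normal:
  assumes "u \<in> \<Omega>"
  shows "h 1 2 1 u = b u" "h 2 1 1 u = b u" "h 2 1 2 u = c u" "h 2 2 1 u = c u"
  using h_sym_left[OF assms] h_sym_right[OF assms] by metis+

lemma \<omega>_normal:
  assumes "u \<in> \<Omega>"
  shows "\<omega> i 1 1 u = 0" "\<omega> i 2 2 u = 0" "\<omega> i 2 1 u = - \<omega> i 1 2 u"
  using \<omega>_refl[OF assms] \<omega>_antisym[OF assms] by metis+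

text \<open>The components of the covariant derivative of the second fundamental form: \<open>hA\<close>, ..., \<open>hE\<close> are
  its values on \<open>(e\<^sub>1, e\<^sub>1, e\<^sub>1, e\<^sub>1)\<close>, \<open>(e\<^sub>1, e\<^sub>1, e\<^sub>1, e\<^sub>2)\<close>, ..., \<open>(e\<^sub>2, e\<^sub>2, e\<^sub>2, e\<^sub>2)\<close>.\<close>

definition "hA u = D 1 a u - 3 * g u * b u"
definition "hB u = D 2 a u - 3 * k u * b u"
definition "hC u = D 2 b u + k u * a u - 2 * k u * c u"
definition "hD u = D 2 c u + 2 * k u * b u - k u * d u"
definition "hE u = D 2 d u + 3 * k u * c u"

lemmas smooth_intros = open_dom smooth_D smooth_h smooth_\<omega> smooth_y smooth_on_add smooth_on_diff smooth_on_minus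
  smooth_on_mult smooth_on_const smooth_on_power2

lemma smooth_cov: "smooth_on \<Omega> hA" "smooth_on \<Omega> hB" "smooth_on \<Omega> hC" "smooth_on \<Omega> hD" "smooth_on \<Omega> hE"
  unfolding hA_def[abs_def] hB_def[abs_def] hC_def[abs_def] hD_def[abs_def] hE_def[abs_def]
  by (intro smooth_intros)+

lemmas D_rules = dir_deriv_add[where S = \<Omega>] dir_deriv_diff[where S = \<Omega>] dir_deriv_minus[where S = \<Omega>]
  dir_deriv_mult[where S = \<Omega>] dir_deriv_power2[where S = \<Omega>] dir_deriv_const smooth_intros smooth_cov

text \<open>The Codazzi equations make the covariant derivative of \<open>h\<close> totally
  symmetric, so its five components, corrected by connection terms, account for all eight first
  derivatives of \<open>a\<close>, \<open>b\<close>, \<open>c\<close>, \<open>d\<close>.\<close>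

lemma D1_D2_h:
  assumes "u \<in> \<Omega>"
  shows "D 1 a u = hA u + 3 * g u * b u" "D 2 a u = hB u + 3 * k u * b u"
    "D 1 b u = hB u - g u * a u + 2 * g u * c u" "D 2 b u = hC u - k u * a u + 2 * k u * c u"
    "D 1 c u = hC u - 2 * g u * b u + g u * d u" "D 2 c u = hD u - 2 * k u * b u + k u * d u"
    "D 1 d u = hD u - 3 * g u * c u" "D 2 d u = hE u - 3 * k u * c u"
proof -
  have sw: "D 1 (h 2 1 1) u = D 1 b u" "D 1 (h 2 1 2) u = D 1 c u"
    by (rule dir_deriv_cong[OF open_dom assms _ smooth_h], simp add: h_normal)+
  show "D 1 a u = hA u + 3 * g u * b u" "D 2 a u = hB u + 3 * k u * b u"
    "D 2 b u = hC u - k u * a u + 2 * k u * c u"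
    "D 2 c u = hD u - 2 * k u * b u + k u * d u" "D 2 d u = hE u - 3 * k u * c u"
    by (simp_all add: hA_def hB_def hC_def hD_def hE_def)
  show "D 1 b u = hB u - g u * a u + 2 * g u * c u"
    using codazzi[OF assms, of 1 1] by (simp add: sum_2 h_normal[OF assms] \<omega>_normal[OF assms] sw hB_def algebra_simps)
  show "D 1 c u = hC u - 2 * g u * b u + g u * d u"
    using codazzi[OF assms, of 1 2] by (simp add: sum_2 h_normal[OF assms] \<omega>_normal[OF assms] sw hC_def algebra_simps)
  show "D 1 d u = hD u - 3 * g u * c u"
    using codazzi[OF assms, of 2 2] by (simp add: sum_2 h_normal[OF assms] \<omega>_normal[OF assms] sw hD_def algebra_simps)
qed

lemma nu_eq:
  assumes "u \<in> \<Omega>"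
  shows "nu 1 u = a u + c u" "nu 2 u = b u + d u"
  using expander[OF assms] h_normal[OF assms] by simp_all

lemma D_y':
  assumes "u \<in> \<Omega>"
  shows "D 1 (y 1) u = 1 + g u * y 2 u + a u * (a u + c u) + b u * (b u + d u)"
    "D 1 (y 2) u = - (g u * y 1 u) + b u * (a u + c u) + c u * (b u + d u)"
    "D 2 (y 1) u = k u * y 2 u + b u * (a u + c u) + c u * (b u + d u)"
    "D 2 (y 2) u = 1 - k u * y 1 u + c u * (a u + c u) + d u * (b u + d u)"
  by (simp_all add: D_y[OF assms] sum_2 h_normal[OF assms] \<omega>_normal[OF assms] nu_eq[OF assms])

text \<open>This is the covariant derivative of the expander equation: the derivative of
  \<open>H\<close> is a trace of the derivative of \<open>h\<close>, and that of the normal position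
  is, by \<open>D_nu\<close>, minus \<open>h\<close> contracted with the tangential position. The
  connection terms of the two sides cancel.\<close>

lemma trace_cov:
  assumes "u \<in> \<Omega>"
  shows "hA u + hC u = - (a u * y 1 u + b u * y 2 u)"
    "hB u + hD u = - (b u * y 1 u + c u * y 2 u)"
    "hC u + hE u = - (c u * y 1 u + d u * y 2 u)"
proof -
  have n1: "D i (nu 1) u = D i (\<lambda>u. a u + c u) u" for i
    by (rule dir_deriv_cong[OF open_dom assms nu_eq(1) smooth_nu])
  have n2: "D i (nu 2) u = D i (\<lambda>u. b u + d u) u" for i
    by (rule dir_deriv_cong[OF open_dom assms nu_eq(2) smooth_nu])
  show "hA u + hC u = - (a u * y 1 u + b u * y 2 u)"
    using n1[of 1] unfolding D_nu[OF assms]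
    by (simp add: D_rules assms sum_2 h_normal[OF assms] \<omega>_normal[OF assms] nu_eq[OF assms] D1_D2_h[OF assms] algebra_simps)
  show "hB u + hD u = - (b u * y 1 u + c u * y 2 u)"
    using n1[of 2] unfolding D_nu[OF assms]
    by (simp add: D_rules assms sum_2 h_normal[OF assms] \<omega>_normal[OF assms] nu_eq[OF assms] D1_D2_h[OF assms] algebra_simps)
  show "hC u + hE u = - (c u * y 1 u + d u * y 2 u)"
    using n2[of 2] unfolding D_nu[OF assms]
    by (simp add: D_rules assms sum_2 h_normal[OF assms] \<omega>_normal[OF assms] nu_eq[OF assms] D1_D2_h[OF assms] algebra_simps)
qed

lemma norm_eq:
  assumes "u \<in> \<Omega>"
  shows "(a u)\<^sup>2 + 3 * (b u)\<^sup>2 + 3 * (c u)\<^sup>2 + (d u)\<^sup>2 = S"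
  using const_norm[OF assms] by (simp add: sum_2 h_normal[OF assms])

lemma norm_cov:
  assumes "u \<in> \<Omega>"
  shows "a u * hA u + 3 * b u * hB u + 3 * c u * hC u + d u * hD u = 0"
    "a u * hB u + 3 * b u * hC u + 3 * c u * hD u + d u * hE u = 0"
proof -
  have z: "D i (\<lambda>u. (a u)\<^sup>2 + 3 * (b u)\<^sup>2 + 3 * (c u)\<^sup>2 + (d u)\<^sup>2) u = 0" for i
    by (rule D_eq_0[OF norm_eq assms])
  show "a u * hA u + 3 * b u * hB u + 3 * c u * hC u + d u * hD u = 0"
    using z[of 1] by (simp add: D_rules assms D1_D2_h[OF assms] algebra_simps)
  show "a u * hB u + 3 * b u * hC u + 3 * c u * hD u + d u * hE u = 0"
    using z[of 2] by (simp add: D_rules assms D1_D2_h[OF assms] algebra_simps)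
qed

text \<open>Second covariant derivatives: the last digit is the direction of differentiation.\<close>

definition "hA1 u = D 1 hA u - 4 * g u * hB u"
definition "hB1 u = D 1 hB u + g u * hA u - 3 * g u * hC u"
definition "hC1 u = D 1 hC u + 2 * g u * hB u - 2 * g u * hD u"
definition "hD1 u = D 1 hD u + 3 * g u * hC u - g u * hE u"
definition "hE1 u = D 1 hE u + 4 * g u * hD u"
definition "hA2 u = D 2 hA u - 4 * k u * hB u"
definition "hB2 u = D 2 hB u + k u * hA u - 3 * k u * hC u"
definition "hC2 u = D 2 hC u + 2 * k u * hB u - 2 * k u * hD u"
definition "hD2 u = D 2 hD u + 3 * k u * hC u - k u * hE u"
definition "hE2 u = D 2 hE u + 4 * k u * hD u"

lemmas cov2_defs = hA1_def hB1_def hC1_def hD1_def hE1_def hA2_def hB2_def hC2_def hD2_def hE2_def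

definition "gauss_curv u = a u * c u + b u * d u - (b u)\<^sup>2 - (c u)\<^sup>2"

lemma D1_k:
  assumes "u \<in> \<Omega>"
  shows "D 1 k u = D 2 g u - (g u)\<^sup>2 - (k u)\<^sup>2 - gauss_curv u"
  using gauss[OF assms] by (simp add: gauss_curv_def h_normal[OF assms])

lemma D_D_h:
  assumes "u \<in> \<Omega>"
  shows "D 1 (D 2 (h i j l)) u = D 2 (D 1 (h i j l)) u - g u * D 1 (h i j l) u - k u * D 2 (h i j l) u"
  using commutator[OF smooth_h assms, of i j l] by simp

text \<open>Each component of \<open>h\<close> is differentiated in both orders. Derivatives of the
  connection coefficients enter only in the combination fixed by the Gauss equation
  (\<open>D1_k\<close>), which leaves the curvature terms.\<close>

lemma ricci:
  assumes "u \<in> \<Omega>"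
  shows "hB1 u = hA2 u + 3 * gauss_curv u * b u"
    "hC1 u = hB2 u + gauss_curv u * (2 * c u - a u)"
    "hD1 u = hC2 u + gauss_curv u * (d u - 2 * b u)"
    "hE1 u = hD2 u - 3 * gauss_curv u * c u"
proof -
  have "D 1 (D 2 a) u = D 1 (\<lambda>u. hB u + 3 * k u * b u) u" "D 2 (D 1 a) u = D 2 (\<lambda>u. hA u + 3 * g u * b u) u"
    by (rule dir_deriv_cong[OF open_dom assms _ smooth_D[OF smooth_h]], simp add: D1_D2_h)+
  then show "hB1 u = hA2 u + 3 * gauss_curv u * b u"
    using D_D_h[OF assms, of 1 1 1]
    by (simp add: D_rules assms D1_D2_h[OF assms] D1_k[OF assms] hB1_def hA2_def) (simp add: algebra_simps power2_eq_square)
  have "D 1 (D 2 b) u = D 1 (\<lambda>u. hC u - k u * a u + 2 * k u * c u) u"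
    "D 2 (D 1 b) u = D 2 (\<lambda>u. hB u - g u * a u + 2 * g u * c u) u"
    by (rule dir_deriv_cong[OF open_dom assms _ smooth_D[OF smooth_h]], simp add: D1_D2_h)+
  then show "hC1 u = hB2 u + gauss_curv u * (2 * c u - a u)"
    using D_D_h[OF assms, of 1 1 2]
    by (simp add: D_rules assms D1_D2_h[OF assms] D1_k[OF assms] hC1_def hB2_def) (simp add: algebra_simps power2_eq_square)
  have "D 1 (D 2 c) u = D 1 (\<lambda>u. hD u - 2 * k u * b u + k u * d u) u"
    "D 2 (D 1 c) u = D 2 (\<lambda>u. hC u - 2 * g u * b u + g u * d u) u"
    by (rule dir_deriv_cong[OF open_dom assms _ smooth_D[OF smooth_h]], simp add: D1_D2_h)+
  then show "hD1 u = hC2 u + gauss_curv u * (d u - 2 * b u)"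
    using D_D_h[OF assms, of 1 2 2]
    by (simp add: D_rules assms D1_D2_h[OF assms] D1_k[OF assms] hD1_def hC2_def) (simp add: algebra_simps power2_eq_square)
  have "D 1 (D 2 d) u = D 1 (\<lambda>u. hE u - 3 * k u * c u) u"
    "D 2 (D 1 d) u = D 2 (\<lambda>u. hD u - 3 * g u * c u) u"
    by (rule dir_deriv_cong[OF open_dom assms _ smooth_D[OF smooth_h]], simp add: D1_D2_h)+
  then show "hE1 u = hD2 u - 3 * gauss_curv u * c u"
    using D_D_h[OF assms, of 2 2 2]
    by (simp add: D_rules assms D1_D2_h[OF assms] D1_k[OF assms] hE1_def hD2_def) (simp add: algebra_simps power2_eq_square)
qed

text \<open>The Hessian of half the squared norm of the position: the metric plus the inner products
  of the second fundamental form with the normal position, which is \<open>H\<close>. It is also the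
  covariant derivative of the tangential position.\<close>

definition "m11 u = 1 + a u * (a u + c u) + b u * (b u + d u)"
definition "m12 u = b u * (a u + c u) + c u * (b u + d u)"
definition "m22 u = 1 + c u * (a u + c u) + d u * (b u + d u)"

text \<open>These are covariant derivatives of \<open>trace_cov\<close>. The undifferentiated
  relations enter again to cancel the connection terms that remain after the product rule.\<close>

lemma trace_cov2:
  assumes "u \<in> \<Omega>"
  shows "hA1 u + hC1 u = - (hA u * y 1 u + hB u * y 2 u) - (a u * m11 u + b u * m12 u)"
    "hB1 u + hD1 u = - (hB u * y 1 u + hC u * y 2 u) - (b u * m11 u + c u * m12 u)"
    "hC1 u + hE1 u = - (hC u * y 1 u + hD u * y 2 u) - (c u * m11 u + d u * m12 u)"
    "hB2 u + hD2 u = - (hC u * y 1 u + hD u * y 2 u) - (b u * m12 u + c u * m22 u)"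
    "hC2 u + hE2 u = - (hD u * y 1 u + hE u * y 2 u) - (c u * m12 u + d u * m22 u)"
proof -
  have 1: "D i (\<lambda>u. hA u + hC u) u = D i (\<lambda>u. - (a u * y 1 u + b u * y 2 u)) u" for i
    by (rule dir_deriv_cong[OF open_dom assms trace_cov(1)]) (simp_all add: D_rules)
  have 2: "D i (\<lambda>u. hB u + hD u) u = D i (\<lambda>u. - (b u * y 1 u + c u * y 2 u)) u" for i
    by (rule dir_deriv_cong[OF open_dom assms trace_cov(2)]) (simp_all add: D_rules)
  have 3: "D i (\<lambda>u. hC u + hE u) u = D i (\<lambda>u. - (c u * y 1 u + d u * y 2 u)) u" for i
    by (rule dir_deriv_cong[OF open_dom assms trace_cov(3)]) (simp_all add: D_rules)
  note s = D_rules assms D1_D2_h[OF assms] D_y'[OF assms]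
  show "hA1 u + hC1 u = - (hA u * y 1 u + hB u * y 2 u) - (a u * m11 u + b u * m12 u)"
    using 1[of 1] trace_cov(2)[OF assms] unfolding cov2_defs m11_def m12_def
    by (simp add: s) algebra
  show "hB1 u + hD1 u = - (hB u * y 1 u + hC u * y 2 u) - (b u * m11 u + c u * m12 u)"
    using 2[of 1] trace_cov[OF assms] unfolding cov2_defs m11_def m12_def
    by (simp add: s) algebra
  show "hC1 u + hE1 u = - (hC u * y 1 u + hD u * y 2 u) - (c u * m11 u + d u * m12 u)"
    using 3[of 1] trace_cov[OF assms] unfolding cov2_defs m11_def m12_def
    by (simp add: s) algebra
  show "hB2 u + hD2 u = - (hC u * y 1 u + hD u * y 2 u) - (b u * m12 u + c u * m22 u)"
    using 2[of 2] trace_cov[OF assms] unfolding cov2_defs m22_def m12_def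
    by (simp add: s) algebra
  show "hC2 u + hE2 u = - (hD u * y 1 u + hE u * y 2 u) - (c u * m12 u + d u * m22 u)"
    using 3[of 2] trace_cov[OF assms] unfolding cov2_defs m22_def m12_def
    by (simp add: s) algebra
qed

lemma norm_cov2:
  assumes "u \<in> \<Omega>"
  shows "a u * hA1 u + 3 * b u * hB1 u + 3 * c u * hC1 u + d u * hD1 u
      + (hA u)\<^sup>2 + 3 * (hB u)\<^sup>2 + 3 * (hC u)\<^sup>2 + (hD u)\<^sup>2 = 0"
    "a u * hB1 u + 3 * b u * hC1 u + 3 * c u * hD1 u + d u * hE1 u
      + hA u * hB u + 3 * hB u * hC u + 3 * hC u * hD u + hD u * hE u = 0"
    "a u * hB2 u + 3 * b u * hC2 u + 3 * c u * hD2 u + d u * hE2 u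
      + (hB u)\<^sup>2 + 3 * (hC u)\<^sup>2 + 3 * (hD u)\<^sup>2 + (hE u)\<^sup>2 = 0"
proof -
  have 1: "D i (\<lambda>u. a u * hA u + 3 * b u * hB u + 3 * c u * hC u + d u * hD u) u = 0" for i
    by (rule D_eq_0[OF norm_cov(1) assms])
  have 2: "D i (\<lambda>u. a u * hB u + 3 * b u * hC u + 3 * c u * hD u + d u * hE u) u = 0" for i
    by (rule D_eq_0[OF norm_cov(2) assms])
  note s = D_rules assms D1_D2_h[OF assms]
  show "a u * hA1 u + 3 * b u * hB1 u + 3 * c u * hC1 u + d u * hD1 u
      + (hA u)\<^sup>2 + 3 * (hB u)\<^sup>2 + 3 * (hC u)\<^sup>2 + (hD u)\<^sup>2 = 0"
    using 1[of 1] norm_cov[OF assms] unfolding cov2_defs by (simp add: s) algebra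
  show "a u * hB1 u + 3 * b u * hC1 u + 3 * c u * hD1 u + d u * hE1 u
      + hA u * hB u + 3 * hB u * hC u + 3 * hC u * hD u + hD u * hE u = 0"
    using 2[of 1] norm_cov[OF assms] unfolding cov2_defs by (simp add: s) algebra
  show "a u * hB2 u + 3 * b u * hC2 u + 3 * c u * hD2 u + d u * hE2 u
      + (hB u)\<^sup>2 + 3 * (hC u)\<^sup>2 + 3 * (hD u)\<^sup>2 + (hE u)\<^sup>2 = 0"
    using 2[of 2] norm_cov[OF assms] unfolding cov2_defs by (simp add: s) algebra
qed

end

context expander_frame begin

text \<open>Simons' identity, which for constant \<open>S\<close> expresses the norm of the covariant derivative of the
  second fundamental form algebraically; it is written as a sum of squares.\<close>

definition "pP u = (a u)\<^sup>2 - (c u)\<^sup>2 + (b u)\<^sup>2 - (d u)\<^sup>2"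
definition "pR u = a u * b u + 2 * b u * c u + c u * d u"

lemma simons:
  assumes "u \<in> \<Omega>"
  shows "(hA u)\<^sup>2 + 4 * (hB u)\<^sup>2 + 6 * (hC u)\<^sup>2 + 4 * (hD u)\<^sup>2 + (hE u)\<^sup>2
    = S + S\<^sup>2 / 2 + 4 * (gauss_curv u)\<^sup>2 + (pP u)\<^sup>2 / 2 + 2 * (pR u)\<^sup>2"
proof -
  define K where "K = gauss_curv u"
  \<comment> \<open>The two pure second derivatives of the constant \<open>S\<close> are added, that
    is, its Laplacian vanishes; this expresses the norm of the first covariant derivative by second
    ones.\<close>
  have "(hA u)\<^sup>2 + 4 * (hB u)\<^sup>2 + 6 * (hC u)\<^sup>2 + 4 * (hD u)\<^sup>2 + (hE u)\<^sup>2
    = - (a u * (hA1 u + hB2 u) + 3 * b u * (hB1 u + hC2 u) + 3 * c u * (hC1 u + hD2 u) + d u * (hD1 u + hE2 u))"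
    using norm_cov2(1,3)[OF assms] by (simp add: algebra_simps)
  \<comment> \<open>The Ricci identities complete each bracket to a derivative of a trace, which
    \<open>trace_cov2\<close> evaluates; the cost is the curvature terms.\<close>
  also have "\<dots> = - (a u * ((hA1 u + hC1 u) - K * (2 * c u - a u)) + 3 * b u * ((hB1 u + hD1 u) - K * (d u - 2 * b u))
      + 3 * c u * ((hB2 u + hD2 u) + K * (2 * c u - a u)) + d u * ((hC2 u + hE2 u) + K * (d u - 2 * b u)))"
  proof -
    have r: "hB2 u = hC1 u - K * (2 * c u - a u)" "hC2 u = hD1 u - K * (d u - 2 * b u)"
      using ricci[OF assms] unfolding K_def[symmetric] by simp_all
    show ?thesis unfolding r by (simp add: algebra_simps)
  qed
  also have "\<dots> = (a u)\<^sup>2 * m11 u + a u * b u * m12 u + 3 * (b u)\<^sup>2 * m11 u + 6 * b u * c u * m12 u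
      + 3 * (c u)\<^sup>2 * m22 u + c u * d u * m12 u + (d u)\<^sup>2 * m22 u
      - K * ((a u)\<^sup>2 + 6 * (b u)\<^sup>2 + 6 * (c u)\<^sup>2 + (d u)\<^sup>2 - 5 * a u * c u - 5 * b u * d u)
      + (a u * hA u + 3 * b u * hB u + 3 * c u * hC u + d u * hD u) * y 1 u
      + (a u * hB u + 3 * b u * hC u + 3 * c u * hD u + d u * hE u) * y 2 u"
    unfolding trace_cov2[OF assms] by (simp add: algebra_simps power2_eq_square)
  \<comment> \<open>The factors of \<open>y 1 u\<close> and \<open>y 2 u\<close> are the two
    derivatives of \<open>S\<close> and vanish; what remains is a polynomial identity in the
    components of \<open>h\<close>.\<close>
  also have "\<dots> = S + S\<^sup>2 / 2 + 4 * K\<^sup>2 + (pP u)\<^sup>2 / 2 + 2 * (pR u)\<^sup>2"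
    unfolding norm_cov[OF assms] norm_eq[OF assms, symmetric] K_def gauss_curv_def pP_def pR_def m11_def m12_def m22_def
    by (simp add: field_simps power2_eq_square)
  finally show ?thesis unfolding K_def .
qed

text \<open>It supplies a relation among second covariant derivatives beyond the differentiated
  trace and norm equations, and through it the tangential position gets bounded.\<close>

lemma simons_cov:
  assumes "u \<in> \<Omega>"
  shows "hA u * hA1 u + 4 * hB u * hB1 u + 6 * hC u * hC1 u + 4 * hD u * hD1 u + hE u * hE1 u
    = 4 * gauss_curv u * (hA u * c u + a u * hC u + hB u * d u + b u * hD u - 2 * b u * hB u - 2 * c u * hC u)
      + pP u * (a u * hA u - c u * hC u + b u * hB u - d u * hD u)
      + 2 * pR u * (hA u * b u + a u * hB u + 2 * hB u * c u + 2 * b u * hC u + hC u * d u + c u * hD u)"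
proof -
  note sm = smooth_intros smooth_cov
  have sK: "smooth_on \<Omega> gauss_curv" "smooth_on \<Omega> pP" "smooth_on \<Omega> pR"
    unfolding gauss_curv_def[abs_def] pP_def[abs_def] pR_def[abs_def] by (intro sm)+
  have s1: "smooth_on \<Omega> (\<lambda>u. 2 * (hA u)\<^sup>2 + 8 * (hB u)\<^sup>2 + 12 * (hC u)\<^sup>2 + 8 * (hD u)\<^sup>2 + 2 * (hE u)\<^sup>2)"
    by (intro sm)
  have dK: "D 1 gauss_curv u = hA u * c u + a u * hC u + hB u * d u + b u * hD u - 2 * b u * hB u - 2 * c u * hC u"
    unfolding gauss_curv_def[abs_def]
    by (simp add: D_rules assms D1_D2_h[OF assms]) (simp add: algebra_simps)
  \<comment> \<open>\<open>pP\<close> and \<open>2 * pR\<close> are the components of the traceless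
    part of the tensor sum_kl h_ikl h_jkl. They rotate into each other with the frame, which is why
    the connection terms of \<open>dP\<close> and \<open>dR\<close> cancel at the end.\<close>
  have dP: "D 1 pP u = 2 * (a u * hA u - c u * hC u + b u * hB u - d u * hD u) + 4 * g u * pR u"
    unfolding pP_def[abs_def] pR_def
    by (simp add: D_rules assms D1_D2_h[OF assms]) (simp add: algebra_simps)
  have dR: "D 1 pR u = hA u * b u + a u * hB u + 2 * hB u * c u + 2 * b u * hC u + hC u * d u + c u * hD u - g u * pP u"
    unfolding pR_def[abs_def] pP_def
    by (simp add: D_rules assms D1_D2_h[OF assms]) (simp add: algebra_simps power2_eq_square)
  have "2 * (hA u)\<^sup>2 + 8 * (hB u)\<^sup>2 + 12 * (hC u)\<^sup>2 + 8 * (hD u)\<^sup>2 + 2 * (hE u)\<^sup>2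
      = 2 * S + S\<^sup>2 + 8 * (gauss_curv u)\<^sup>2 + (pP u)\<^sup>2 + 4 * (pR u)\<^sup>2" if "u \<in> \<Omega>" for u
    using simons[OF that] by (simp add: field_simps)
  then have "D 1 (\<lambda>u. 2 * (hA u)\<^sup>2 + 8 * (hB u)\<^sup>2 + 12 * (hC u)\<^sup>2 + 8 * (hD u)\<^sup>2 + 2 * (hE u)\<^sup>2) u
    = D 1 (\<lambda>u. 2 * S + S\<^sup>2 + 8 * (gauss_curv u)\<^sup>2 + (pP u)\<^sup>2 + 4 * (pR u)\<^sup>2) u"
    by (rule dir_deriv_cong[OF open_dom assms _ s1])
  then have "2 * (hA u * D 1 hA u + 4 * hB u * D 1 hB u + 6 * hC u * D 1 hC u + 4 * hD u * D 1 hD u + hE u * D 1 hE u)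
    = 8 * gauss_curv u * D 1 gauss_curv u + pP u * D 1 pP u + 4 * pR u * D 1 pR u"
    by (simp add: D_rules assms sK)
  moreover have "hA u * hA1 u + 4 * hB u * hB1 u + 6 * hC u * hC1 u + 4 * hD u * hD1 u + hE u * hE1 u
    = hA u * D 1 hA u + 4 * hB u * D 1 hB u + 6 * hC u * D 1 hC u + 4 * hD u * D 1 hD u + hE u * D 1 hE u"
    unfolding cov2_defs by (simp add: algebra_simps)
  ultimately show ?thesis unfolding dK dP dR by (simp add: algebra_simps)
qed

end

section \<open>Algebraic consequences at a point\<close>

text \<open>The relations between the components of the second fundamental form and its first two
  covariant derivatives at a point whose tangential position is \<open>t e\<^sub>1\<close>; second
  derivatives occur only in the direction \<open>e\<^sub>1\<close>.\<close>

definition expander_jet1 :: "real \<Rightarrow> real \<Rightarrow> real \<Rightarrow> real \<Rightarrow> real \<Rightarrow> real \<Rightarrow> real \<Rightarrow> real \<Rightarrow> real \<Rightarrow> real \<Rightarrow> real \<Rightarrow> bool" where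
  "expander_jet1 S t a b c d A B C D E \<longleftrightarrow>
    a\<^sup>2 + 3 * b\<^sup>2 + 3 * c\<^sup>2 + d\<^sup>2 = S \<and>
    A + C = - (a * t) \<and> B + D = - (b * t) \<and> C + E = - (c * t) \<and>
    a * A + 3 * b * B + 3 * c * C + d * D = 0 \<and> a * B + 3 * b * C + 3 * c * D + d * E = 0 \<and>
    A\<^sup>2 + 4 * B\<^sup>2 + 6 * C\<^sup>2 + 4 * D\<^sup>2 + E\<^sup>2 = S + S\<^sup>2 / 2 + 4 * (a * c + b * d - b\<^sup>2 - c\<^sup>2)\<^sup>2
      + (a\<^sup>2 - c\<^sup>2 + b\<^sup>2 - d\<^sup>2)\<^sup>2 / 2 + 2 * (a * b + 2 * b * c + c * d)\<^sup>2"

definition expander_jet2 :: "real \<Rightarrow> real \<Rightarrow> real \<Rightarrow> real \<Rightarrow> real \<Rightarrow> real \<Rightarrow> real \<Rightarrow> real \<Rightarrow> real \<Rightarrow> real \<Rightarrow>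
    real \<Rightarrow> real \<Rightarrow> real \<Rightarrow> real \<Rightarrow> real \<Rightarrow> bool" where
  "expander_jet2 t a b c d A B C D E A1 B1 C1 D1 E1 \<longleftrightarrow>
    A1 + C1 = - (A * t) - (a * (1 + a * (a + c) + b * (b + d)) + b * (b * (a + c) + c * (b + d))) \<and>
    B1 + D1 = - (B * t) - (b * (1 + a * (a + c) + b * (b + d)) + c * (b * (a + c) + c * (b + d))) \<and>
    C1 + E1 = - (C * t) - (c * (1 + a * (a + c) + b * (b + d)) + d * (b * (a + c) + c * (b + d))) \<and>
    a * A1 + 3 * b * B1 + 3 * c * C1 + d * D1 + A\<^sup>2 + 3 * B\<^sup>2 + 3 * C\<^sup>2 + D\<^sup>2 = 0 \<and>
    a * B1 + 3 * b * C1 + 3 * c * D1 + d * E1 + A * B + 3 * B * C + 3 * C * D + D * E = 0 \<and>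
    A * A1 + 4 * B * B1 + 6 * C * C1 + 4 * D * D1 + E * E1
    = 4 * (a * c + b * d - b\<^sup>2 - c\<^sup>2) * (A * c + a * C + B * d + b * D - 2 * b * B - 2 * c * C)
      + (a\<^sup>2 - c\<^sup>2 + b\<^sup>2 - d\<^sup>2) * (a * A - c * C + b * B - d * D)
      + 2 * (a * b + 2 * b * c + c * d) * (A * b + a * B + 2 * B * c + 2 * b * C + C * d + c * D)"

lemma (in expander_frame) expander_jets:
  assumes "u \<in> \<Omega>" "y 2 u = 0"
  shows "expander_jet1 S (y 1 u) (a u) (b u) (c u) (d u) (hA u) (hB u) (hC u) (hD u) (hE u)"
    and "expander_jet2 (y 1 u) (a u) (b u) (c u) (d u) (hA u) (hB u) (hC u) (hD u) (hE u)
      (hA1 u) (hB1 u) (hC1 u) (hD1 u) (hE1 u)"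
  unfolding expander_jet1_def expander_jet2_def
  using norm_eq[OF assms(1)] trace_cov[OF assms(1)] norm_cov[OF assms(1)] simons[OF assms(1)]
    trace_cov2[OF assms(1)] norm_cov2[OF assms(1)] simons_cov[OF assms(1)] assms(2)
  by (simp_all add: m11_def m12_def pP_def pR_def gauss_curv_def)

text \<open>Each quadratic expression squared in Simons' identity is at most \<open>4 * S\<close> in
  absolute value, so the right side is at most S + S^2 / 2 + (64 + 8 + 32) S^2, whence the 105. The
  summand 1 gives \<open>1 \<le> M\<close>, so that a bound \<open>M\<close> on a square is also one
  on the absolute value.\<close>

lemma expander_jet1_bounds:
  assumes "expander_jet1 S t a b c d A B C D E"
  defines "M \<equiv> 1 + S + 105 * S\<^sup>2"
  shows "\<bar>a\<bar> \<le> M" "\<bar>b\<bar> \<le> M" "\<bar>c\<bar> \<le> M" "\<bar>d\<bar> \<le> M"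
    "\<bar>A\<bar> \<le> M" "\<bar>B\<bar> \<le> M" "\<bar>C\<bar> \<le> M" "\<bar>D\<bar> \<le> M" "\<bar>E\<bar> \<le> M"
proof -
  have n: "a\<^sup>2 + 3 * b\<^sup>2 + 3 * c\<^sup>2 + d\<^sup>2 = S"
    and s: "A\<^sup>2 + 4 * B\<^sup>2 + 6 * C\<^sup>2 + 4 * D\<^sup>2 + E\<^sup>2 = S + S\<^sup>2 / 2 + 4 * (a * c + b * d - b\<^sup>2 - c\<^sup>2)\<^sup>2
      + (a\<^sup>2 - c\<^sup>2 + b\<^sup>2 - d\<^sup>2)\<^sup>2 / 2 + 2 * (a * b + 2 * b * c + c * d)\<^sup>2"
    using assms(1) unfolding expander_jet1_def by auto
  have nn: "0 \<le> a\<^sup>2" "0 \<le> b\<^sup>2" "0 \<le> c\<^sup>2" "0 \<le> d\<^sup>2" "0 \<le> A\<^sup>2" "0 \<le> B\<^sup>2" "0 \<le> C\<^sup>2" "0 \<le> D\<^sup>2" "0 \<le> E\<^sup>2" by simp_all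
  have S0: "0 \<le> S" using n nn by linarith
  then have M: "1 \<le> M" "S \<le> M" unfolding M_def by simp_all
  have abs_le: "\<bar>z\<bar> \<le> M" if "z\<^sup>2 \<le> M" for z
  proof (rule power2_le_imp_le)
    have "z\<^sup>2 \<le> M * M" using that M mult_left_mono[of 1 M M] by linarith
    then show "\<bar>z\<bar>\<^sup>2 \<le> M\<^sup>2" by (simp add: power2_eq_square)
  qed (use M in simp)
  have prod: "2 * (p * q) \<le> p\<^sup>2 + q\<^sup>2" "- (2 * (p * q)) \<le> p\<^sup>2 + q\<^sup>2" for p q :: real
    using zero_le_power2[of "p - q"] zero_le_power2[of "p + q"]
    by (simp_all add: power2_diff power2_sum)
  have "\<bar>a * c + b * d - b\<^sup>2 - c\<^sup>2\<bar> \<le> 4 * S"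
    using prod[of a c] prod[of b d] n nn by (intro abs_leI; linarith)
  then have 1: "(a * c + b * d - b\<^sup>2 - c\<^sup>2)\<^sup>2 \<le> (4 * S)\<^sup>2" using S0 by (simp only: power2_le_iff_abs_le)
  have "\<bar>a\<^sup>2 - c\<^sup>2 + b\<^sup>2 - d\<^sup>2\<bar> \<le> 4 * S" using n nn by (intro abs_leI; linarith)
  then have 2: "(a\<^sup>2 - c\<^sup>2 + b\<^sup>2 - d\<^sup>2)\<^sup>2 \<le> (4 * S)\<^sup>2" using S0 by (simp only: power2_le_iff_abs_le)
  have "\<bar>a * b + 2 * b * c + c * d\<bar> \<le> 4 * S"
    using prod[of a b] prod[of b c] prod[of c d] n nn unfolding mult.assoc by (intro abs_leI; linarith)
  then have 3: "(a * b + 2 * b * c + c * d)\<^sup>2 \<le> (4 * S)\<^sup>2" using S0 by (simp only: power2_le_iff_abs_le)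
  have sM: "A\<^sup>2 + 4 * B\<^sup>2 + 6 * C\<^sup>2 + 4 * D\<^sup>2 + E\<^sup>2 \<le> M"
  proof -
    have "(4 * S)\<^sup>2 = 16 * S\<^sup>2" by (simp add: power_mult_distrib)
    then show ?thesis using s 1 2 3 zero_le_power2[of S] unfolding M_def by linarith
  qed
  show "\<bar>a\<bar> \<le> M" "\<bar>b\<bar> \<le> M" "\<bar>c\<bar> \<le> M" "\<bar>d\<bar> \<le> M"
    by (rule abs_le; use n nn M in linarith)+
  show "\<bar>A\<bar> \<le> M" "\<bar>B\<bar> \<le> M" "\<bar>C\<bar> \<le> M" "\<bar>D\<bar> \<le> M" "\<bar>E\<bar> \<le> M"
    by (rule abs_le; use sM nn M in linarith)+
qed

text \<open>Bolzano-Weierstrass one coordinate at a time, each time thinning out the previous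
  subsequence; coordinates from \<open>m\<close> on may be unbounded.\<close>

lemma simultaneous_convergent_subsequence:
  fixes Z :: "nat \<Rightarrow> nat \<Rightarrow> real"
  assumes "\<And>n i. i < m \<Longrightarrow> \<bar>Z n i\<bar> \<le> M"
  shows "\<exists>r. strict_mono r \<and> (\<forall>i<m. convergent (\<lambda>n. Z (r n) i))"
  using assms
proof (induction m)
  case 0
  then show ?case using strict_mono_id by blast
next
  case (Suc m)
  then obtain r where r: "strict_mono r" "\<forall>i<m. convergent (\<lambda>n. Z (r n) i)" by auto
  have "bounded (range (\<lambda>n. Z (r n) m))" using Suc.prems[of m] by (auto simp: bounded_iff)
  then obtain l s where s: "strict_mono s" "((\<lambda>n. Z (r n) m) \<circ> s) \<longlonglongrightarrow> l"
    using bounded_imp_convergent_subsequence by blast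
  have "convergent (\<lambda>n. Z ((r \<circ> s) n) i)" if "i < Suc m" for i
  proof (cases "i = m")
    case True
    then show ?thesis using s(2) by (auto simp: convergent_def o_def)
  next
    case False
    then have "convergent (\<lambda>n. Z (r n) i)" using r(2) that by auto
    from convergent_subseq_convergent[OF this s(1)] show ?thesis by (simp add: o_def)
  qed
  moreover have "strict_mono (r \<circ> s)" using r(1) s(1) by (rule strict_mono_o)
  ultimately show ?case by blast
qed

lemma expander_jet1_lower: "expander_jet1 S t a b c d A B C D E \<Longrightarrow> S \<le> A\<^sup>2 + 4 * B\<^sup>2 + 6 * C\<^sup>2 + 4 * D\<^sup>2 + E\<^sup>2"
  unfolding expander_jet1_def by simp

text \<open>Let \<open>t\<close> tend to infinity while the first-order data stay bounded. The trace
  relations divided by \<open>t\<close> send \<open>a\<close>, \<open>b\<close>, \<open>c\<close> to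
  0, so the square of \<open>d\<close> tends to \<open>S\<close> and the norm relations send
  \<open>D\<close>, \<open>E\<close> to 0. The second-order trace and norm relations divided by
  \<open>t\<close> are five linear equations for the scaled second derivatives, which therefore tend
  to C - A, - B, - C, 0, 0 in terms of the limits. The derivative of Simons' identity then reads A^2
  - A C + 4 B^2 + 6 C^2 = 0, so the whole covariant derivative tends to 0, against its lower bound
  \<open>S\<close>.\<close>

lemma tangential_position_bound:
  assumes "S > 0"
  shows "\<exists>T. \<forall>t a b c d A B C D E A1 B1 C1 D1 E1. expander_jet1 S t a b c d A B C D E \<longrightarrow>
    expander_jet2 t a b c d A B C D E A1 B1 C1 D1 E1 \<longrightarrow> t \<le> T"
proof (rule ccontr)
  assume neg: "\<not> ?thesis"
  \<comment> \<open>All data share one index so that a single subsequence serves them: 0 to 8 are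
    the bounded first-order components, 9 to 13 the second-order ones, for which no bound is
    available, and 14 is \<open>t\<close>.\<close>
  have "\<exists>z :: nat \<Rightarrow> real. real n < z 14 \<and>
      expander_jet1 S (z 14) (z 0) (z 1) (z 2) (z 3) (z 4) (z 5) (z 6) (z 7) (z 8) \<and>
      expander_jet2 (z 14) (z 0) (z 1) (z 2) (z 3) (z 4) (z 5) (z 6) (z 7) (z 8) (z 9) (z 10) (z 11) (z 12) (z 13)" for n
  proof -
    have "\<exists>t a b c d A B C D E A1 B1 C1 D1 E1. expander_jet1 S t a b c d A B C D E \<and>
      expander_jet2 t a b c d A B C D E A1 B1 C1 D1 E1 \<and> \<not> t \<le> real n"
      using neg[unfolded not_ex, THEN spec, of "real n"] by (simp only: not_all not_imp)
    then show ?thesis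
    proof (elim exE conjE)
      fix t a b c d A B C D E A1 B1 C1 D1 E1
      assume "expander_jet1 S t a b c d A B C D E"
        "expander_jet2 t a b c d A B C D E A1 B1 C1 D1 E1" "\<not> t \<le> real n"
      then show ?thesis
        by (intro exI[of _ "\<lambda>i. [a, b, c, d, A, B, C, D, E, A1, B1, C1, D1, E1, t] ! i"]) simp
    qed
  qed
  then obtain Z0 :: "nat \<Rightarrow> nat \<Rightarrow> real" where Z0: "\<And>n. real n < Z0 n 14"
    "\<And>n. expander_jet1 S (Z0 n 14) (Z0 n 0) (Z0 n 1) (Z0 n 2) (Z0 n 3) (Z0 n 4) (Z0 n 5) (Z0 n 6) (Z0 n 7) (Z0 n 8)"
    "\<And>n. expander_jet2 (Z0 n 14) (Z0 n 0) (Z0 n 1) (Z0 n 2) (Z0 n 3) (Z0 n 4) (Z0 n 5) (Z0 n 6) (Z0 n 7) (Z0 n 8)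
      (Z0 n 9) (Z0 n 10) (Z0 n 11) (Z0 n 12) (Z0 n 13)"
    by metis
  have bnd: "\<bar>Z0 n i\<bar> \<le> 1 + S + 105 * S\<^sup>2" if "i < 9" for n i
  proof -
    have "i \<in> {0, 1, 2, 3, 4, 5, 6, 7, 8}" using that by auto
    then show ?thesis using expander_jet1_bounds[OF Z0(2)[of n]] by blast
  qed
  obtain r where r: "strict_mono r" "\<forall>i<9. convergent (\<lambda>n. Z0 (r n) i)"
    using simultaneous_convergent_subsequence[of 9 Z0, OF bnd] by blast
  define Z where "Z = (\<lambda>i n. Z0 (r n) i)"
  define l where "l = (\<lambda>i. lim (Z i))"
  have l: "Z i \<longlonglongrightarrow> l i" if "i < 9" for i
    using r(2) that unfolding Z_def l_def by (simp add: convergent_LIMSEQ_iff)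
  define t a b c d where "t = Z 14" and "a = Z 0" and "b = Z 1" and "c = Z 2" and "d = Z 3"
  define A B C D E where "A = Z 4" and "B = Z 5" and "C = Z 6" and "D = Z 7" and "E = Z 8"
  define A1 B1 C1 D1 E1 where "A1 = Z 9" and "B1 = Z 10" and "C1 = Z 11" and "D1 = Z 12" and "E1 = Z 13"
  note names = t_def a_def b_def c_def d_def A_def B_def C_def D_def E_def A1_def B1_def C1_def D1_def E1_def
  have t_gt: "t n > real n" for n
    using Z0(1)[of "r n"] strict_mono_imp_increasing[OF r(1), of n] unfolding names Z_def by linarith
  have jet1: "expander_jet1 S (t n) (a n) (b n) (c n) (d n) (A n) (B n) (C n) (D n) (E n)" for n
    using Z0(2) unfolding names Z_def .
  have jet2: "expander_jet2 (t n) (a n) (b n) (c n) (d n) (A n) (B n) (C n) (D n) (E n) (A1 n) (B1 n) (C1 n) (D1 n) (E1 n)" for n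
    using Z0(3) unfolding names Z_def .
  have lims: "a \<longlonglongrightarrow> l 0" "b \<longlonglongrightarrow> l 1" "c \<longlonglongrightarrow> l 2" "d \<longlonglongrightarrow> l 3"
    "A \<longlonglongrightarrow> l 4" "B \<longlonglongrightarrow> l 5" "C \<longlonglongrightarrow> l 6" "D \<longlonglongrightarrow> l 7" "E \<longlonglongrightarrow> l 8"
    unfolding names by (rule l; simp)+
  have t_pos: "t n > 0" for n using t_gt[of n] by linarith
  have it: "(\<lambda>n. inverse (t n)) \<longlonglongrightarrow> 0"
  proof (rule tendsto_inverse_0_at_top)
    show "filterlim t at_top sequentially"
      by (rule filterlim_at_top_mono[OF filterlim_real_sequentially]) (use t_gt less_imp_le in \<open>auto intro!: always_eventually\<close>)
  qed
  have vanish: "x \<longlonglongrightarrow> 0" if "\<And>n. x n = p n * inverse (t n)" "p \<longlonglongrightarrow> q" for x p q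
  proof -
    have "x = (\<lambda>n. p n * inverse (t n))" by (rule ext) (rule that(1))
    then show ?thesis using tendsto_mult[OF that(2) it] by simp
  qed
  have "a \<longlonglongrightarrow> 0" "b \<longlonglongrightarrow> 0" "c \<longlonglongrightarrow> 0"
  proof -
    have r: "a n = - (A n + C n) * inverse (t n)" "b n = - (B n + D n) * inverse (t n)"
      "c n = - (C n + E n) * inverse (t n)" for n
      using jet1[of n] t_pos[of n] unfolding expander_jet1_def by (auto simp: field_simps)
    show "a \<longlonglongrightarrow> 0" by (rule vanish[OF r(1) tendsto_minus[OF tendsto_add[OF lims(5,7)]]])
    show "b \<longlonglongrightarrow> 0" by (rule vanish[OF r(2) tendsto_minus[OF tendsto_add[OF lims(6,8)]]])
    show "c \<longlonglongrightarrow> 0" by (rule vanish[OF r(3) tendsto_minus[OF tendsto_add[OF lims(7,9)]]])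
  qed
  then have l0: "l 0 = 0" "l 1 = 0" "l 2 = 0" using lims LIMSEQ_unique by blast+
  have eq: "P = Q" if "\<And>n. p n = q n" "p \<longlonglongrightarrow> P" "q \<longlonglongrightarrow> Q" for p q :: "nat \<Rightarrow> real" and P Q
    using that LIMSEQ_unique by (metis ext)
  have l3: "(l 3)\<^sup>2 = S"
  proof -
    have "(\<lambda>n. (a n)\<^sup>2 + 3 * (b n)\<^sup>2 + 3 * (c n)\<^sup>2 + (d n)\<^sup>2) \<longlonglongrightarrow> (l 0)\<^sup>2 + 3 * (l 1)\<^sup>2 + 3 * (l 2)\<^sup>2 + (l 3)\<^sup>2"
      by (intro tendsto_intros lims)
    from eq[OF _ this tendsto_const[of S]] show ?thesis using jet1 l0 unfolding expander_jet1_def by auto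
  qed
  then have d_ne: "l 3 \<noteq> 0" using \<open>S > 0\<close> by auto
  have "(\<lambda>n. a n * A n + 3 * b n * B n + 3 * c n * C n + d n * D n) \<longlonglongrightarrow> l 0 * l 4 + 3 * l 1 * l 5 + 3 * l 2 * l 6 + l 3 * l 7"
    by (intro tendsto_intros lims)
  from eq[OF _ this tendsto_const[of 0]] have l7: "l 7 = 0"
    using jet1 l0 d_ne unfolding expander_jet1_def by auto
  have "(\<lambda>n. a n * B n + 3 * b n * C n + 3 * c n * D n + d n * E n) \<longlonglongrightarrow> l 0 * l 5 + 3 * l 1 * l 6 + 3 * l 2 * l 7 + l 3 * l 8"
    by (intro tendsto_intros lims)
  from eq[OF _ this tendsto_const[of 0]] have l8: "l 8 = 0"
    using jet1 l0 d_ne unfolding expander_jet1_def by auto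
  define \<alpha> \<beta> \<gamma> \<delta> \<epsilon> where "\<alpha> = (\<lambda>n. A1 n / t n)" and "\<beta> = (\<lambda>n. B1 n / t n)" and "\<gamma> = (\<lambda>n. C1 n / t n)"
    and "\<delta> = (\<lambda>n. D1 n / t n)" and "\<epsilon> = (\<lambda>n. E1 n / t n)"
  note greek = \<alpha>_def \<beta>_def \<gamma>_def \<delta>_def \<epsilon>_def
  define k1 k2 k3 where
    "k1 = (\<lambda>n. - A n - (a n * (1 + a n * (a n + c n) + b n * (b n + d n)) + b n * (b n * (a n + c n) + c n * (b n + d n))) * inverse (t n))"
    and "k2 = (\<lambda>n. - B n - (b n * (1 + a n * (a n + c n) + b n * (b n + d n)) + c n * (b n * (a n + c n) + c n * (b n + d n))) * inverse (t n))"
    and "k3 = (\<lambda>n. - C n - (c n * (1 + a n * (a n + c n) + b n * (b n + d n)) + d n * (b n * (a n + c n) + c n * (b n + d n))) * inverse (t n))"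
  have k: "k1 \<longlonglongrightarrow> - l 4" "k2 \<longlonglongrightarrow> - l 5" "k3 \<longlonglongrightarrow> - l 6"
    unfolding k1_def k2_def k3_def by (rule tendsto_eq_intros lims it refl | simp)+
  have div: "x / t n + z / t n = - w - p * inverse (t n)" if "x + z = - (w * t n) - p" for x z w p n
  proof -
    have "x = - (w * t n) - p - z" using that by simp
    then show ?thesis using t_pos[of n] by (simp add: field_simps)
  qed
  have "\<alpha> n + \<gamma> n = k1 n" "\<beta> n + \<delta> n = k2 n" "\<gamma> n + \<epsilon> n = k3 n" for n
    unfolding greek k1_def k2_def k3_def
    by (rule div; use jet2[of n] in \<open>simp only: expander_jet2_def\<close>)+
  then have tr: "\<alpha> n = k1 n - k3 n + \<epsilon> n" "\<beta> n = k2 n - \<delta> n" "\<gamma> n = k3 n - \<epsilon> n" for n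
    by (smt (verit))+
  define q1 q2 q3 where
    "q1 = (\<lambda>n. - ((A n)\<^sup>2 + 3 * (B n)\<^sup>2 + 3 * (C n)\<^sup>2 + (D n)\<^sup>2) * inverse (t n) - a n * (k1 n - k3 n) - 3 * b n * k2 n - 3 * c n * k3 n)"
    and "q2 = (\<lambda>n. - (A n * B n + 3 * B n * C n + 3 * C n * D n + D n * E n) * inverse (t n) - a n * k2 n - 3 * b n * k3 n)"
    and "q3 = (\<lambda>n. (4 * (a n * c n + b n * d n - (b n)\<^sup>2 - (c n)\<^sup>2) * (A n * c n + a n * C n + B n * d n + b n * D n - 2 * b n * B n - 2 * c n * C n)
      + ((a n)\<^sup>2 - (c n)\<^sup>2 + (b n)\<^sup>2 - (d n)\<^sup>2) * (a n * A n - c n * C n + b n * B n - d n * D n)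
      + 2 * (a n * b n + 2 * b n * c n + c n * d n) * (A n * b n + a n * B n + 2 * B n * c n + 2 * b n * C n + C n * d n + c n * D n)) * inverse (t n))"
  have q: "q1 \<longlonglongrightarrow> 0" "q2 \<longlonglongrightarrow> 0" "q3 \<longlonglongrightarrow> 0"
    unfolding q1_def q2_def q3_def by (rule it lims k refl tendsto_eq_intros | simp add: l0 l0[unfolded One_nat_def])+
  \<comment> \<open>After elimination of the traces, the matrix of the system for
    \<open>\<delta>\<close> and \<open>\<epsilon>\<close> is a multiple of a rotation. Its
    determinant \<open>w\<close> tends to \<open>S\<close> and so stays away from 0.\<close>
  have sys: "(d n - 3 * b n) * \<delta> n + (a n - 3 * c n) * \<epsilon> n = q1 n"
    "(d n - 3 * b n) * \<epsilon> n - (a n - 3 * c n) * \<delta> n = q2 n" for n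
  proof -
    have "a n * \<alpha> n + 3 * b n * \<beta> n + 3 * c n * \<gamma> n + d n * \<delta> n = - ((A n)\<^sup>2 + 3 * (B n)\<^sup>2 + 3 * (C n)\<^sup>2 + (D n)\<^sup>2) * inverse (t n)"
      "a n * \<beta> n + 3 * b n * \<gamma> n + 3 * c n * \<delta> n + d n * \<epsilon> n = - (A n * B n + 3 * B n * C n + 3 * C n * D n + D n * E n) * inverse (t n)"
      using jet2[of n] t_pos[of n] unfolding expander_jet2_def greek by (simp_all add: field_simps)
    then show "(d n - 3 * b n) * \<delta> n + (a n - 3 * c n) * \<epsilon> n = q1 n"
      "(d n - 3 * b n) * \<epsilon> n - (a n - 3 * c n) * \<delta> n = q2 n"
      unfolding q1_def q2_def tr by (simp_all add: algebra_simps)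
  qed
  define w where "w = (\<lambda>n. (d n - 3 * b n)\<^sup>2 + (a n - 3 * c n)\<^sup>2)"
  have w: "w \<longlonglongrightarrow> S" unfolding w_def by (rule tendsto_eq_intros lims refl | simp add: l0 l0[unfolded One_nat_def] l3)+
  have wd: "w n * \<delta> n = (d n - 3 * b n) * q1 n - (a n - 3 * c n) * q2 n" "w n * \<epsilon> n = (d n - 3 * b n) * q2 n + (a n - 3 * c n) * q1 n" for n
    unfolding w_def sys[symmetric] by (simp_all add: algebra_simps power2_eq_square)
  have wd0: "(\<lambda>n. w n * \<delta> n) \<longlonglongrightarrow> 0" "(\<lambda>n. w n * \<epsilon> n) \<longlonglongrightarrow> 0"
    unfolding wd by (rule tendsto_eq_intros lims q refl | simp)+
  have w_ev: "eventually (\<lambda>n. w n \<noteq> 0) sequentially"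
    using w \<open>S > 0\<close> by (simp add: tendsto_imp_eventually_ne)
  have \<delta>0: "\<delta> \<longlonglongrightarrow> 0"
  proof (rule Lim_transform_eventually)
    show "(\<lambda>n. w n * \<delta> n / w n) \<longlonglongrightarrow> 0" using tendsto_divide[OF wd0(1) w] \<open>S > 0\<close> by simp
    show "eventually (\<lambda>n. w n * \<delta> n / w n = \<delta> n) sequentially" using w_ev by eventually_elim simp
  qed
  have \<epsilon>0: "\<epsilon> \<longlonglongrightarrow> 0"
  proof (rule Lim_transform_eventually)
    show "(\<lambda>n. w n * \<epsilon> n / w n) \<longlonglongrightarrow> 0" using tendsto_divide[OF wd0(2) w] \<open>S > 0\<close> by simp
    show "eventually (\<lambda>n. w n * \<epsilon> n / w n = \<epsilon> n) sequentially" using w_ev by eventually_elim simp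
  qed
  have "A n * \<alpha> n + 4 * B n * \<beta> n + 6 * C n * \<gamma> n + 4 * D n * \<delta> n + E n * \<epsilon> n = q3 n" for n
    using jet2[of n] t_pos[of n] unfolding expander_jet2_def greek q3_def by (simp add: divide_simps)
  moreover have "(\<lambda>n. A n * \<alpha> n + 4 * B n * \<beta> n + 6 * C n * \<gamma> n + 4 * D n * \<delta> n + E n * \<epsilon> n)
      \<longlonglongrightarrow> l 4 * (- l 4 - - l 6 + 0) + 4 * l 5 * (- l 5 - 0) + 6 * l 6 * (- l 6 - 0) + 4 * l 7 * 0 + l 8 * 0"
    unfolding tr by (intro tendsto_intros lims k \<delta>0 \<epsilon>0)
  ultimately have z: "(l 4)\<^sup>2 - l 4 * l 6 + 4 * (l 5)\<^sup>2 + 6 * (l 6)\<^sup>2 = 0"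
    using eq[OF _ _ q(3)] by (fastforce simp: algebra_simps power2_eq_square)
  have "S \<le> (l 4)\<^sup>2 + 4 * (l 5)\<^sup>2 + 6 * (l 6)\<^sup>2 + 4 * (l 7)\<^sup>2 + (l 8)\<^sup>2"
    by (rule LIMSEQ_le_const[where X = "\<lambda>n. (A n)\<^sup>2 + 4 * (B n)\<^sup>2 + 6 * (C n)\<^sup>2 + 4 * (D n)\<^sup>2 + (E n)\<^sup>2"])
      (intro tendsto_intros lims, use expander_jet1_lower[OF jet1] in blast)
  moreover have "2 * (l 4 * l 6) \<le> (l 4)\<^sup>2 + (l 6)\<^sup>2"
    using zero_le_power2[of "l 4 - l 6"] by (simp add: power2_diff)
  ultimately show False using z l7 l8 \<open>S > 0\<close> zero_le_power2[of "l 6"] zero_le_power2[of "l 5"] zero_le_power2[of "l 4"]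
    by simp
qed

text \<open>The bracket is the Hessian entry along the tangential position. A failure for \<sigma> =
  1 / (n + 1) makes it at most 1/4, because \<open>t\<close> is nonnegative, and also forces
  \<open>t\<close> to 0, because the entry is bounded. In the limit a = 3 c and d = 3 b, and the
  entry is 1 + 12 c^2 + 4 b^2, a contradiction. Any number strictly between 0 and 1 could replace
  1/4.\<close>

lemma tangential_direction_gain:
  assumes "S > 0"
  shows "\<exists>\<sigma>>0. \<forall>t a b c d A B C D E. 0 \<le> t \<longrightarrow> expander_jet1 S t a b c d A B C D E \<longrightarrow>
    2 * t + \<sigma> * (1 + a * (a + c) + b * (b + d)) > \<sigma> / 4"
proof (rule ccontr)
  assume neg: "\<not> ?thesis"
  have "\<exists>z :: nat \<Rightarrow> real. 0 \<le> z 9 \<and>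
      expander_jet1 S (z 9) (z 0) (z 1) (z 2) (z 3) (z 4) (z 5) (z 6) (z 7) (z 8) \<and>
      2 * z 9 + inverse (Suc n) * (1 + z 0 * (z 0 + z 2) + z 1 * (z 1 + z 3)) \<le> inverse (Suc n) / 4" for n
  proof -
    have "inverse (real (Suc n)) > 0" by simp
    then have "\<exists>t a b c d A B C D E. 0 \<le> t \<and> expander_jet1 S t a b c d A B C D E \<and>
      \<not> 2 * t + inverse (Suc n) * (1 + a * (a + c) + b * (b + d)) > inverse (Suc n) / 4"
      using neg[unfolded not_ex, THEN spec, of "inverse (real (Suc n))"] by (simp only: not_all not_imp simp_thms)
    then show ?thesis
    proof (elim exE conjE)
      fix t a b c d A B C D E
      assume "0 \<le> t" "expander_jet1 S t a b c d A B C D E"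
        "\<not> 2 * t + inverse (Suc n) * (1 + a * (a + c) + b * (b + d)) > inverse (Suc n) / 4"
      then show ?thesis
        by (intro exI[of _ "\<lambda>i. [a, b, c, d, A, B, C, D, E, t] ! i"]) simp
    qed
  qed
  then obtain Z0 :: "nat \<Rightarrow> nat \<Rightarrow> real" where Z0: "\<And>n. 0 \<le> Z0 n 9"
    "\<And>n. expander_jet1 S (Z0 n 9) (Z0 n 0) (Z0 n 1) (Z0 n 2) (Z0 n 3) (Z0 n 4) (Z0 n 5) (Z0 n 6) (Z0 n 7) (Z0 n 8)"
    "\<And>n. 2 * Z0 n 9 + inverse (Suc n) * (1 + Z0 n 0 * (Z0 n 0 + Z0 n 2) + Z0 n 1 * (Z0 n 1 + Z0 n 3)) \<le> inverse (Suc n) / 4"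
    by metis
  have bnd: "\<bar>Z0 n i\<bar> \<le> 1 + S + 105 * S\<^sup>2" if "i < 9" for n i
  proof -
    have "i \<in> {0, 1, 2, 3, 4, 5, 6, 7, 8}" using that by auto
    then show ?thesis using expander_jet1_bounds[OF Z0(2)[of n]] by blast
  qed
  obtain r where r: "strict_mono r" "\<forall>i<9. convergent (\<lambda>n. Z0 (r n) i)"
    using simultaneous_convergent_subsequence[of 9 Z0, OF bnd] by blast
  define Z where "Z = (\<lambda>i n. Z0 (r n) i)"
  define l where "l = (\<lambda>i. lim (Z i))"
  have l: "Z i \<longlonglongrightarrow> l i" if "i < 9" for i
    using r(2) that unfolding Z_def l_def by (simp add: convergent_LIMSEQ_iff)
  define t a b c d where "t = Z 9" and "a = Z 0" and "b = Z 1" and "c = Z 2" and "d = Z 3"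
  define A B C D E where "A = Z 4" and "B = Z 5" and "C = Z 6" and "D = Z 7" and "E = Z 8"
  note names = t_def a_def b_def c_def d_def A_def B_def C_def D_def E_def
  define m where "m = (\<lambda>n. 1 + a n * (a n + c n) + b n * (b n + d n))"
  have t_ge: "t n \<ge> 0" for n using Z0(1) unfolding names Z_def .
  have jet1: "expander_jet1 S (t n) (a n) (b n) (c n) (d n) (A n) (B n) (C n) (D n) (E n)" for n
    using Z0(2) unfolding names Z_def .
  have up: "2 * t n + inverse (Suc (r n)) * m n \<le> inverse (Suc (r n)) / 4" for n
    using Z0(3) unfolding names Z_def m_def .
  have lims: "a \<longlonglongrightarrow> l 0" "b \<longlonglongrightarrow> l 1" "c \<longlonglongrightarrow> l 2" "d \<longlonglongrightarrow> l 3"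
    "A \<longlonglongrightarrow> l 4" "B \<longlonglongrightarrow> l 5" "C \<longlonglongrightarrow> l 6" "D \<longlonglongrightarrow> l 7" "E \<longlonglongrightarrow> l 8"
    unfolding names by (rule l; simp)+
  have m_lim: "m \<longlonglongrightarrow> 1 + l 0 * (l 0 + l 2) + l 1 * (l 1 + l 3)"
    unfolding m_def by (intro tendsto_intros lims)
  have m_le: "m n \<le> 1 / 4" for n
  proof -
    define s where "s = inverse (real (Suc (r n)))"
    have s: "0 < s" unfolding s_def by simp
    have "s * m n \<le> s * (1 / 4)" using up[of n] t_ge[of n] unfolding s_def[symmetric] by linarith
    then show ?thesis using s by (simp only: mult_le_cancel_left_pos)
  qed
  then have m_l: "1 + l 0 * (l 0 + l 2) + l 1 * (l 1 + l 3) \<le> 1 / 4"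
    using LIMSEQ_le_const2[OF m_lim] by blast
  have ir: "(\<lambda>n. inverse (real (Suc (r n)))) \<longlonglongrightarrow> 0"
    using LIMSEQ_subseq_LIMSEQ[OF LIMSEQ_inverse_real_of_nat r(1)] by (simp add: o_def)
  have t0: "t \<longlonglongrightarrow> 0"
  proof (rule tendsto_sandwich[OF _ _ tendsto_const])
    show "eventually (\<lambda>n. 0 \<le> t n) sequentially" using t_ge by simp
    show "eventually (\<lambda>n. t n \<le> inverse (Suc (r n)) * (1 / 4 - m n) / 2) sequentially"
      using up by (auto simp: algebra_simps intro!: always_eventually)
    show "(\<lambda>n. inverse (real (Suc (r n))) * (1 / 4 - m n) / 2) \<longlonglongrightarrow> 0"
      by (rule tendsto_eq_intros ir m_lim refl | simp)+
  qed
  have eq: "P = Q" if "\<And>n. p n = q n" "p \<longlonglongrightarrow> P" "q \<longlonglongrightarrow> Q" for p q :: "nat \<Rightarrow> real" and P Q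
    using that LIMSEQ_unique by (metis ext)
  have r: "A n + C n = - (a n * t n)" "B n + D n = - (b n * t n)" "C n + E n = - (c n * t n)"
    "a n * A n + 3 * b n * B n + 3 * c n * C n + d n * D n = 0"
    "a n * B n + 3 * b n * C n + 3 * c n * D n + d n * E n = 0" for n
    using jet1[of n] unfolding expander_jet1_def by auto
  have "l 4 + l 6 = - (l 0 * 0)" by (rule eq[of "\<lambda>n. A n + C n" "\<lambda>n. - (a n * t n)", OF r(1)]) (intro tendsto_intros lims t0)+
  then have e1: "l 4 = - l 6" by simp
  have "l 5 + l 7 = - (l 1 * 0)" by (rule eq[of "\<lambda>n. B n + D n" "\<lambda>n. - (b n * t n)", OF r(2)]) (intro tendsto_intros lims t0)+
  then have e2: "l 7 = - l 5" by simp
  have "l 6 + l 8 = - (l 2 * 0)" by (rule eq[of "\<lambda>n. C n + E n" "\<lambda>n. - (c n * t n)", OF r(3)]) (intro tendsto_intros lims t0)+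
  then have e3: "l 8 = - l 6" by simp
  have s1: "l 0 * l 4 + 3 * l 1 * l 5 + 3 * l 2 * l 6 + l 3 * l 7 = 0"
    by (rule eq[of "\<lambda>n. a n * A n + 3 * b n * B n + 3 * c n * C n + d n * D n" "\<lambda>n. 0", OF r(4)]) (intro tendsto_intros lims)+
  have s2: "l 0 * l 5 + 3 * l 1 * l 6 + 3 * l 2 * l 7 + l 3 * l 8 = 0"
    by (rule eq[of "\<lambda>n. a n * B n + 3 * b n * C n + 3 * c n * D n + d n * E n" "\<lambda>n. 0", OF r(5)]) (intro tendsto_intros lims)+
  have "S \<le> (l 4)\<^sup>2 + 4 * (l 5)\<^sup>2 + 6 * (l 6)\<^sup>2 + 4 * (l 7)\<^sup>2 + (l 8)\<^sup>2"
    by (rule LIMSEQ_le_const[where X = "\<lambda>n. (A n)\<^sup>2 + 4 * (B n)\<^sup>2 + 6 * (C n)\<^sup>2 + 4 * (D n)\<^sup>2 + (E n)\<^sup>2"])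
      (intro tendsto_intros lims, use expander_jet1_lower[OF jet1] in blast)
  then have pos: "(l 5)\<^sup>2 + (l 6)\<^sup>2 \<noteq> 0" using e1 e2 e3 \<open>S > 0\<close> by (simp add: sum_power2_eq_zero_iff) auto
  \<comment> \<open>With A = - C, D = - B, E = - C the two norm relations are linear in a - 3 c and
    3 b - d, and the sum of their squares factors. The factor B^2 + C^2 is at least S / 8, since the
    norm of the covariant derivative is now 8 (B^2 + C^2).\<close>
  have "((l 0 - 3 * l 2)\<^sup>2 + (3 * l 1 - l 3)\<^sup>2) * ((l 5)\<^sup>2 + (l 6)\<^sup>2)
    = (l 0 * l 4 + 3 * l 1 * l 5 + 3 * l 2 * l 6 + l 3 * l 7)\<^sup>2 + (l 0 * l 5 + 3 * l 1 * l 6 + 3 * l 2 * l 7 + l 3 * l 8)\<^sup>2"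
    unfolding e1 e2 e3 by (simp add: algebra_simps power2_eq_square)
  also have "\<dots> = 0" unfolding s1 s2 by simp
  finally have "(l 0 - 3 * l 2)\<^sup>2 + (3 * l 1 - l 3)\<^sup>2 = 0" using pos mult_eq_0_iff by blast
  then have "l 0 = 3 * l 2" "l 3 = 3 * l 1" by (simp_all add: sum_power2_eq_zero_iff)
  then have "1 + l 0 * (l 0 + l 2) + l 1 * (l 1 + l 3) = 1 + 12 * (l 2 * l 2) + 4 * (l 1 * l 1)"
    by simp
  then show False using m_l zero_le_square[of "l 2"] zero_le_square[of "l 1"] by linarith
qed

section \<open>Curves and the induced metric\<close>

locale immersed_surface =
  fixes A :: "'m::{t2_space, second_countable_topology} chart set" and x :: "'m \<Rightarrow> complex^2"
  assumes atlas: "smooth_surface_atlas A" and immersion: "smooth_immersion A x"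
begin

abbreviation rep :: "'m set \<Rightarrow> ('m \<Rightarrow> real^2) \<Rightarrow> real^2 \<Rightarrow> complex^2" where
  "rep U \<phi> \<equiv> local_rep (U, \<phi>) x"

lemma chart_at: obtains U \<phi> where "(U, \<phi>) \<in> A" "p \<in> U"
proof -
  have "p \<in> (\<Union>(U, \<phi>)\<in>A. U)" using atlas unfolding smooth_surface_atlas_def by simp
  then show ?thesis using that by auto
qed

lemma
  assumes "(U, \<phi>) \<in> A"
  shows open_chart: "open U" and open_chart_image: "open (\<phi> ` U)"
    and chart_homeo: "homeomorphism U (\<phi> ` U) \<phi> (inv_into U \<phi>)"
  using assms atlas unfolding smooth_surface_atlas_def by auto

lemma smooth_transition:
  "(U, \<phi>) \<in> A \<Longrightarrow> (V, \<psi>) \<in> A \<Longrightarrow> smooth_on (\<phi> ` (U \<inter> V)) (\<psi> \<circ> inv_into U \<phi>)"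
  using atlas unfolding smooth_surface_atlas_def local_rep_def by auto

lemma
  assumes "(U, \<phi>) \<in> A"
  shows smooth_rep: "smooth_on (\<phi> ` U) (rep U \<phi>)"
    and inj_rep: "u \<in> \<phi> ` U \<Longrightarrow> inj (frechet_derivative (rep U \<phi>) (at u))"
  using assms immersion unfolding smooth_immersion_def by auto

lemma chart_inj: "(U, \<phi>) \<in> A \<Longrightarrow> inj_on \<phi> U"
  using chart_homeo unfolding homeomorphism_def by (metis inj_on_inverseI)

lemma chart_inverse: "(U, \<phi>) \<in> A \<Longrightarrow> p \<in> U \<Longrightarrow> inv_into U \<phi> (\<phi> p) = p"
  using chart_inj by (simp add: inv_into_f_f)

lemma local_rep_chart: "(U, \<phi>) \<in> A \<Longrightarrow> p \<in> U \<Longrightarrow> local_rep (U, \<phi>) f (\<phi> p) = f p"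
  by (simp add: local_rep_def chart_inverse)

lemma open_image_Int:
  assumes "(U, \<phi>) \<in> A" "open W"
  shows "open (\<phi> ` (U \<inter> W))"
proof -
  have "openin (top_of_set U) (U \<inter> W)" using assms(2) by auto
  then have "openin (top_of_set (\<phi> ` U)) (\<phi> ` (U \<inter> W))"
    using homeomorphism_imp_open_map[OF chart_homeo[OF assms(1)]] by auto
  then show ?thesis using open_chart_image[OF assms(1)] openin_open_trans by blast
qed

lemma C1_curve_on_cong:
  assumes "\<And>t. t \<in> I \<Longrightarrow> c t = c2 t" "C1_curve_on A I c"
  shows "C1_curve_on A I c2"
proof -
  have eq: "I \<inter> c2 -` U = I \<inter> c -` U" for U using assms(1) by auto
  have "continuous_on I c2" using assms unfolding C1_curve_on_def by (metis continuous_on_cong)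
  moreover have "\<exists>c'. continuous_on (I \<inter> c2 -` U) c' \<and>
      (\<forall>t\<in>I \<inter> c2 -` U. ((\<phi> \<circ> c2) has_vector_derivative c' t) (at t within I \<inter> c2 -` U))"
    if ch: "(U, \<phi>) \<in> A" for U \<phi>
  proof -
    obtain c' where c': "continuous_on (I \<inter> c -` U) c'"
      "\<And>t. t \<in> I \<inter> c -` U \<Longrightarrow> ((\<phi> \<circ> c) has_vector_derivative c' t) (at t within I \<inter> c -` U)"
      using assms(2) ch unfolding C1_curve_on_def by blast
    have "((\<phi> \<circ> c2) has_vector_derivative c' t) (at t within I \<inter> c -` U)" if "t \<in> I \<inter> c -` U" for t
      by (rule has_vector_derivative_transform[OF that _ c'(2)[OF that]]) (use assms(1) in auto)
    then show ?thesis unfolding eq using c'(1) by blast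
  qed
  ultimately show ?thesis unfolding C1_curve_on_def by blast
qed

lemma C1_curve_on_affine:
  assumes "C1_curve_on A I c" "(\<lambda>t. m * t + k) ` I2 \<subseteq> I"
  shows "C1_curve_on A I2 (\<lambda>t. c (m * t + k))"
proof -
  define a where "a = (\<lambda>t. m * t + k)"
  have im: "a t \<in> I" if "t \<in> I2" for t using assms(2) that unfolding a_def by auto
  have ca: "continuous_on T a" for T unfolding a_def by (intro continuous_intros)
  have "continuous_on I2 (c \<circ> a)"
    using assms im unfolding C1_curve_on_def
    by (intro continuous_on_compose ca) (auto intro: continuous_on_subset)
  moreover have "\<exists>c'. continuous_on (I2 \<inter> (c \<circ> a) -` U) c' \<and>
      (\<forall>t\<in>I2 \<inter> (c \<circ> a) -` U. ((\<phi> \<circ> (c \<circ> a)) has_vector_derivative c' t) (at t within I2 \<inter> (c \<circ> a) -` U))"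
    if ch: "(U, \<phi>) \<in> A" for U \<phi>
  proof -
    obtain c' where c': "continuous_on (I \<inter> c -` U) c'"
      "\<And>t. t \<in> I \<inter> c -` U \<Longrightarrow> ((\<phi> \<circ> c) has_vector_derivative c' t) (at t within I \<inter> c -` U)"
      using assms(1) ch unfolding C1_curve_on_def by blast
    let ?J = "I2 \<inter> (c \<circ> a) -` U"
    have sub: "a ` ?J \<subseteq> I \<inter> c -` U" using im by auto
    have "continuous_on ?J (\<lambda>t. m *\<^sub>R c' (a t))"
      using continuous_on_compose2[OF c'(1) ca sub] by (intro continuous_intros)
    moreover have "((\<phi> \<circ> (c \<circ> a)) has_vector_derivative m *\<^sub>R c' (a t)) (at t within ?J)" if "t \<in> ?J" for t
    proof -
      have "(a has_vector_derivative m) (at t within ?J)"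
        unfolding a_def by (auto intro!: derivative_eq_intros)
      moreover have "((\<phi> \<circ> c) has_vector_derivative c' (a t)) (at (a t) within a ` ?J)"
        using has_vector_derivative_within_subset[OF c'(2) sub] that im by auto
      ultimately have "(((\<phi> \<circ> c) \<circ> a) has_vector_derivative m *\<^sub>R c' (a t)) (at t within ?J)"
        by (rule vector_diff_chain_within)
      then show ?thesis by (simp add: o_assoc)
    qed
    ultimately show ?thesis by blast
  qed
  ultimately have "C1_curve_on A I2 (c \<circ> a)" unfolding C1_curve_on_def by blast
  then show ?thesis by (simp add: o_def a_def)
qed

text \<open>The velocities in \<open>C1_curve_on\<close> are given separately in each chart. The
  derivative of \<open>x \<circ> c\<close> does not depend on a chart, so its continuity can be
  checked locally without any gluing.\<close>

lemma C1_curve_on_imp_C1_immersed: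
  assumes "C1_curve_on A {s..t} c" "s < t"
  obtains g where "continuous_on {s..t} g"
    "\<And>r. r \<in> {s..t} \<Longrightarrow> ((x \<circ> c) has_vector_derivative g r) (at r within {s..t})"
proof
  define g where "g = (\<lambda>r. vector_derivative (x \<circ> c) (at r within {s..t}))"
  have cont: "continuous_on {s..t} c" using assms(1) unfolding C1_curve_on_def by blast
  have loc: "((x \<circ> c) has_vector_derivative g r) (at r within {s..t}) \<and> continuous (at r within {s..t}) g"
    if r: "r \<in> {s..t}" for r
  proof -
    obtain U \<phi> where ch: "(U, \<phi>) \<in> A" "c r \<in> U" using chart_at by blast
    let ?V = "{s..t} \<inter> c -` U"
    obtain c' where c': "continuous_on ?V c'"
      "\<And>q. q \<in> ?V \<Longrightarrow> ((\<phi> \<circ> c) has_vector_derivative c' q) (at q within ?V)"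
      using assms(1) ch unfolding C1_curve_on_def by blast
    define X where "X = rep U \<phi>"
    note sX = smooth_rep[OF ch(1), folded X_def]
    obtain W where W: "open W" "?V = {s..t} \<inter> W"
      using continuous_openin_preimage_gen[OF cont open_chart[OF ch(1)]] by (auto simp: openin_open)
    \<comment> \<open>The preimage of the chart is relatively open in the interval, so a derivative
      within it is a derivative within the interval.\<close>
    have at_V: "at q within ?V = at q within {s..t}" if "q \<in> ?V" for q
      using at_within_nhd[of q W "?V" "{s..t}"] W that by auto
    define f where "f = (\<lambda>q. frechet_derivative X (at (\<phi> (c q))) (c' q))"
    have hv: "((x \<circ> c) has_vector_derivative f q) (at q within {s..t})" if q: "q \<in> ?V" for q
    proof -
      have u: "\<phi> (c q) \<in> \<phi> ` U" using q by auto
      have "(X has_derivative frechet_derivative X (at (\<phi> (c q)))) (at ((\<phi> \<circ> c) q) within (\<phi> \<circ> c) ` ?V)"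
        using smooth_on_has_derivative[OF sX u] by (simp add: has_derivative_at_withinI)
      then have "((X \<circ> (\<phi> \<circ> c)) has_vector_derivative f q) (at q within ?V)"
        unfolding f_def using c'(2)[OF q] by (rule vector_derivative_diff_chain_within[rotated])
      then have "((x \<circ> c) has_vector_derivative f q) (at q within ?V)"
        by (rule has_vector_derivative_transform[OF q, rotated]) (simp add: X_def local_rep_chart[OF ch(1)])
      then show ?thesis unfolding at_V[OF q] .
    qed
    have gf: "g q = f q" if "q \<in> ?V" for q
      unfolding g_def using vector_derivative_within_closed_interval[OF \<open>s < t\<close> _ hv[OF that]] that by blast
    have rV: "r \<in> ?V" using r ch by auto
    have cphi: "continuous_on ?V (\<lambda>q. \<phi> (c q))"
      unfolding continuous_on_eq_continuous_within
      using has_vector_derivative_continuous[OF c'(2)] by (simp add: o_def)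
    have "continuous_on ?V f"
    proof -
      have "f q = (c' q $ 1) *\<^sub>R frechet_derivative X (at (\<phi> (c q))) (axis 1 1)
          + (c' q $ 2) *\<^sub>R frechet_derivative X (at (\<phi> (c q))) (axis 2 1)" if "q \<in> ?V" for q
        unfolding f_def by (rule linear_vec2, rule has_derivative_linear, rule smooth_on_has_derivative[OF sX]) (use that in auto)
      moreover have "continuous_on ?V (\<lambda>q. frechet_derivative X (at (\<phi> (c q))) w)" for w
        by (rule continuous_on_compose2[OF smooth_on_imp_continuous_on[OF smooth_on_frechet_derivative_const[OF sX]] cphi]) auto
      then have "continuous_on ?V (\<lambda>q. (c' q $ 1) *\<^sub>R frechet_derivative X (at (\<phi> (c q))) (axis 1 1)
          + (c' q $ 2) *\<^sub>R frechet_derivative X (at (\<phi> (c q))) (axis 2 1))"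
        by (intro continuous_intros c'(1))
      ultimately show ?thesis by (metis (no_types, lifting) continuous_on_cong)
    qed
    then have "continuous_on ?V g" using gf by (metis (no_types, lifting) continuous_on_cong)
    then have "continuous (at r within {s..t}) g"
      using rV at_V[OF rV] unfolding continuous_on_eq_continuous_within by metis
    then show ?thesis using hv[OF rV] gf[OF rV] by simp
  qed
  show "continuous_on {s..t} g" using loc by (simp add: continuous_on_eq_continuous_within)
  show "((x \<circ> c) has_vector_derivative g r) (at r within {s..t})" if "r \<in> {s..t}" for r
    using loc that by blast
qed

abbreviation speed :: "(real \<Rightarrow> 'm) \<Rightarrow> real \<Rightarrow> real" where
  "speed c t \<equiv> norm (vector_derivative (x \<circ> c) (at t))"

text \<open>The speed is defined by two-sided derivatives, whereas a curve on a closed interval has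
  only one-sided ones at its ends. The integral is therefore transferred from the continuous
  derivative within the interval, with the two end points as exceptions.\<close>

lemma C1_curve_on_length:
  assumes "C1_curve_on A {s..t} c" "s \<le> t"
  shows "speed c integrable_on {s..t}" "norm (x (c t) - x (c s)) \<le> integral {s..t} (speed c)"
    "\<And>r. s < r \<Longrightarrow> r < t \<Longrightarrow> (x \<circ> c) differentiable (at r)"
proof -
  have "speed c integrable_on {s..t} \<and> norm (x (c t) - x (c s)) \<le> integral {s..t} (speed c) \<and>
    (\<forall>r. s < r \<and> r < t \<longrightarrow> (x \<circ> c) differentiable (at r))"
  proof (cases "s = t")
    case True
    then show ?thesis by (auto simp: integrable_on_def intro: has_integral_refl)
  next
    case False
    then have st: "s < t" using assms(2) by simp
    obtain g where g: "continuous_on {s..t} g"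
      "\<And>r. r \<in> {s..t} \<Longrightarrow> ((x \<circ> c) has_vector_derivative g r) (at r within {s..t})"
      using C1_curve_on_imp_C1_immersed[OF assms(1) st] by blast
    have at_r: "((x \<circ> c) has_vector_derivative g r) (at r)" if "s < r" "r < t" for r
      using g(2)[of r] that by (simp add: at_within_Icc_at)
    have ng: "(\<lambda>r. norm (g r)) integrable_on {s..t}"
      by (intro integrable_continuous_real continuous_intros g)
    have sp: "speed c r = norm (g r)" if "r \<in> {s..t} - {s, t}" for r
      using vector_derivative_at[OF at_r[of r]] that by auto
    have i: "speed c integrable_on {s..t}"
      by (rule integrable_spike_finite[where S = "{s, t}", OF _ sp ng]) auto
    have "integral {s..t} (speed c) = integral {s..t} (\<lambda>r. norm (g r))"
      by (rule integral_unique, rule has_integral_spike_finite[where S = "{s, t}", OF _ sp integrable_integral[OF ng]]) auto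
    moreover have ft: "(g has_integral (x \<circ> c) t - (x \<circ> c) s) {s..t}"
      by (rule fundamental_theorem_of_calculus[OF assms(2) g(2)])
    have "norm (integral {s..t} g) \<le> integral {s..t} (\<lambda>r. norm (g r))"
      by (rule integral_norm_bound_integral[OF has_integral_integrable[OF ft] ng]) simp
    ultimately show ?thesis
      using i at_r integral_unique[OF ft] vector_derivative_works
      by (auto intro: differentiableI_vector)
  qed
  then show "speed c integrable_on {s..t}" "norm (x (c t) - x (c s)) \<le> integral {s..t} (speed c)"
    "\<And>r. s < r \<Longrightarrow> r < t \<Longrightarrow> (x \<circ> c) differentiable (at r)" by blast+
qed

text \<open>Both claims pass to the union of adjacent intervals, so Bolzano's bisection principle
  reduces them to short intervals around a point \<open>r\<close>, where the only possible break
  point is \<open>r\<close> itself.\<close>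

lemma piecewise_C1_length:
  assumes "piecewise_C1_curve A c" "0 \<le> s" "s \<le> t" "t \<le> 1"
  shows "speed c integrable_on {s..t}" "norm (x (c t) - x (c s)) \<le> integral {s..t} (speed c)"
proof -
  obtain B where B: "finite B"
    "\<And>s t. 0 \<le> s \<Longrightarrow> s < t \<Longrightarrow> t \<le> 1 \<Longrightarrow> {s<..<t} \<inter> B = {} \<Longrightarrow> C1_curve_on A {s..t} c"
    using assms(1) unfolding piecewise_C1_curve_def by blast
  define P where "P = (\<lambda>a b. 0 \<le> a \<and> b \<le> 1 \<longrightarrow>
    speed c integrable_on {a..b} \<and> norm (x (c b) - x (c a)) \<le> integral {a..b} (speed c))"
  have tr: "P a b'" if "P a b" "P b b'" "a \<le> b" "b \<le> b'" for a b b'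
  proof -
    {
      assume ab: "0 \<le> a" "b' \<le> 1"
      then have 1: "speed c integrable_on {a..b}" "norm (x (c b) - x (c a)) \<le> integral {a..b} (speed c)"
        "speed c integrable_on {b..b'}" "norm (x (c b') - x (c b)) \<le> integral {b..b'} (speed c)"
        using that unfolding P_def by auto
      have 2: "speed c integrable_on {a..b'}" by (rule Henstock_Kurzweil_Integration.integrable_combine[OF that(3,4) 1(1,3)])
      have "norm (x (c b') - x (c a)) \<le> norm (x (c b) - x (c a)) + norm (x (c b') - x (c b))"
        using norm_triangle_ineq[of "x (c b) - x (c a)" "x (c b') - x (c b)"] by simp
      with 1 2 Henstock_Kurzweil_Integration.integral_combine[OF that(3,4) 2]
      have "speed c integrable_on {a..b'} \<and> norm (x (c b') - x (c a)) \<le> integral {a..b'} (speed c)" by linarith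
    }
    then show ?thesis unfolding P_def by blast
  qed
  have "P s t" using assms(3)
  proof (induction rule: Bolzano)
    case (trans a b c)
    then show ?case using tr by blast
  next
    case (local r)
    have "open (- (B - {r}))" using B(1) by (intro open_Compl finite_imp_closed) auto
    then obtain d where d: "d > 0" "ball r d \<subseteq> - (B - {r})"
      using open_contains_ball[of "- (B - {r})"] by auto
    have "P a b" if ab: "a \<le> r \<and> r \<le> b \<and> b - a < d" for a b
    proof -
      have free: "{a<..<r} \<inter> B = {}" "{r<..<b} \<inter> B = {}"
        using d(2) ab by (force simp: subset_eq dist_real_def)+
      have piece: "P p q" if "p \<le> q" "{p<..<q} \<inter> B = {}" for p q
      proof (cases "p = q")
        case True
        then show ?thesis unfolding P_def by (auto simp: integrable_on_def intro: has_integral_refl)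
      next
        case False
        then show ?thesis using C1_curve_on_length[OF B(2)] that unfolding P_def by auto
      qed
      show ?thesis using tr[OF piece[OF _ free(1)] piece[OF _ free(2)]] ab by blast
    qed
    then show ?case using d(1) by blast
  qed
  then show "speed c integrable_on {s..t}" "norm (x (c t) - x (c s)) \<le> integral {s..t} (speed c)"
    using assms unfolding P_def by auto
qed

lemma piecewise_C1_differentiable:
  assumes "piecewise_C1_curve A c"
  obtains F where "finite F" "\<And>r. r \<in> {0..1} - F \<Longrightarrow> (x \<circ> c) differentiable (at r)"
proof -
  obtain B where B: "finite B"
    "\<And>s t. 0 \<le> s \<Longrightarrow> s < t \<Longrightarrow> t \<le> 1 \<Longrightarrow> {s<..<t} \<inter> B = {} \<Longrightarrow> C1_curve_on A {s..t} c"
    using assms(1) unfolding piecewise_C1_curve_def by blast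
  show ?thesis
  proof (rule that[of "B \<union> {0, 1}"])
    show "(x \<circ> c) differentiable (at r)" if r: "r \<in> {0..1} - (B \<union> {0, 1})" for r
    proof -
      have "open ({0<..<1} - B)" using B(1) by (intro open_Diff finite_imp_closed) auto
      then obtain d where d: "d > 0" "cball r d \<subseteq> {0<..<1} - B"
        using r open_contains_cball[of "{0<..<1} - B"] by force
      have "{r - d..r + d} \<subseteq> {0<..<1} - B" using d(2) by (simp add: cball_eq_atLeastAtMost)
      moreover have "r - d \<in> {r - d..r + d}" "r + d \<in> {r - d..r + d}" using d(1) by auto
      moreover have "{r - d<..<r + d} \<subseteq> {r - d..r + d}" by auto
      ultimately have "0 \<le> r - d" "r + d \<le> 1" "{r - d<..<r + d} \<inter> B = {}"
        by (meson DiffD1 greaterThanLessThan_iff less_imp_le subsetD, meson DiffD1 greaterThanLessThan_iff less_imp_le subsetD, blast)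
      then show ?thesis using C1_curve_on_length(3)[OF B(2)[of "r - d" "r + d"], of r] d(1) by auto
    qed
  qed (use B(1) in auto)
qed

lemma norm_le_induced_length:
  assumes "piecewise_C1_curve A c" "0 \<le> s" "s \<le> t" "t \<le> 1"
  shows "norm (x (c t) - x (c s)) \<le> induced_length x c"
proof -
  have "norm (x (c t) - x (c s)) \<le> integral {s..t} (speed c)" by (rule piecewise_C1_length[OF assms])
  also have "\<dots> \<le> integral {0..1} (speed c)"
    using assms piecewise_C1_length(1)[OF assms] piecewise_C1_length(1)[OF assms(1), of 0 1]
    by (intro integral_subset_le) auto
  finally show ?thesis by (simp add: induced_length_def o_def)
qed

lemma induced_length_nonneg: "piecewise_C1_curve A c \<Longrightarrow> 0 \<le> induced_length x c"
  using norm_le_induced_length[of c 0 0] by simp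

lemma speed_affine:
  assumes "(speed c has_integral L) {0..1}" "finite F" "\<And>r. r \<in> {0..1} - F \<Longrightarrow> (x \<circ> c) differentiable (at r)"
    and "m \<noteq> 0" "(\<lambda>t. (t - k) / m) ` {0..1} = {p..q}"
  shows "(speed (\<lambda>t. c (m * t + k)) has_integral L) {p..q}"
proof -
  have im: "(\<lambda>t. (1 / m) *\<^sub>R t + - ((1 / m) *\<^sub>R k)) ` cbox 0 1 = {p..q}"
    using assms(5) by (simp add: diff_divide_distrib)
  have "((\<lambda>t. speed c (m *\<^sub>R t + k)) has_integral (1 / \<bar>m\<bar> ^ DIM(real)) *\<^sub>R L) {p..q}"
    using has_integral_affinity[of "speed c" L 0 1 m k] assms(1,4) unfolding im by simp
  from has_integral_mult_right[OF this, of "\<bar>m\<bar>"]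
  have i: "((\<lambda>t. \<bar>m\<bar> * speed c (m * t + k)) has_integral L) {p..q}" using assms(4) by simp
  show ?thesis
  proof (rule has_integral_spike_finite[OF _ _ i])
    show "finite ((\<lambda>t. (t - k) / m) ` F)" using assms(2) by simp
    show "speed (\<lambda>t. c (m * t + k)) r = \<bar>m\<bar> * speed c (m * r + k)"
      if r: "r \<in> {p..q} - (\<lambda>t. (t - k) / m) ` F" for r
    proof -
      obtain r' where r': "r' \<in> {0..1}" "r = (r' - k) / m" using r assms(5) by blast
      then have mr: "m * r + k = r'" using assms(4) by simp
      then have "r' \<notin> F" using r r' by auto
      then have d: "((x \<circ> c) has_vector_derivative vector_derivative (x \<circ> c) (at (m * r + k))) (at (m * r + k))"
        using assms(3)[of r'] r' mr by (simp add: vector_derivative_works)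
      have "((\<lambda>t. m * t + k) has_vector_derivative m) (at r)" by (auto intro!: derivative_eq_intros)
      from vector_diff_chain_at[OF this d]
      have "vector_derivative (x \<circ> (\<lambda>t. c (m * t + k))) (at r) = m *\<^sub>R vector_derivative (x \<circ> c) (at (m * r + k))"
        by (intro vector_derivative_at) (simp add: o_def)
      then show ?thesis by simp
    qed
  qed
qed

lemma speed_has_integral: "piecewise_C1_curve A c \<Longrightarrow> (speed c has_integral induced_length x c) {0..1}"
  unfolding induced_length_def using piecewise_C1_length(1)[of c 0 1] by (simp add: integrable_integral o_def)

text \<open>The reversal is written in the form m t + k so that it falls under
  \<open>C1_curve_on_affine\<close> and \<open>speed_affine\<close>.\<close>

lemma reverse_curve:
  assumes "piecewise_C1_curve A c"
  shows "piecewise_C1_curve A (\<lambda>t. c (- 1 * t + 1))" "induced_length x (\<lambda>t. c (- 1 * t + 1)) = induced_length x c"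
proof -
  obtain B where B: "finite B" "continuous_on {0..1} c"
    "\<And>s t. 0 \<le> s \<Longrightarrow> s < t \<Longrightarrow> t \<le> 1 \<Longrightarrow> {s<..<t} \<inter> B = {} \<Longrightarrow> C1_curve_on A {s..t} c"
    using assms(1) unfolding piecewise_C1_curve_def by blast
  have "continuous_on {0..1} (\<lambda>t. c (- 1 * t + 1))"
    by (rule continuous_on_compose2[OF B(2)]) (auto intro!: continuous_intros)
  moreover have "C1_curve_on A {s..t} (\<lambda>t. c (- 1 * t + 1))"
    if st: "0 \<le> s" "s < t" "t \<le> 1" "{s<..<t} \<inter> (\<lambda>b. 1 - b) ` B = {}" for s t
  proof (rule C1_curve_on_affine)
    have "r \<notin> B" if "1 - t < r" "r < 1 - s" for r
    proof
      assume "r \<in> B"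
      then have "1 - r \<in> {s<..<t} \<inter> (\<lambda>b. 1 - b) ` B" using that by auto
      then show False using st(4) by blast
    qed
    then show "C1_curve_on A {1 - t..1 - s} c" using st by (intro B(3)) auto
  qed auto
  ultimately show "piecewise_C1_curve A (\<lambda>t. c (- 1 * t + 1))"
    unfolding piecewise_C1_curve_def using B(1) by (intro conjI exI[of _ "(\<lambda>b. 1 - b) ` B"]) simp_all
  obtain F where F: "finite F" "\<And>r. r \<in> {0..1} - F \<Longrightarrow> (x \<circ> c) differentiable (at r)"
    using piecewise_C1_differentiable[OF assms] by blast
  have "(\<lambda>t. (t - 1) / - 1) ` {0..1} = {0..1::real}"
    using image_diff_atLeastAtMost[of 1 0 "1::real"] by simp
  from speed_affine[OF speed_has_integral[OF assms] F _ this]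
  show "induced_length x (\<lambda>t. c (- 1 * t + 1)) = induced_length x c"
    unfolding induced_length_def[of x "\<lambda>t. c (- 1 * t + 1)"] by (simp add: integral_unique o_def)
qed

lemma join_curve:
  assumes "piecewise_C1_curve A c1" "piecewise_C1_curve A c2" "c1 1 = c2 0"
  shows "piecewise_C1_curve A (c1 +++ c2)" "induced_length x (c1 +++ c2) = induced_length x c1 + induced_length x c2"
proof -
  obtain B1 where B1: "finite B1" "continuous_on {0..1} c1"
    "\<And>s t. 0 \<le> s \<Longrightarrow> s < t \<Longrightarrow> t \<le> 1 \<Longrightarrow> {s<..<t} \<inter> B1 = {} \<Longrightarrow> C1_curve_on A {s..t} c1"
    using assms(1) unfolding piecewise_C1_curve_def by blast
  obtain B2 where B2: "finite B2" "continuous_on {0..1} c2"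
    "\<And>s t. 0 \<le> s \<Longrightarrow> s < t \<Longrightarrow> t \<le> 1 \<Longrightarrow> {s<..<t} \<inter> B2 = {} \<Longrightarrow> C1_curve_on A {s..t} c2"
    using assms(2) unfolding piecewise_C1_curve_def by blast
  \<comment> \<open>As the joint 1/2 is itself a break point, an interval avoiding \<open>B\<close>
    lies in one half, where the joined curve is an affine reparametrisation of \<open>c1\<close> or
    of \<open>c2\<close>.\<close>
  define B where "B = {1/2} \<union> (\<lambda>b. b / 2) ` B1 \<union> (\<lambda>b. (b + 1) / 2) ` B2"
  have left: "(c1 +++ c2) t = c1 (2 * t + 0)" if "t \<le> 1/2" for t using that by (simp add: joinpaths_def)
  have right: "(c1 +++ c2) t = c2 (2 * t + - 1)" if "t \<ge> 1/2" for t
  proof (cases "t = 1/2")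
    case True
    show ?thesis unfolding True using assms(3) by (simp add: joinpaths_def)
  next
    case False
    then show ?thesis using that by (simp add: joinpaths_def)
  qed
  have "continuous_on {0..1} (c1 +++ c2)"
    using path_join_imp[of c1 c2] B1(2) B2(2) assms(3) by (simp add: path_def pathfinish_def pathstart_def)
  moreover have "C1_curve_on A {s..t} (c1 +++ c2)"
    if st: "0 \<le> s" "s < t" "t \<le> 1" "{s<..<t} \<inter> B = {}" for s t
  proof -
    have "1/2 \<in> B" unfolding B_def by simp
    then consider "t \<le> 1/2" | "s \<ge> 1/2" using st by force
    then show ?thesis
    proof cases
      case 1
      have "r \<notin> B1" if "2 * s < r" "r < 2 * t" for r
      proof
        assume "r \<in> B1"
        then have "r / 2 \<in> {s<..<t} \<inter> B" using that unfolding B_def by auto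
        then show False using st(4) by blast
      qed
      then have "C1_curve_on A {2 * s..2 * t} c1" using st 1 by (intro B1(3)) auto
      then have "C1_curve_on A {s..t} (\<lambda>t. c1 (2 * t + 0))" by (rule C1_curve_on_affine) auto
      then show ?thesis by (rule C1_curve_on_cong[rotated]) (use 1 left in auto)
    next
      case 2
      have "r \<notin> B2" if "2 * s - 1 < r" "r < 2 * t - 1" for r
      proof
        assume "r \<in> B2"
        then have "(r + 1) / 2 \<in> {s<..<t} \<inter> B" using that unfolding B_def by auto
        then show False using st(4) by blast
      qed
      then have "C1_curve_on A {2 * s - 1..2 * t - 1} c2" using st 2 by (intro B2(3)) auto
      then have "C1_curve_on A {s..t} (\<lambda>t. c2 (2 * t + - 1))" by (rule C1_curve_on_affine) auto
      then show ?thesis by (rule C1_curve_on_cong[rotated]) (use 2 right in auto)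
    qed
  qed
  moreover have "finite B" unfolding B_def using B1(1) B2(1) by simp
  ultimately show "piecewise_C1_curve A (c1 +++ c2)"
    unfolding piecewise_C1_curve_def by (intro conjI exI[of _ B]) simp_all
  have loc: "vector_derivative (x \<circ> f) (at r) = vector_derivative (x \<circ> f2) (at r)"
    if "open T" "r \<in> T" "\<And>t. t \<in> T \<Longrightarrow> f t = f2 t" for f f2 T r
  proof -
    have "((x \<circ> f) has_vector_derivative d) (at r) \<longleftrightarrow> ((x \<circ> f2) has_vector_derivative d) (at r)" for d
      using has_vector_derivative_transform_within_open[OF _ that(1,2), of "x \<circ> f" d "x \<circ> f2"]
        has_vector_derivative_transform_within_open[OF _ that(1,2), of "x \<circ> f2" d "x \<circ> f"] that(3) by auto
    then show ?thesis unfolding vector_derivative_def by simp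
  qed
  obtain F1 where F1: "finite F1" "\<And>r. r \<in> {0..1} - F1 \<Longrightarrow> (x \<circ> c1) differentiable (at r)"
    using piecewise_C1_differentiable[OF assms(1)] by blast
  obtain F2 where F2: "finite F2" "\<And>r. r \<in> {0..1} - F2 \<Longrightarrow> (x \<circ> c2) differentiable (at r)"
    using piecewise_C1_differentiable[OF assms(2)] by blast
  have "(\<lambda>t. (t - 0) / 2) ` {0..1} = {0..1/2::real}"
    using image_affinity_atLeastAtMost_div[of 2 0 0 1] by simp
  from speed_affine[OF speed_has_integral[OF assms(1)] F1 _ this]
  have 1: "(speed (\<lambda>t. c1 (2 * t + 0)) has_integral induced_length x c1) {0..1/2}" by simp
  have "(\<lambda>t. (t - - 1) / 2) ` {0..1} = {1/2..1::real}"
    using image_affinity_atLeastAtMost_div[of 2 "1/2" 0 1] by (simp add: add_divide_distrib)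
  from speed_affine[OF speed_has_integral[OF assms(2)] F2 _ this]
  have 2: "(speed (\<lambda>t. c2 (2 * t + - 1)) has_integral induced_length x c2) {1/2..1}" by simp
  have "(speed (c1 +++ c2) has_integral induced_length x c1) {0..1/2}"
    by (rule has_integral_spike_finite[OF _ _ 1, of "{1/2}"])
      (use left in \<open>auto intro!: arg_cong[where f = norm] loc[of "{..<1/2}"]\<close>)
  moreover have "(speed (c1 +++ c2) has_integral induced_length x c2) {1/2..1}"
    by (rule has_integral_spike_finite[OF _ _ 2, of "{1/2}"])
      (use right in \<open>auto intro!: arg_cong[where f = norm] loc[of "{1/2<..}"]\<close>)
  ultimately have "(speed (c1 +++ c2) has_integral induced_length x c1 + induced_length x c2) {0..1}"
    by (intro has_integral_combine[of 0 "1/2" 1]) auto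
  then show "induced_length x (c1 +++ c2) = induced_length x c1 + induced_length x c2"
    unfolding induced_length_def[of x "c1 +++ c2"] by (simp add: integral_unique)
qed

end

section \<open>Coordinate segments and the induced distance\<close>

context immersed_surface begin

abbreviation d :: "'m \<Rightarrow> 'm \<Rightarrow> real" where "d \<equiv> induced_dist A x"

definition chart_segment :: "'m set \<Rightarrow> ('m \<Rightarrow> real^2) \<Rightarrow> real^2 \<Rightarrow> real^2 \<Rightarrow> real \<Rightarrow> 'm" where
  "chart_segment U \<phi> u w t = inv_into U \<phi> (u + t *\<^sub>R w)"

text \<open>Read in any other chart, a coordinate segment is a transition map along a line, hence
  C1. The length bound is what compares the induced distance with coordinate data.\<close>

lemma chart_segment:
  assumes ch: "(U, \<phi>) \<in> A" and seg: "\<And>t. t \<in> {0..1} \<Longrightarrow> u + t *\<^sub>R w \<in> \<phi> ` U"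
  shows "piecewise_C1_curve A (chart_segment U \<phi> u w)"
    and "(\<And>t. t \<in> {0..1} \<Longrightarrow> norm (frechet_derivative (rep U \<phi>) (at (u + t *\<^sub>R w)) w) \<le> M)
      \<Longrightarrow> induced_length x (chart_segment U \<phi> u w) \<le> M"
proof -
  let ?c = "chart_segment U \<phi> u w" and ?l = "\<lambda>t. u + t *\<^sub>R w"
  have cl: "continuous_on T ?l" for T by (intro continuous_intros)
  have dl: "(?l has_vector_derivative w) (at t within T)" for t T
    by (auto intro!: derivative_eq_intros)
  have inU: "?c t \<in> U" "\<phi> (?c t) = ?l t" if "t \<in> {0..1}" for t
    using seg[OF that] by (auto simp: chart_segment_def inv_into_into f_inv_into_f)
  have cc: "continuous_on {0..1} ?c"
    unfolding chart_segment_def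
    by (rule continuous_on_compose2[OF homeomorphism_cont2[OF chart_homeo[OF ch]] cl]) (use seg in auto)
  have C1: "C1_curve_on A {s..t} ?c" if st: "0 \<le> s" "t \<le> 1" for s t
    unfolding C1_curve_on_def
  proof (intro conjI ballI)
    show "continuous_on {s..t} ?c" using cc by (rule continuous_on_subset) (use st in auto)
  next
    fix ch2 assume "ch2 \<in> A"
    then obtain V \<psi> where c2: "(V, \<psi>) \<in> A" "ch2 = (V, \<psi>)" by (cases ch2) blast
    let ?J = "{s..t} \<inter> ?c -` V"
    define \<Psi> where "\<Psi> = \<psi> \<circ> inv_into U \<phi>"
    have sm: "smooth_on (\<phi> ` (U \<inter> V)) \<Psi>" unfolding \<Psi>_def by (rule smooth_transition[OF ch c2(1)])
    have lJ: "?l r \<in> \<phi> ` (U \<inter> V)" if "r \<in> ?J" for r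
    proof -
      have "r \<in> {0..1}" using that st by auto
      from inU[OF this] have "?c r \<in> U \<inter> V" "?l r = \<phi> (?c r)" using that by auto
      then show ?thesis by (rule image_eqI[rotated])
    qed
    have "continuous_on (\<phi> ` (U \<inter> V)) (\<lambda>z. frechet_derivative \<Psi> (at z) w)"
      by (rule smooth_on_imp_continuous_on[OF smooth_on_frechet_derivative_const[OF sm]])
    from continuous_on_compose2[OF this cl image_subsetI[OF lJ]]
    have "continuous_on ?J (\<lambda>r. frechet_derivative \<Psi> (at (?l r)) w)" .
    moreover have "((\<psi> \<circ> ?c) has_vector_derivative frechet_derivative \<Psi> (at (?l r)) w) (at r within ?J)"
      if r: "r \<in> ?J" for r
    proof -
      have "(\<Psi> has_derivative frechet_derivative \<Psi> (at (?l r))) (at (?l r) within ?l ` ?J)"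
        by (rule has_derivative_at_withinI[OF smooth_on_has_derivative[OF sm lJ[OF r]]])
      from vector_derivative_diff_chain_within[OF dl this]
      show ?thesis by (simp add: \<Psi>_def chart_segment_def o_def)
    qed
    ultimately show "case ch2 of (U, \<phi>) \<Rightarrow> \<exists>c'. continuous_on ({s..t} \<inter> ?c -` U) c' \<and>
        (\<forall>r\<in>{s..t} \<inter> ?c -` U. ((\<phi> \<circ> ?c) has_vector_derivative c' r) (at r within {s..t} \<inter> ?c -` U))"
      unfolding c2(2) by auto
  qed
  then show pw: "piecewise_C1_curve A ?c"
    unfolding piecewise_C1_curve_def using cc by (intro conjI exI[of _ "{}"]) auto
  assume M: "\<And>t. t \<in> {0..1} \<Longrightarrow> norm (frechet_derivative (rep U \<phi>) (at (?l t)) w) \<le> M"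
  have sp: "speed ?c t \<le> M" if t: "t \<in> {0..1}" for t
  proof -
    have "((rep U \<phi> \<circ> ?l) has_vector_derivative frechet_derivative (rep U \<phi>) (at (?l t)) w) (at t)"
      by (rule vector_derivative_diff_chain_within[OF dl has_derivative_at_withinI[OF smooth_on_has_derivative[OF smooth_rep[OF ch] seg[OF t]]]])
    moreover have "rep U \<phi> \<circ> ?l = x \<circ> ?c" by (auto simp: local_rep_def chart_segment_def)
    ultimately show ?thesis using M[OF t] vector_derivative_at by metis
  qed
  have "integral {0..1} (speed ?c) \<le> integral {0..1::real} (\<lambda>t. M)"
    by (rule integral_le[OF piecewise_C1_length(1)[OF pw] _ sp]) (auto simp: integrable_const_ivl)
  then show "induced_length x ?c \<le> M" by (simp add: induced_length_def o_def)
qed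

lemma d_le: "piecewise_C1_curve A c \<Longrightarrow> d (c 0) (c 1) \<le> induced_length x c"
  unfolding induced_dist_def by (rule cInf_lower) (auto intro!: bdd_belowI[of _ 0] induced_length_nonneg)

lemma chart_segment_d_le:
  assumes ch: "(U, \<phi>) \<in> A" and seg: "\<And>t. t \<in> {0..1} \<Longrightarrow> u + t *\<^sub>R w \<in> \<phi> ` U"
    and "\<And>t. t \<in> {0..1} \<Longrightarrow> norm (frechet_derivative (rep U \<phi>) (at (u + t *\<^sub>R w)) w) \<le> M"
  shows "d (inv_into U \<phi> u) (inv_into U \<phi> (u + w)) \<le> M"
  using chart_segment[OF assms(1,2)] assms(3) d_le[of "chart_segment U \<phi> u w"]
  by (force simp: chart_segment_def)

lemma curve_near:
  obtains T where "open T" "p \<in> T"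
    "\<And>q. q \<in> T \<Longrightarrow> \<exists>c. piecewise_C1_curve A c \<and> c 0 = p \<and> c 1 = q"
proof -
  obtain U \<phi> where ch: "(U, \<phi>) \<in> A" "p \<in> U" using chart_at by blast
  obtain r where r: "r > 0" "ball (\<phi> p) r \<subseteq> \<phi> ` U"
    using open_chart_image[OF ch(1)] ch(2) open_contains_ball by (metis imageI)
  show ?thesis
  proof
    show "open (U \<inter> \<phi> -` ball (\<phi> p) r)"
      using homeomorphism_cont1[OF chart_homeo[OF ch(1)]] open_chart[OF ch(1)]
      by (simp add: continuous_open_preimage)
    show "p \<in> U \<inter> \<phi> -` ball (\<phi> p) r" using ch r by simp
    fix q assume q: "q \<in> U \<inter> \<phi> -` ball (\<phi> p) r"
    define w where "w = \<phi> q - \<phi> p"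
    have "\<phi> p + t *\<^sub>R w \<in> \<phi> ` U" if "t \<in> {0..1}" for t
    proof -
      have "\<phi> p \<in> ball (\<phi> p) r" "\<phi> q \<in> ball (\<phi> p) r" using q r by auto
      then have "(1 - t) *\<^sub>R \<phi> p + t *\<^sub>R \<phi> q \<in> ball (\<phi> p) r"
        using convexD[OF convex_ball, of "\<phi> p" "\<phi> p" r "\<phi> q" "1 - t" t] that by auto
      then show ?thesis using r(2) by (auto simp: w_def algebra_simps)
    qed
    from chart_segment(1)[OF ch(1) this]
    show "\<exists>c. piecewise_C1_curve A c \<and> c 0 = p \<and> c 1 = q"
      using q by (intro exI[of _ "chart_segment U \<phi> (\<phi> p) w"])
        (auto simp: chart_segment_def w_def chart_inverse[OF ch(1)] ch(2))
  qed
qed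

end

section \<open>The induced distance as a metric, and Ekeland's principle\<close>

locale complete_surface = immersed_surface +
  assumes conn: "connected (UNIV :: 'a set)" and complete: "complete_induced_metric A x"
begin

text \<open>Being joined by a curve is an equivalence relation with open classes. It follows that
  the infimum defining the distance is over a nonempty set; the infimum of the empty set would carry
  no information.\<close>

lemma ex_curve: "\<exists>c. piecewise_C1_curve A c \<and> c 0 = p \<and> c 1 = q"
proof (rule connected_equivalence_relation[OF conn, where R = "\<lambda>p q. \<exists>c. piecewise_C1_curve A c \<and> c 0 = p \<and> c 1 = q"])
  show "\<exists>c. piecewise_C1_curve A c \<and> c 0 = q \<and> c 1 = p"
    if pq: "\<exists>c. piecewise_C1_curve A c \<and> c 0 = p \<and> c 1 = q" for p q
  proof -
    obtain c where c: "piecewise_C1_curve A c" "c 0 = p" "c 1 = q" using pq by blast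
    then show ?thesis using reverse_curve(1)[OF c(1)] by (intro exI[of _ "\<lambda>t. c (- 1 * t + 1)"]) simp
  qed
  show "\<exists>c. piecewise_C1_curve A c \<and> c 0 = p \<and> c 1 = r"
    if pqr: "\<exists>c. piecewise_C1_curve A c \<and> c 0 = p \<and> c 1 = q" "\<exists>c. piecewise_C1_curve A c \<and> c 0 = q \<and> c 1 = r" for p q r
  proof -
    obtain c1 c2 where c: "piecewise_C1_curve A c1" "c1 0 = p" "c1 1 = q"
      "piecewise_C1_curve A c2" "c2 0 = q" "c2 1 = r" using pqr by blast
    then show ?thesis using join_curve(1)[OF c(1,4)] by (intro exI[of _ "c1 +++ c2"]) (simp add: joinpaths_def)
  qed
  show "\<exists>T. openin (top_of_set UNIV) T \<and> p \<in> T \<and> (\<forall>q\<in>T. \<exists>c. piecewise_C1_curve A c \<and> c 0 = p \<and> c 1 = q)" for p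
    using curve_near[of p] by (metis open_openin subtopology_UNIV)
qed auto

lemma d_lessE:
  assumes "d p q < r"
  obtains c where "piecewise_C1_curve A c" "c 0 = p" "c 1 = q" "induced_length x c < r"
proof -
  have "{induced_length x c | c. piecewise_C1_curve A c \<and> c 0 = p \<and> c 1 = q} \<noteq> {}"
    using ex_curve by blast
  from cInf_lessD[OF this assms[unfolded induced_dist_def]] that show ?thesis by blast
qed

lemma d_nonneg: "0 \<le> d p q"
  unfolding induced_dist_def
  by (rule cInf_greatest) (use ex_curve[of p q] induced_length_nonneg in auto)

lemma d_triangle: "d p r \<le> d p q + d q r"
proof (rule field_le_epsilon)
  fix e :: real assume "e > 0"
  obtain c1 where c1: "piecewise_C1_curve A c1" "c1 0 = p" "c1 1 = q" "induced_length x c1 < d p q + e / 2"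
    using d_lessE[of p q "d p q + e / 2"] \<open>e > 0\<close> by auto
  obtain c2 where c2: "piecewise_C1_curve A c2" "c2 0 = q" "c2 1 = r" "induced_length x c2 < d q r + e / 2"
    using d_lessE[of q r "d q r + e / 2"] \<open>e > 0\<close> by auto
  have "d ((c1 +++ c2) 0) ((c1 +++ c2) 1) \<le> induced_length x c1 + induced_length x c2"
    using d_le[OF join_curve(1)[OF c1(1) c2(1)]] join_curve(2)[OF c1(1) c2(1)] c1 c2 by simp
  then show "d p r \<le> d p q + d q r + e" using c1 c2 by (simp add: joinpaths_def)
qed

lemma d_sym_le: "d q p \<le> d p q"
proof (rule field_le_epsilon)
  fix e :: real assume "e > 0"
  then obtain c where c: "piecewise_C1_curve A c" "c 0 = p" "c 1 = q" "induced_length x c < d p q + e"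
    using d_lessE[of p q "d p q + e"] by auto
  then show "d q p \<le> d p q + e" using d_le[OF reverse_curve(1)[OF c(1)]] reverse_curve(2)[OF c(1)] by simp
qed

lemma d_sym: "d q p = d p q"
  using d_sym_le[of p q] d_sym_le[of q p] by simp

lemma d_refl: "d p p = 0"
proof -
  obtain U \<phi> where ch: "(U, \<phi>) \<in> A" "p \<in> U" using chart_at by blast
  have lin: "linear (frechet_derivative (rep U \<phi>) (at (\<phi> p)))"
    by (rule has_derivative_linear[OF smooth_on_has_derivative[OF smooth_rep[OF ch(1)]]]) (use ch in auto)
  have "d (inv_into U \<phi> (\<phi> p)) (inv_into U \<phi> (\<phi> p + 0)) \<le> 0"
    by (rule chart_segment_d_le[OF ch(1)]) (use ch linear_0[OF lin] in auto)
  then show ?thesis using d_nonneg[of p p] chart_inverse[OF ch] by simp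
qed

text \<open>Near \<open>p\<close> the injective differential gives \<open>X\<close> a lower
  Lipschitz bound at the centre. A curve leaving the coordinate disc of radius \<open>\<rho>\<close>
  crosses its boundary, where the immersion has moved by at least
  \<open>\<kappa> / 2 * \<rho>\<close>, and the curve is no shorter than this chord. Thus
  convergence in the induced distance implies convergence in the manifold, which makes completeness
  usable for continuous functions.\<close>

lemma d_small_imp_near:
  assumes "open W" "p \<in> W"
  obtains \<delta> where "\<delta> > 0" "\<And>q. d p q < \<delta> \<Longrightarrow> q \<in> W"
proof -
  obtain U \<phi> where ch: "(U, \<phi>) \<in> A" "p \<in> U" using chart_at by blast
  define X where "X = rep U \<phi>"
  define u where "u = \<phi> p"
  have u: "u \<in> \<phi> ` U" using ch u_def by simp
  have der: "(X has_derivative frechet_derivative X (at u)) (at u)"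
    unfolding X_def by (rule smooth_on_has_derivative[OF smooth_rep[OF ch(1)] u])
  obtain \<kappa> where \<kappa>: "\<kappa> > 0" "\<And>w. \<kappa> * norm w \<le> norm (frechet_derivative X (at u) w)"
    using linear_inj_bounded_below_pos[OF has_derivative_linear[OF der]] inj_rep[OF ch(1) u] unfolding X_def
    by metis
  obtain r0 where r0: "r0 > 0" "\<And>z. norm (z - u) < r0 \<Longrightarrow>
      norm (X z - X u - frechet_derivative X (at u) (z - u)) \<le> \<kappa> / 2 * norm (z - u)"
    using der[unfolded has_derivative_at_alt] \<kappa>(1) by (meson half_gt_zero)
  have low: "\<kappa> / 2 * norm (z - u) \<le> norm (X z - X u)" if "norm (z - u) < r0" for z
  proof -
    have "norm (frechet_derivative X (at u) (z - u)) \<le> norm (X z - X u) + norm (X z - X u - frechet_derivative X (at u) (z - u))"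
      using norm_triangle_ineq4[of "X z - X u" "X z - X u - frechet_derivative X (at u) (z - u)"] by simp
    then show ?thesis using r0(2)[OF that] \<kappa>(2)[of "z - u"] by (simp add: field_simps)
  qed
  obtain r1 where r1: "r1 > 0" "cball u r1 \<subseteq> \<phi> ` (U \<inter> W)"
    using open_image_Int[OF ch(1) assms(1)] ch assms(2) unfolding u_def
    by (metis IntI image_eqI open_contains_cball)
  define \<rho> where "\<rho> = min r1 (r0 / 2)"
  have \<rho>: "\<rho> > 0" "\<rho> < r0" "cball u \<rho> \<subseteq> \<phi> ` (U \<inter> W)"
    using r0 r1 unfolding \<rho>_def by (auto simp: subset_iff min_def split: if_splits)
  define G where "G = U \<inter> \<phi> -` ball u \<rho>"
  define K where "K = inv_into U \<phi> ` cball u \<rho>"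
  have G: "open G" unfolding G_def
    using homeomorphism_cont1[OF chart_homeo[OF ch(1)]] open_chart[OF ch(1)]
    by (simp add: continuous_open_preimage)
  have "continuous_on (cball u \<rho>) (inv_into U \<phi>)"
    using continuous_on_subset[OF homeomorphism_cont2[OF chart_homeo[OF ch(1)]]] \<rho>(3) by blast
  \<comment> \<open>The Hausdorff property enters here: the compact image of the closed disc is
    closed in the manifold, so the frontier of \<open>G\<close> stays inside the chart.\<close>
  then have "closed K" unfolding K_def by (intro compact_imp_closed compact_continuous_image) auto
  moreover have "G \<subseteq> K"
  proof
    fix q assume "q \<in> G"
    then have "q = inv_into U \<phi> (\<phi> q)" "\<phi> q \<in> cball u \<rho>"
      using chart_inverse[OF ch(1)] unfolding G_def by auto
    then show "q \<in> K" unfolding K_def by blast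
  qed
  ultimately have clG: "closure G \<subseteq> K" by (simp add: closure_minimal)
  have GW: "G \<subseteq> W"
  proof
    fix q assume q: "q \<in> G"
    then have "\<phi> q \<in> \<phi> ` (U \<inter> W)" using \<rho>(3) unfolding G_def by auto
    then show "q \<in> W" using q chart_inj[OF ch(1)] unfolding G_def by (auto dest: inj_onD)
  qed
  show ?thesis
  proof
    show "\<kappa> / 2 * \<rho> > 0" using \<kappa> \<rho> by simp
    fix q assume dq: "d p q < \<kappa> / 2 * \<rho>"
    show "q \<in> W"
    proof (rule ccontr)
      assume "q \<notin> W"
      then have qG: "q \<notin> G" using GW by blast
      obtain c where c: "piecewise_C1_curve A c" "c 0 = p" "c 1 = q" "induced_length x c < \<kappa> / 2 * \<rho>"
        using d_lessE[OF dq] by blast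
      have "connected (c ` {0..1})"
        using c(1) unfolding piecewise_C1_curve_def by (intro connected_continuous_image) auto
      moreover have "p \<in> c ` {0..1} \<inter> G" "q \<in> c ` {0..1} - G"
        using c qG ch \<rho> unfolding G_def u_def by (force simp: image_iff)+
      ultimately have "c ` {0..1} \<inter> frontier G \<noteq> {}" using connected_Int_frontier by blast
      then obtain t where t: "t \<in> {0..1}" "c t \<in> frontier G" by blast
      then have tG: "c t \<in> closure G" "c t \<notin> G"
        using interior_open[OF G] unfolding frontier_def by simp_all
      then obtain z where z: "z \<in> cball u \<rho>" "c t = inv_into U \<phi> z" using clG tG(1) unfolding K_def by auto
      have zU: "z \<in> \<phi> ` U" using z(1) \<rho>(3) by blast
      then have "c t \<in> U" "\<phi> (c t) = z" unfolding z(2) by (auto simp: inv_into_into f_inv_into_f)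
      then have "norm (z - u) = \<rho>" using tG(2) z(1) unfolding G_def by (auto simp: dist_norm norm_minus_commute)
      moreover have "X z = x (c t)" "X u = x p"
        using z(2) local_rep_chart[OF ch] unfolding X_def u_def by (auto simp: local_rep_def)
      ultimately have "\<kappa> / 2 * \<rho> \<le> norm (x (c t) - x (c 0))" using low[of z] \<rho>(2) c(2) by simp
      also have "\<dots> \<le> induced_length x c" using norm_le_induced_length[OF c(1), of 0 t] t(1) by simp
      finally show False using c(4) by simp
    qed
  qed
qed

lemma d_tendsto_imp_tendsto:
  assumes "(\<lambda>n. d (s n) p) \<longlonglongrightarrow> 0"
  shows "s \<longlonglongrightarrow> p"
proof (rule topological_tendstoI)
  fix W assume "open W" "p \<in> W"
  then obtain \<delta> where \<delta>: "\<delta> > 0" "\<And>q. d p q < \<delta> \<Longrightarrow> q \<in> W" using d_small_imp_near by blast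
  have "eventually (\<lambda>n. d (s n) p < \<delta>) sequentially" using assms \<delta>(1) by (rule order_tendstoD)
  then show "eventually (\<lambda>n. s n \<in> W) sequentially" by eventually_elim (use \<delta>(2) d_sym in metis)
qed

text \<open>By the triangle inequality, \<open>q \<in> S p\<close> is a transitive relation. Moving
  each time to a near-minimiser of \<open>f\<close> on the current set gives a Cauchy sequence,
  since the decrease of \<open>f\<close> dominates the distances. Its limit lies in all these sets,
  and so would a point violating the claim, but with a value of \<open>f\<close> that
  near-minimality rules out.\<close>

lemma ekeland:
  fixes f :: "'a \<Rightarrow> real"
  assumes cont: "continuous_on UNIV f" and low: "\<And>q. m \<le> f q" and \<epsilon>: "\<epsilon> > 0"
  obtains p where "\<And>q. f p - \<epsilon> * d p q \<le> f q"
proof -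
  define S where "S = (\<lambda>p. {q. f q + \<epsilon> * d p q \<le> f p})"
  have refl: "p \<in> S p" for p unfolding S_def by (simp add: d_refl)
  have trans: "r \<in> S p" if "q \<in> S p" "r \<in> S q" for p q r
    using that mult_left_mono[OF d_triangle[of p r q], of \<epsilon>] \<epsilon> unfolding S_def by (simp add: algebra_simps)
  have bdd: "bdd_below (f ` S p)" for p by (rule bdd_belowI2) (rule low)
  have "\<exists>q\<in>S p. f q < Inf (f ` S p) + inverse (Suc n)" for p and n :: nat
    using cInf_lessD[of "f ` S p" "Inf (f ` S p) + inverse (Suc n)"] refl by auto
  define nxt where "nxt = (\<lambda>(n::nat) p. SOME q. q \<in> S p \<and> f q < Inf (f ` S p) + inverse (Suc n))"
  have nxt: "nxt n p \<in> S p \<and> f (nxt n p) < Inf (f ` S p) + inverse (Suc n)" for n p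
    unfolding nxt_def by (rule someI_ex) (use \<open>\<And>p n. \<exists>q\<in>S p. f q < Inf (f ` S p) + inverse (Suc n)\<close> in blast)
  \<comment> \<open>Any starting point will do, as the location of the resulting point is
    irrelevant.\<close>
  define s where "s = rec_nat undefined nxt"
  have s: "s (Suc n) \<in> S (s n)" "f (s (Suc n)) < Inf (f ` S (s n)) + inverse (Suc n)" for n
    unfolding s_def using nxt by auto
  have s_mono: "s n \<in> S (s k)" if "k \<le> n" for k n
    using that by (induction rule: dec_induct) (use refl trans s(1) in blast)+
  have dec: "f (s n) \<le> f (s k)" if "k \<le> n" for k n
    using s_mono[OF that] \<epsilon> d_nonneg[of "s k" "s n"] unfolding S_def
    by (smt (verit, best) mem_Collect_eq mult_nonneg_nonneg)
  then have "decseq (\<lambda>n. f (s n))" unfolding decseq_def by blast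
  then obtain l where l: "(\<lambda>n. f (s n)) \<longlonglongrightarrow> l" using decseq_convergent[of "\<lambda>n. f (s n)" m] low by blast
  have ds: "d (s k) (s n) \<le> (f (s k) - f (s n)) / \<epsilon>" if "k \<le> n" for k n
    using s_mono[OF that] \<epsilon> unfolding S_def by (simp add: field_simps)
  have "\<exists>N. \<forall>k\<ge>N. \<forall>n\<ge>N. d (s k) (s n) < e" if "e > 0" for e
  proof -
    have "Cauchy (\<lambda>n. f (s n))" using l by (rule LIMSEQ_imp_Cauchy)
    then obtain N where N: "\<And>k n. N \<le> k \<Longrightarrow> N \<le> n \<Longrightarrow> \<bar>f (s k) - f (s n)\<bar> < \<epsilon> * e"
      using \<epsilon> \<open>e > 0\<close> unfolding Cauchy_def dist_real_def by (metis mult_pos_pos)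
    have le: "d (s k) (s n) < e" if "N \<le> k" "k \<le> n" for k n
    proof -
      have "(f (s k) - f (s n)) / \<epsilon> < e" using N[of k n] that \<epsilon> by (simp add: field_simps)
      then show ?thesis using ds[OF that(2)] by simp
    qed
    have "d (s k) (s n) < e" if "N \<le> k" "N \<le> n" for k n
      using le[of k n] le[of n k] d_sym[of "s k" "s n"] that by (cases "k \<le> n") auto
    then show ?thesis by blast
  qed
  then obtain p where p: "(\<lambda>n. d (s n) p) \<longlonglongrightarrow> 0" using complete unfolding complete_induced_metric_def by blast
  have "isCont f p" using cont by (simp add: continuous_on_eq_continuous_at)
  then have fp: "(\<lambda>n. f (s n)) \<longlonglongrightarrow> f p"
    using d_tendsto_imp_tendsto[OF p] isCont_tendsto_compose by blast
  have pS: "p \<in> S (s k)" for k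
  proof -
    have "d (s k) p \<le> (f (s k) - f p) / \<epsilon> + 0"
    proof (rule tendsto_lowerbound)
      show "(\<lambda>n. (f (s k) - f (s n)) / \<epsilon> + d (s n) p) \<longlonglongrightarrow> (f (s k) - f p) / \<epsilon> + 0"
        by (intro tendsto_intros fp p) (use \<epsilon> in auto)
      show "eventually (\<lambda>n. d (s k) p \<le> (f (s k) - f (s n)) / \<epsilon> + d (s n) p) sequentially"
        using eventually_ge_at_top[of k]
      proof eventually_elim
        case (elim n)
        then show ?case using ds[OF elim] d_triangle[of "s k" p "s n"] by linarith
      qed
    qed simp
    then show ?thesis unfolding S_def using \<epsilon> by (simp add: field_simps)
  qed
  show ?thesis
  proof
    fix q
    show "f p - \<epsilon> * d p q \<le> f q"
    proof (rule ccontr)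
      assume neg: "\<not> ?thesis"
      then have "q \<in> S p" unfolding S_def by simp
      then have qS: "q \<in> S (s n)" for n using trans[OF pS] by blast
      \<comment> \<open>As \<open>q\<close> lies in every set \<open>S (s n)\<close>,
        near-minimality bounds \<open>f q\<close> below by \<open>f (s (Suc n))\<close> up to an
        error tending to 0; the limit is \<open>f p \<le> f q\<close>.\<close>
      have "f (s (Suc n)) - inverse (Suc n) \<le> f q" for n
        using s(2)[of n] cInf_lower[OF imageI[OF qS] bdd, of n] by linarith
      moreover have "(\<lambda>n. f (s (Suc n)) - inverse (Suc n)) \<longlonglongrightarrow> f p - 0"
        by (intro tendsto_intros LIMSEQ_Suc[OF fp] LIMSEQ_inverse_real_of_nat)
      ultimately have "f p - 0 \<le> f q" using LIMSEQ_le_const2 by blast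
      then show False using neg \<epsilon> d_nonneg[of p q] by (smt (verit) mult_nonneg_nonneg)
    qed
  qed
qed

text \<open>Only a differentiable \<open>F\<close> touching \<open>f\<close> from above at
  \<open>p\<close> is required, so \<open>f\<close> itself may fail to be differentiable there, as
  the length of the tangential position may at its zeros. Short coordinate segments from
  \<open>p\<close> bound \<open>d p q\<close>, and the difference quotients of \<open>F\<close>
  inherit Ekeland's inequality.\<close>

lemma ekeland_derivative:
  fixes f :: "'a \<Rightarrow> real" and F :: "real^2 \<Rightarrow> real"
  assumes ek: "\<And>q. f p - \<epsilon> * d p q \<le> f q" and \<epsilon>: "\<epsilon> > 0"
    and ch: "(U, \<phi>) \<in> A" "p \<in> U"
    and F: "(F has_derivative F') (at (\<phi> p))" "F (\<phi> p) = f p"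
    and N: "\<And>q. q \<in> U \<Longrightarrow> f q \<le> F (\<phi> q)"
  shows "- (\<epsilon> * norm (frechet_derivative (rep U \<phi>) (at (\<phi> p)) w)) \<le> F' w"
proof -
  define X where "X = rep U \<phi>"
  define u where "u = \<phi> p"
  define L where "L = norm (frechet_derivative X (at u) w)"
  have u: "u \<in> \<phi> ` U" using ch u_def by simp
  note sX = smooth_rep[OF ch(1), folded X_def]
  have lin: "linear (frechet_derivative X (at z))" if "z \<in> \<phi> ` U" for z
    using has_derivative_linear[OF smooth_on_has_derivative[OF sX that]] .
  have "- (\<epsilon> * L) \<le> F' w + e" if "e > 0" for e
  proof -
    define \<eta> where "\<eta> = e / \<epsilon>"
    have \<eta>: "\<eta> > 0" using that \<epsilon> unfolding \<eta>_def by simp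
    have "continuous_on (\<phi> ` U) (\<lambda>z. norm (frechet_derivative X (at z) w))"
      by (intro continuous_intros smooth_on_imp_continuous_on smooth_on_frechet_derivative_const sX)
    then have "isCont (\<lambda>z. norm (frechet_derivative X (at z) w)) u"
      using u open_chart_image[OF ch(1)] continuous_on_eq_continuous_at by blast
    then obtain r1 where r1: "r1 > 0" "\<And>z. dist z u < r1 \<Longrightarrow> \<bar>norm (frechet_derivative X (at z) w) - L\<bar> < \<eta>"
      using \<eta> unfolding continuous_at_eps_delta L_def dist_real_def by metis
    obtain r2 where r2: "r2 > 0" "ball u r2 \<subseteq> \<phi> ` U"
      using u open_chart_image[OF ch(1)] open_contains_ball by blast
    define r where "r = min r1 r2 / (norm w + 1)"
    have r: "r > 0" unfolding r_def using r1 r2 by (simp add: add_nonneg_pos)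
    have near: "dist (u + s *\<^sub>R w) u < min r1 r2" if "0 \<le> s" "s < r" for s
    proof -
      have "s * (norm w + 1) < min r1 r2"
        using that(2) unfolding r_def by (subst (asm) pos_less_divide_eq) (auto simp: add_nonneg_pos)
      moreover have "dist (u + s *\<^sub>R w) u = s * norm w" using that(1) by (simp add: dist_norm)
      moreover have "s * norm w \<le> s * (norm w + 1)" using that(1) by (simp add: algebra_simps)
      ultimately show ?thesis by simp
    qed
    have step: "- \<epsilon> * (L + \<eta>) \<le> (F (u + t *\<^sub>R w) - F u) / t" if t: "0 < t" "t < r" for t
    proof -
      have pt: "u + s *\<^sub>R (t *\<^sub>R w) \<in> \<phi> ` U \<and> norm (frechet_derivative X (at (u + s *\<^sub>R (t *\<^sub>R w))) (t *\<^sub>R w)) \<le> t * (L + \<eta>)"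
        if "s \<in> {0..1}" for s
      proof -
        have "s * t \<le> 1 * t" by (rule mult_right_mono) (use that t in auto)
        then have "s * t < r" using t by linarith
        then have st: "0 \<le> s * t" "s * t < r" using that t by auto
        from near[OF st] have n: "dist (u + s *\<^sub>R (t *\<^sub>R w)) u < min r1 r2" by simp
        then have i: "u + s *\<^sub>R (t *\<^sub>R w) \<in> \<phi> ` U" using r2(2) by (auto simp: dist_commute subset_iff)
        have le: "norm (frechet_derivative X (at (u + s *\<^sub>R (t *\<^sub>R w))) w) \<le> L + \<eta>"
          using r1(2)[of "u + s *\<^sub>R (t *\<^sub>R w)"] n by simp
        have "norm (frechet_derivative X (at (u + s *\<^sub>R (t *\<^sub>R w))) (t *\<^sub>R w))
            = t * norm (frechet_derivative X (at (u + s *\<^sub>R (t *\<^sub>R w))) w)"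
          unfolding linear_cmul[OF lin[OF i]] using t by simp
        also have "\<dots> \<le> t * (L + \<eta>)" by (rule mult_left_mono[OF le]) (use t in simp)
        finally show ?thesis using i by blast
      qed
      define q where "q = inv_into U \<phi> (u + t *\<^sub>R w)"
      have q: "q \<in> U" "\<phi> q = u + t *\<^sub>R w"
        using pt[of 1] unfolding q_def by (auto simp: inv_into_into f_inv_into_f)
      have "d (inv_into U \<phi> u) q \<le> t * (L + \<eta>)"
        unfolding q_def by (rule chart_segment_d_le[OF ch(1)]) (use pt X_def in auto)
      then have dpq: "d p q \<le> t * (L + \<eta>)" unfolding u_def by (simp add: chart_inverse[OF ch])
      have "f p - \<epsilon> * (t * (L + \<eta>)) \<le> f p - \<epsilon> * d p q" using dpq \<epsilon> by simp
      also have "\<dots> \<le> f q" by (rule ek)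
      also have "\<dots> \<le> F (u + t *\<^sub>R w)" using N[OF q(1)] unfolding q(2) .
      finally have "- (\<epsilon> * (L + \<eta>)) * t \<le> F (u + t *\<^sub>R w) - F u"
        using F(2) unfolding u_def by (simp add: algebra_simps)
      then show ?thesis using t(1) by (simp add: pos_le_divide_eq)
    qed
    have "((\<lambda>t. F (u + t *\<^sub>R w)) has_real_derivative F' w) (at 0)"
    proof -
      have 1: "((\<lambda>t. u + t *\<^sub>R w) has_derivative (\<lambda>t. t *\<^sub>R w)) (at 0)"
        by (auto intro!: derivative_eq_intros)
      have 2: "(F has_derivative F') (at (u + 0 *\<^sub>R w))" using F(1) by (simp add: u_def)
      show ?thesis
        using has_derivative_compose[OF 1 2] linear_cmul[OF has_derivative_linear[OF 2]]
        unfolding has_field_derivative_def by (simp add: mult_commute_abs)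
    qed
    then have "(\<lambda>t. (F (u + t *\<^sub>R w) - F u) / t) \<midarrow>0\<rightarrow> F' w"
      unfolding has_field_derivative_iff by simp
    then have lim: "((\<lambda>t. (F (u + t *\<^sub>R w) - F u) / t) \<longlongrightarrow> F' w) (at_right 0)"
      by (rule tendsto_mono[rotated]) (simp add: at_le)
    have "- \<epsilon> * (L + \<eta>) \<le> F' w"
      by (rule tendsto_lowerbound[OF lim]) (use step r in \<open>auto simp: eventually_at_right_field\<close>)
    then show ?thesis unfolding \<eta>_def using \<epsilon> by (simp add: algebra_simps)
  qed
  then show ?thesis unfolding L_def X_def u_def by (rule field_le_epsilon)
qed

end

section \<open>Adapted frames in charts\<close>

text \<open>Gram-Schmidt acts on the coordinate fields, with the inner products of their images.
  Before normalisation the second field always has second coordinate 1, so by injectivity its image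
  cannot vanish.\<close>

lemma gram_schmidt_frame:
  fixes X :: "real^2 \<Rightarrow> complex^2"
  assumes S: "open S" and X: "smooth_on S X" and inj: "\<And>u. u \<in> S \<Longrightarrow> inj (frechet_derivative X (at u))"
  obtains v1 v2 where "smooth_on S v1" "smooth_on S v2"
    "\<And>u. u \<in> S \<Longrightarrow> dir_deriv v1 X u \<bullet> dir_deriv v1 X u = 1"
    "\<And>u. u \<in> S \<Longrightarrow> dir_deriv v2 X u \<bullet> dir_deriv v2 X u = 1"
    "\<And>u. u \<in> S \<Longrightarrow> dir_deriv v1 X u \<bullet> dir_deriv v2 X u = 0"
proof -
  define \<xi> :: "2 \<Rightarrow> real^2 \<Rightarrow> complex^2" where "\<xi> = (\<lambda>i u. frechet_derivative X (at u) (axis i 1))"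
  have lin: "linear (frechet_derivative X (at u))" if "u \<in> S" for u
    using has_derivative_linear[OF smooth_on_has_derivative[OF X that]] .
  have nz: "frechet_derivative X (at u) z \<noteq> 0" if "u \<in> S" "z \<noteq> 0" for u z
    using inj[OF that(1)] linear_0[OF lin[OF that(1)]] that(2) by (metis injD)
  have s\<xi>: "smooth_on S (\<xi> i)" for i unfolding \<xi>_def by (rule smooth_on_frechet_derivative_const[OF X])
  have \<xi>1: "\<xi> 1 u \<bullet> \<xi> 1 u > 0" if "u \<in> S" for u
    using nz[OF that, of "axis 1 1"] unfolding \<xi>_def by (simp add: axis_eq_0_iff)
  define v1 :: "real^2 \<Rightarrow> real^2" where "v1 = (\<lambda>u. inverse (sqrt (\<xi> 1 u \<bullet> \<xi> 1 u)) *\<^sub>R axis 1 1)"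
  have sv1: "smooth_on S v1" unfolding v1_def
    by (intro smooth_on_scaleR smooth_on_inverse_sqrt smooth_on_inner smooth_on_const S s\<xi> \<xi>1)
  define e1 where "e1 = dir_deriv v1 X"
  have se1: "smooth_on S e1" unfolding e1_def by (intro smooth_on_dir_deriv S sv1 X)
  have e1: "e1 u = inverse (sqrt (\<xi> 1 u \<bullet> \<xi> 1 u)) *\<^sub>R \<xi> 1 u" if "u \<in> S" for u
    unfolding e1_def dir_deriv_def v1_def by (simp add: linear_cmul[OF lin[OF that]] \<xi>_def)
  have n1: "e1 u \<bullet> e1 u = 1" if "u \<in> S" for u
    using \<xi>1[OF that] unfolding e1[OF that] by (simp add: real_sqrt_mult_self field_simps)
  define w :: "real^2 \<Rightarrow> real^2" where "w = (\<lambda>u. axis 2 1 - (\<xi> 2 u \<bullet> e1 u) *\<^sub>R v1 u)"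
  have sw: "smooth_on S w" unfolding w_def
    by (intro smooth_on_diff smooth_on_scaleR smooth_on_inner smooth_on_const S s\<xi> se1 sv1)
  define W where "W = dir_deriv w X"
  have sW: "smooth_on S W" unfolding W_def by (intro smooth_on_dir_deriv S sw X)
  have W: "W u = \<xi> 2 u - (\<xi> 2 u \<bullet> e1 u) *\<^sub>R e1 u" if "u \<in> S" for u
    unfolding W_def dir_deriv_def[of w] unfolding w_def
    by (simp add: linear_diff[OF lin[OF that]] linear_cmul[OF lin[OF that]]) (simp add: \<xi>_def e1_def dir_deriv_def)
  have "w u $ 2 = 1" for u unfolding w_def v1_def by (simp add: axis_def)
  then have "w u \<noteq> 0" for u by (metis zero_index zero_neq_one)
  then have WW: "W u \<bullet> W u > 0" if "u \<in> S" for u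
    using nz[OF that, of "w u"] unfolding W_def dir_deriv_def by simp
  have We: "e1 u \<bullet> W u = 0" if "u \<in> S" for u
    unfolding W[OF that] by (simp add: inner_diff_right n1[OF that] inner_commute)
  define v2 :: "real^2 \<Rightarrow> real^2" where "v2 = (\<lambda>u. inverse (sqrt (W u \<bullet> W u)) *\<^sub>R w u)"
  have sv2: "smooth_on S v2" unfolding v2_def
    by (intro smooth_on_scaleR smooth_on_inverse_sqrt smooth_on_inner S sW sw WW)
  have e2: "dir_deriv v2 X u = inverse (sqrt (W u \<bullet> W u)) *\<^sub>R W u" if "u \<in> S" for u
    unfolding dir_deriv_def v2_def by (simp add: linear_cmul[OF lin[OF that]]) (simp add: W_def dir_deriv_def)
  show ?thesis
  proof (rule that[OF sv1 sv2])
    show "dir_deriv v1 X u \<bullet> dir_deriv v1 X u = 1" if "u \<in> S" for u using n1[OF that] unfolding e1_def .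
    show "dir_deriv v2 X u \<bullet> dir_deriv v2 X u = 1" if "u \<in> S" for u
      unfolding e2[OF that] using WW[OF that] by (simp add: real_sqrt_mult_self field_simps)
    show "dir_deriv v1 X u \<bullet> dir_deriv v2 X u = 0" if "u \<in> S" for u
      unfolding e2[OF that] using We[OF that] unfolding e1_def by simp
  qed
qed

lemma inner_normal_part:
  assumes "subspace T" "n \<in> orthogonal_comp T"
  shows "normal_part T w \<bullet> n = w \<bullet> n"
proof -
  have "normal_part T w \<in> orthogonal_comp T \<and> w - normal_part T w \<in> T"
    unfolding normal_part_def by (rule theI'[OF normal_part_unique[OF assms(1)]])
  then have "orthogonal (w - normal_part T w) n" using assms(2) unfolding orthogonal_comp_def by blast
  then show ?thesis by (simp add: orthogonal_def inner_diff_left)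
qed

lemma normal_part_eqI:
  assumes "subspace T" "n \<in> orthogonal_comp T" "w - n \<in> T"
  shows "normal_part T w = n"
  unfolding normal_part_def
  by (rule the1_equality[OF normal_part_unique[OF assms(1)]]) (use assms(2,3) in auto)

context lagrangian_frame begin

lemma subspace_tangent_plane: "u \<in> \<Omega> \<Longrightarrow> subspace (tangent_plane X u)"
  unfolding tangent_plane_def
  by (intro linear_subspace_image has_derivative_linear[OF smooth_on_has_derivative[OF smooth_X]] subspace_UNIV)

lemma e_in_tangent_plane: "e i u \<in> tangent_plane X u"
  unfolding e_def dir_deriv_def tangent_plane_def by simp

lemma normal_space_iff:
  assumes "u \<in> \<Omega>"
  shows "n \<in> orthogonal_comp (tangent_plane X u) \<longleftrightarrow> e 1 u \<bullet> n = 0 \<and> e 2 u \<bullet> n = 0"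
proof
  assume "n \<in> orthogonal_comp (tangent_plane X u)"
  then show "e 1 u \<bullet> n = 0 \<and> e 2 u \<bullet> n = 0"
    using e_in_tangent_plane unfolding orthogonal_comp_def orthogonal_def by blast
next
  assume n: "e 1 u \<bullet> n = 0 \<and> e 2 u \<bullet> n = 0"
  have "w \<bullet> n = 0" if "w \<in> tangent_plane X u" for w
    using that n unfolding tangent_plane_eq_span[OF assms] by (auto simp: inner_add_left)
  then show "n \<in> orthogonal_comp (tangent_plane X u)" unfolding orthogonal_comp_def orthogonal_def by blast
qed

lemma J_e_normal: "u \<in> \<Omega> \<Longrightarrow> J (e i u) \<in> orthogonal_comp (tangent_plane X u)"
  by (simp add: normal_space_iff e_inner_J)

lemma position_decomp:
  assumes "u \<in> \<Omega>"
  shows "X u = y 1 u *\<^sub>R e 1 u + y 2 u *\<^sub>R e 2 u + (nu 1 u *\<^sub>R J (e 1 u) + nu 2 u *\<^sub>R J (e 2 u))"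
proof (rule euclidean_eqI)
  fix b :: "complex^2"
  show "X u \<bullet> b = (y 1 u *\<^sub>R e 1 u + y 2 u *\<^sub>R e 2 u + (nu 1 u *\<^sub>R J (e 1 u) + nu 2 u *\<^sub>R J (e 2 u))) \<bullet> b"
    by (subst parseval[OF assms]) (simp add: sum_2 y_def nu_def inner_add_left inner_commute[of b])
qed

lemma norm_tangential_position:
  assumes "u \<in> \<Omega>"
  shows "norm (X u - normal_part (tangent_plane X u) (X u)) = sqrt ((y 1 u)\<^sup>2 + (y 2 u)\<^sup>2)"
proof -
  have "normal_part (tangent_plane X u) (X u) = nu 1 u *\<^sub>R J (e 1 u) + nu 2 u *\<^sub>R J (e 2 u)"
  proof (rule normal_part_eqI[OF subspace_tangent_plane[OF assms]])
    show "nu 1 u *\<^sub>R J (e 1 u) + nu 2 u *\<^sub>R J (e 2 u) \<in> orthogonal_comp (tangent_plane X u)"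
      by (intro subspace_add subspace_scale subspace_orthogonal_comp J_e_normal assms)
    show "X u - (nu 1 u *\<^sub>R J (e 1 u) + nu 2 u *\<^sub>R J (e 2 u)) \<in> tangent_plane X u"
      unfolding tangent_plane_eq_span[OF assms] using position_decomp[OF assms] by (metis add_diff_cancel_right')
  qed
  then have eq: "X u - normal_part (tangent_plane X u) (X u) = y 1 u *\<^sub>R e 1 u + y 2 u *\<^sub>R e 2 u"
    using position_decomp[OF assms] by (metis add_diff_cancel_right')
  show ?thesis unfolding eq norm_eq_sqrt_inner
    by (simp add: inner_add_left inner_add_right e_inner_e[OF assms] power2_eq_square)
qed

lemma norm_position:
  assumes "u \<in> \<Omega>"
  shows "(norm (X u))\<^sup>2 = (y 1 u)\<^sup>2 + (y 2 u)\<^sup>2 + (nu 1 u)\<^sup>2 + (nu 2 u)\<^sup>2"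
  unfolding power2_norm_eq_inner by (subst parseval[OF assms]) (simp add: sum_2 y_def nu_def power2_eq_square)

end

section \<open>From the definitions on the surface to frames\<close>

locale expander_surface = complete_surface +
  fixes S :: real
  assumes lagr: "lagrangian A x" and expd: "self_expander A x"
    and norm_const: "\<And>U \<phi> u v. (U, \<phi>) \<in> A \<Longrightarrow> u \<in> \<phi> ` U \<Longrightarrow>
      orthonormal_frame (rep U \<phi>) u v \<Longrightarrow> squared_norm_h (rep U \<phi>) u v = S"
begin

text \<open>The definitions quantify over frames at a single point, so they apply to the values of
  the frame fields; \<open>D_frechet\<close> identifies the coefficients of the second fundamental
  form, and inner products with normal vectors do not see the projection in
  \<open>normal_part\<close>.\<close>

lemma expander_frameI:
  assumes ch: "(U, \<phi>) \<in> A" and v: "\<And>i. smooth_on (\<phi> ` U) (v i)"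
    and on: "\<And>u i j. u \<in> \<phi> ` U \<Longrightarrow>
      dir_deriv (v i) (rep U \<phi>) u \<bullet> dir_deriv (v j) (rep U \<phi>) u = (if i = j then 1 else 0)"
  shows "expander_frame (\<phi> ` U) (rep U \<phi>) v S"
proof -
  define X where "X = rep U \<phi>"
  define \<Omega> where "\<Omega> = \<phi> ` U"
  have LT: "J ` tangent_plane X u = orthogonal_comp (tangent_plane X u)" if "u \<in> \<Omega>" for u
    using lagr ch that unfolding lagrangian_def X_def \<Omega>_def by blast
  interpret F: lagrangian_frame \<Omega> X v
  proof
    show "dir_deriv (v i) X u \<bullet> J (dir_deriv (v j) X u) = 0" if u: "u \<in> \<Omega>" for u i j
    proof -
      have "dir_deriv (v j) X u \<in> tangent_plane X u" unfolding dir_deriv_def tangent_plane_def by simp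
      then have "J (dir_deriv (v j) X u) \<in> orthogonal_comp (tangent_plane X u)"
        using LT[OF u] by blast
      then show ?thesis unfolding orthogonal_comp_def orthogonal_def tangent_plane_def
        by (simp add: dir_deriv_def)
    qed
  qed (use ch v on open_chart_image smooth_rep in \<open>auto simp: X_def \<Omega>_def\<close>)
  show ?thesis unfolding X_def[symmetric] \<Omega>_def[symmetric]
  proof
    fix u assume u: "u \<in> \<Omega>"
    define V where "V = (\<lambda>i. v i u)"
    have onf: "orthonormal_frame X u V"
      using F.orthonormal[OF u] unfolding orthonormal_frame_def V_def dir_deriv_def by blast
    have nf: "normal_frame X u V p = J (F.e p u)" for p
      unfolding normal_frame_def V_def F.e_def dir_deriv_def by simp
    have hc: "h_coeff X u V p i j = F.h i j p u" for p i j
      unfolding h_coeff_def nf second_fund_form_def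
        inner_normal_part[OF F.subspace_tangent_plane[OF u] F.J_e_normal[OF u]]
      unfolding F.D_frechet[OF u] V_def ..
    have "u \<in> \<phi> ` U" using u unfolding \<Omega>_def .
    then have mc: "mean_curvature_vector X u V = normal_part (tangent_plane X u) (X u)"
      using expd ch onf unfolding self_expander_def X_def by blast
    show "F.nu p u = F.h 1 1 p u + F.h 2 2 p u" for p
    proof -
      have "F.nu p u = normal_part (tangent_plane X u) (X u) \<bullet> J (F.e p u)"
        unfolding F.nu_def inner_normal_part[OF F.subspace_tangent_plane[OF u] F.J_e_normal[OF u]] ..
      also have "\<dots> = F.h 1 1 p u + F.h 2 2 p u"
        unfolding mc[symmetric] mean_curvature_vector_def hc nf using exhaust_2[of p]
        by (auto simp: sum_2 inner_add_left F.e_inner_e[OF u])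
      finally show ?thesis .
    qed
    show "(\<Sum>i\<in>UNIV. \<Sum>j\<in>UNIV. \<Sum>p\<in>UNIV. (F.h i j p u)\<^sup>2) = S"
      using norm_const[OF ch \<open>u \<in> \<phi> ` U\<close> onf[unfolded X_def]]
      unfolding squared_norm_h_def X_def[symmetric] hc .
  qed
qed

text \<open>The Gram-Schmidt frame is rotated by a constant angle chosen at \<open>u0\<close>.
  Normalising the tangential position field instead would break down at its zeros.\<close>

lemma adapted_frame:
  assumes ch: "(U, \<phi>) \<in> A" and u0: "u0 \<in> \<phi> ` U"
  obtains v where "expander_frame (\<phi> ` U) (rep U \<phi>) v S"
    "lagrangian_frame.y (rep U \<phi>) v 2 u0 = 0"
    "lagrangian_frame.y (rep U \<phi>) v 1 u0 \<ge> 0"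
proof -
  define X where "X = rep U \<phi>"
  define \<Omega> where "\<Omega> = \<phi> ` U"
  note sX = smooth_rep[OF ch, folded X_def \<Omega>_def] and op = open_chart_image[OF ch, folded \<Omega>_def]
  obtain v1 v2 where v: "smooth_on \<Omega> v1" "smooth_on \<Omega> v2"
    "\<And>u. u \<in> \<Omega> \<Longrightarrow> dir_deriv v1 X u \<bullet> dir_deriv v1 X u = 1"
    "\<And>u. u \<in> \<Omega> \<Longrightarrow> dir_deriv v2 X u \<bullet> dir_deriv v2 X u = 1"
    "\<And>u. u \<in> \<Omega> \<Longrightarrow> dir_deriv v1 X u \<bullet> dir_deriv v2 X u = 0"
    using gram_schmidt_frame[OF op sX] inj_rep[OF ch] unfolding X_def \<Omega>_def by blast
  define a b where "a = X u0 \<bullet> dir_deriv v1 X u0" and "b = X u0 \<bullet> dir_deriv v2 X u0"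
  define t where "t = sqrt (a\<^sup>2 + b\<^sup>2)"
  define p q where "p = (if t = 0 then 1 else a / t)" and "q = (if t = 0 then 0 else b / t)"
  have t: "t \<ge> 0" "t * t = a * a + b * b" unfolding t_def by (simp_all add: power2_eq_square)
  have pq: "p * p + q * q = 1" using t(2) unfolding p_def q_def by (auto simp: add_divide_distrib[symmetric])
  have rot: "- q * a + p * b = 0" "p * a + q * b \<ge> 0"
  proof -
    have "a = 0 \<and> b = 0" if "t = 0" using t(2) that by (simp add: sum_squares_eq_zero_iff)
    moreover have "p * a + q * b = t" if "t \<noteq> 0"
      using that t(2) unfolding p_def q_def by (simp add: field_simps)
    ultimately show "- q * a + p * b = 0" "p * a + q * b \<ge> 0"
      using t(1) unfolding p_def q_def by (auto simp: field_simps)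
  qed
  define w :: "2 \<Rightarrow> real^2 \<Rightarrow> real^2" where
    "w = (\<lambda>i u. if i = 1 then p *\<^sub>R v1 u + q *\<^sub>R v2 u else (- q) *\<^sub>R v1 u + p *\<^sub>R v2 u)"
  have sw: "smooth_on \<Omega> (w i)" for i
    unfolding w_def by (cases "i = 1") (auto intro!: smooth_on_add smooth_on_scaleR smooth_on_const op v(1,2))
  have lin: "linear (frechet_derivative X (at u))" if "u \<in> \<Omega>" for u
    using has_derivative_linear[OF smooth_on_has_derivative[OF sX that]] .
  have dw: "dir_deriv (w 1) X u = p *\<^sub>R dir_deriv v1 X u + q *\<^sub>R dir_deriv v2 X u"
    "dir_deriv (w 2) X u = (- q) *\<^sub>R dir_deriv v1 X u + p *\<^sub>R dir_deriv v2 X u" if "u \<in> \<Omega>" for u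
    unfolding w_def dir_deriv_def by (simp_all add: linear_add[OF lin[OF that]] linear_cmul[OF lin[OF that]] linear_diff[OF lin[OF that]] linear_neg[OF lin[OF that]])
  have on: "dir_deriv (w i) X u \<bullet> dir_deriv (w j) X u = (if i = j then 1 else 0)" if u: "u \<in> \<Omega>" for u i j
    using exhaust_2[of i] exhaust_2[of j] pq
    by (auto simp: dw[OF u] inner_add_left inner_add_right inner_diff_left inner_diff_right v(3-5)[OF u] inner_commute[of "dir_deriv v2 X u" "dir_deriv v1 X u"]
        algebra_simps)
  have ef: "expander_frame \<Omega> X w S"
    unfolding X_def \<Omega>_def by (rule expander_frameI[OF ch]) (use sw on in \<open>auto simp: X_def \<Omega>_def\<close>)
  interpret F: expander_frame \<Omega> X w S by (rule ef)
  have u0': "u0 \<in> \<Omega>" using u0 unfolding \<Omega>_def .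
  have "F.y 2 u0 = 0" "F.y 1 u0 \<ge> 0"
    unfolding F.y_def F.e_def dw[OF u0'] using rot unfolding a_def b_def by (simp_all add: inner_add_right inner_diff_right)
  with ef show ?thesis using that unfolding X_def \<Omega>_def by blast
qed

end

section \<open>The classification\<close>

context immersed_surface begin

text \<open>By the chain rule all charts around \<open>q\<close> give the same plane, so the union
  over them defines it without a choice of chart.\<close>

definition tangent_space :: "'m \<Rightarrow> (complex^2) set" where
  "tangent_space q = (\<Union>(U, \<phi>)\<in>{(U, \<phi>) \<in> A. q \<in> U}. tangent_plane (rep U \<phi>) (\<phi> q))"

lemma tangent_plane_transition:
  assumes U: "(U, \<phi>) \<in> A" "q \<in> U" and V: "(V, \<psi>) \<in> A" "q \<in> V"
  shows "tangent_plane (rep V \<psi>) (\<psi> q) \<subseteq> tangent_plane (rep U \<phi>) (\<phi> q)"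
proof -
  define \<tau> where "\<tau> = \<phi> \<circ> inv_into V \<psi>"
  have q: "\<psi> q \<in> \<psi> ` (V \<inter> U)" "\<phi> q \<in> \<phi> ` U" using U V by auto
  have \<tau>q: "\<tau> (\<psi> q) = \<phi> q" unfolding \<tau>_def using chart_inverse[OF V] by simp
  have d\<tau>: "(\<tau> has_derivative frechet_derivative \<tau> (at (\<psi> q))) (at (\<psi> q))"
    unfolding \<tau>_def by (rule smooth_on_has_derivative[OF smooth_transition[OF V(1) U(1)] q(1)])
  have dU: "(rep U \<phi> has_derivative frechet_derivative (rep U \<phi>) (at (\<phi> q))) (at (\<tau> (\<psi> q)))"
    unfolding \<tau>q by (rule smooth_on_has_derivative[OF smooth_rep[OF U(1)] q(2)])
  have eq: "rep U \<phi> (\<tau> z) = rep V \<psi> z" if zVU: "z \<in> \<psi> ` (V \<inter> U)" for z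
  proof -
    obtain r where r: "r \<in> V" "r \<in> U" "z = \<psi> r" using zVU by blast
    show ?thesis unfolding r(3) \<tau>_def
      using chart_inverse[OF V(1) r(1)] local_rep_chart[OF U(1) r(2), of x] local_rep_chart[OF V(1) r(1), of x] by simp
  qed
  have "(rep V \<psi> has_derivative
      (\<lambda>w. frechet_derivative (rep U \<phi>) (at (\<phi> q)) (frechet_derivative \<tau> (at (\<psi> q)) w))) (at (\<psi> q))"
    by (rule has_derivative_transform_within_open[OF has_derivative_compose[OF d\<tau> dU] open_image_Int[OF V(1) open_chart[OF U(1)]] q(1) eq])
  then have "frechet_derivative (rep V \<psi>) (at (\<psi> q))
      = (\<lambda>w. frechet_derivative (rep U \<phi>) (at (\<phi> q)) (frechet_derivative \<tau> (at (\<psi> q)) w))"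
    using frechet_derivative_at by metis
  then show ?thesis unfolding tangent_plane_def by auto
qed

lemma tangent_space_eq:
  assumes "(U, \<phi>) \<in> A" "q \<in> U"
  shows "tangent_space q = tangent_plane (rep U \<phi>) (\<phi> q)"
  unfolding tangent_space_def using tangent_plane_transition[OF assms] assms by fastforce

definition tangential_norm :: "'m \<Rightarrow> real" where
  "tangential_norm q = norm (x q - normal_part (tangent_space q) (x q))"

lemma continuous_on_UNIV_charts:
  fixes f :: "'m \<Rightarrow> 'b::topological_space"
  assumes "\<And>U \<phi>. (U, \<phi>) \<in> A \<Longrightarrow> continuous_on (\<phi> ` U) (local_rep (U, \<phi>) f)"
  shows "continuous_on UNIV f"
proof -
  have "isCont f q" for q
  proof -
    obtain U \<phi> where ch: "(U, \<phi>) \<in> A" "q \<in> U" using chart_at by blast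
    have "continuous_on U (\<lambda>p. local_rep (U, \<phi>) f (\<phi> p))"
      by (rule continuous_on_compose2[OF assms[OF ch(1)] homeomorphism_cont1[OF chart_homeo[OF ch(1)]]]) simp
    then have "continuous_on U f" by (rule continuous_on_eq) (rule local_rep_chart[OF ch(1)])
    then show ?thesis using ch(2) open_chart[OF ch(1)] continuous_on_eq_continuous_at by blast
  qed
  then show ?thesis by (simp add: continuous_at_imp_continuous_on)
qed

end

section \<open>Vanishing of S, and the flat case\<close>

context expander_surface begin

lemma tangential_norm_frame:
  assumes ch: "(U, \<phi>) \<in> A" and ef: "expander_frame (\<phi> ` U) (rep U \<phi>) v S" and q: "q \<in> U"
  shows "tangential_norm q = sqrt ((lagrangian_frame.y (rep U \<phi>) v 1 (\<phi> q))\<^sup>2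
      + (lagrangian_frame.y (rep U \<phi>) v 2 (\<phi> q))\<^sup>2)"
proof -
  interpret F: expander_frame "\<phi> ` U" "rep U \<phi>" v S by (rule ef)
  show ?thesis
    unfolding tangential_norm_def tangent_space_eq[OF ch q]
    using F.norm_tangential_position[of "\<phi> q"] q by (simp add: local_rep_chart[OF ch q])
qed

lemma continuous_tangential_norm: "continuous_on UNIV tangential_norm"
proof (rule continuous_on_UNIV_charts)
  fix U \<phi> assume ch: "(U, \<phi>) \<in> A"
  show "continuous_on (\<phi> ` U) (local_rep (U, \<phi>) tangential_norm)"
  proof (cases "U = {}")
    case False
    then obtain u0 where "u0 \<in> \<phi> ` U" by blast
    then obtain v where ef: "expander_frame (\<phi> ` U) (rep U \<phi>) v S" using adapted_frame[OF ch] by blast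
    interpret F: expander_frame "\<phi> ` U" "rep U \<phi>" v S by (rule ef)
    have "continuous_on (\<phi> ` U) (\<lambda>u. sqrt ((F.y 1 u)\<^sup>2 + (F.y 2 u)\<^sup>2))"
      by (intro continuous_intros smooth_on_imp_continuous_on F.smooth_y)
    then show ?thesis
      by (rule continuous_on_eq) (auto simp: local_rep_chart[OF ch] tangential_norm_frame[OF ch ef])
  qed simp
qed

lemma continuous_position: "continuous_on UNIV x"
  by (intro continuous_on_UNIV_charts smooth_on_imp_continuous_on smooth_rep)

lemma S_nonneg: "0 \<le> S"
proof -
  obtain U \<phi> where ch: "(U, \<phi>) \<in> A" "undefined \<in> U" using chart_at by blast
  then have u: "\<phi> undefined \<in> \<phi> ` U" by blast
  obtain v where ef: "expander_frame (\<phi> ` U) (rep U \<phi>) v S" using adapted_frame[OF ch(1) u] by blast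
  interpret F: expander_frame "\<phi> ` U" "rep U \<phi>" v S by (rule ef)
  show ?thesis unfolding F.const_norm[OF u, symmetric] by (intro sum_nonneg) simp
qed

lemma S_not_positive: "\<not> 0 < S"
proof
  assume S: "0 < S"
  obtain T where T: "\<And>t a b c d A B C D E A1 B1 C1 D1 E1. expander_jet1 S t a b c d A B C D E \<Longrightarrow>
      expander_jet2 t a b c d A B C D E A1 B1 C1 D1 E1 \<Longrightarrow> t \<le> T"
    using tangential_position_bound[OF S] by (elim exE) blast
  obtain \<sigma> where \<sigma>: "\<sigma> > 0" "\<And>t a b c d A B C D E. 0 \<le> t \<Longrightarrow> expander_jet1 S t a b c d A B C D E \<Longrightarrow>
      2 * t + \<sigma> * (1 + a * (a + c) + b * (b + d)) > \<sigma> / 4"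
    using tangential_direction_gain[OF S] by (elim exE conjE) blast
  \<comment> \<open>The sign is reversed because Ekeland's principle is stated for functions bounded
    below.\<close>
  define f where "f = (\<lambda>q. - ((norm (x q))\<^sup>2 + \<sigma> * tangential_norm q))"
  have bounds: "tangential_norm q \<le> T \<and> (norm (x q))\<^sup>2 \<le> T\<^sup>2 + 2 * S" for q
  proof -
    obtain U \<phi> where ch: "(U, \<phi>) \<in> A" "q \<in> U" using chart_at by blast
    then have u: "\<phi> q \<in> \<phi> ` U" by blast
    obtain v where ef: "expander_frame (\<phi> ` U) (rep U \<phi>) v S"
      and y: "lagrangian_frame.y (rep U \<phi>) v 2 (\<phi> q) = 0" "lagrangian_frame.y (rep U \<phi>) v 1 (\<phi> q) \<ge> 0"
      using adapted_frame[OF ch(1) u] by blast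
    interpret F: expander_frame "\<phi> ` U" "rep U \<phi>" v S by (rule ef)
    have yT: "F.y 1 (\<phi> q) \<le> T" by (rule T[OF F.expander_jets[OF u y(1)]])
    have tn: "tangential_norm q = F.y 1 (\<phi> q)"
      unfolding tangential_norm_frame[OF ch(1) ef ch(2)] y(1) using y(2) by simp
    \<comment> \<open>The normal part of the position is \<open>H\<close>, which the constant
      \<open>S\<close> controls; a bound on the tangential part therefore bounds the whole
      position.\<close>
    have nu: "(F.nu 1 (\<phi> q))\<^sup>2 + (F.nu 2 (\<phi> q))\<^sup>2 \<le> 2 * S"
    proof -
      have sq: "(p + r)\<^sup>2 \<le> 2 * p\<^sup>2 + 2 * r\<^sup>2" for p r :: real
        using zero_le_power2[of "p - r"] by (simp add: power2_diff power2_sum)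
      show ?thesis
        using sq[of "F.a (\<phi> q)" "F.c (\<phi> q)"] sq[of "F.b (\<phi> q)" "F.d (\<phi> q)"] F.norm_eq[OF u]
          zero_le_power2[of "F.b (\<phi> q)"] zero_le_power2[of "F.c (\<phi> q)"]
        unfolding F.nu_eq[OF u] by linarith
    qed
    have "(F.y 1 (\<phi> q))\<^sup>2 \<le> T\<^sup>2" using yT y(2) by (rule power_mono)
    then have "(norm (rep U \<phi> (\<phi> q)))\<^sup>2 \<le> T\<^sup>2 + 2 * S"
      unfolding F.norm_position[OF u] y(1) using nu by simp
    then show ?thesis using tn yT local_rep_chart[OF ch, of x] by simp
  qed
  have low: "- (T\<^sup>2 + 2 * S + \<sigma> * T) \<le> f q" for q
    using bounds[of q] mult_left_mono[of "tangential_norm q" T \<sigma>] \<sigma>(1) unfolding f_def by linarith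
  have cont: "continuous_on UNIV f"
    unfolding f_def by (intro continuous_intros continuous_position continuous_tangential_norm)
  \<comment> \<open>The slope equals the threshold in \<open>tangential_direction_gain\<close>,
    whose strict inequality will contradict it.\<close>
  have \<epsilon>: "0 < \<sigma> / 4" using \<sigma>(1) by simp
  obtain p where p: "\<And>q. f p - \<sigma> / 4 * d p q \<le> f q" using ekeland[OF cont low \<epsilon>] by blast
  obtain U \<phi> where ch: "(U, \<phi>) \<in> A" "p \<in> U" using chart_at by blast
  then have u: "\<phi> p \<in> \<phi> ` U" by blast
  define X where "X = rep U \<phi>"
  obtain v where ef: "expander_frame (\<phi> ` U) X v S"
    and y: "lagrangian_frame.y X v 2 (\<phi> p) = 0" "lagrangian_frame.y X v 1 (\<phi> p) \<ge> 0"
    using adapted_frame[OF ch(1) u] unfolding X_def by blast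
  interpret F: expander_frame "\<phi> ` U" X v S by (rule ef)
  \<comment> \<open>\<open>F.y 1\<close> is at most the length of the tangential position, with
    equality at \<open>p\<close>. Hence \<open>G\<close> is smooth and touches \<open>f\<close> from
    above, even if the tangential position vanishes at \<open>p\<close>.\<close>
  define G where "G = (\<lambda>u. - (X u \<bullet> X u + \<sigma> * F.y 1 u))"
  have sG: "smooth_on (\<phi> ` U) G"
    unfolding G_def by (intro smooth_on_minus smooth_on_add smooth_on_inner smooth_on_mult smooth_on_const F.open_dom F.smooth_X F.smooth_y)
  have Xq: "X (\<phi> q) = x q" if "q \<in> U" for q unfolding X_def by (rule local_rep_chart[OF ch(1) that])
  have tn: "tangential_norm q = sqrt ((F.y 1 (\<phi> q))\<^sup>2 + (F.y 2 (\<phi> q))\<^sup>2)" if "q \<in> U" for q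
    using tangential_norm_frame[OF ch(1) ef[unfolded X_def] that] unfolding X_def .
  have Gp: "G (\<phi> p) = f p"
    unfolding G_def f_def tn[OF ch(2)] Xq[OF ch(2)] y(1) using y(2) by (simp add: power2_norm_eq_inner)
  have Gle: "f q \<le> G (\<phi> q)" if "q \<in> U" for q
  proof -
    have "F.y 1 (\<phi> q) \<le> tangential_norm q" unfolding tn[OF that] by (rule real_le_rsqrt) simp
    then show ?thesis unfolding G_def f_def Xq[OF that] using \<sigma>(1) by (simp add: power2_norm_eq_inner)
  qed
  have lower: "- (\<sigma> / 4 * norm (frechet_derivative X (at (\<phi> p)) (v 1 (\<phi> p)))) \<le> frechet_derivative G (at (\<phi> p)) (v 1 (\<phi> p))"
    using ekeland_derivative[OF p \<epsilon> ch smooth_on_has_derivative[OF sG u] Gp Gle] unfolding X_def .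
  have unit: "norm (frechet_derivative X (at (\<phi> p)) (v 1 (\<phi> p))) = 1"
    using F.orthonormal[OF u, of 1 1] by (simp add: dir_deriv_def norm_eq_sqrt_inner)
  have deriv: "frechet_derivative G (at (\<phi> p)) (v 1 (\<phi> p)) = - (2 * F.y 1 (\<phi> p) + \<sigma> * F.m11 (\<phi> p))"
  proof -
    have s: "smooth_on (\<phi> ` U) (\<lambda>u. X u \<bullet> X u)" "smooth_on (\<phi> ` U) (\<lambda>u. \<sigma> * F.y 1 u)"
      by (intro smooth_on_inner smooth_on_mult smooth_on_const F.open_dom F.smooth_X F.smooth_y)+
    have "F.D 1 G (\<phi> p) = - (F.D 1 (\<lambda>u. X u \<bullet> X u) (\<phi> p) + F.D 1 (\<lambda>u. \<sigma> * F.y 1 u) (\<phi> p))"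
      unfolding G_def dir_deriv_minus[OF smooth_on_add[OF F.open_dom s] u] dir_deriv_add[OF s u] ..
    also have "F.D 1 (\<lambda>u. X u \<bullet> X u) (\<phi> p) = 2 * F.y 1 (\<phi> p)"
      unfolding F.D_inner[OF F.smooth_X F.smooth_X u] by (simp add: F.y_def F.e_def inner_commute)
    also have "F.D 1 (\<lambda>u. \<sigma> * F.y 1 u) (\<phi> p) = \<sigma> * F.m11 (\<phi> p)"
      unfolding dir_deriv_mult[OF smooth_on_const[OF F.open_dom] F.smooth_y u] dir_deriv_const F.D_y'(1)[OF u] y(1)
      by (simp add: F.m11_def)
    finally show ?thesis unfolding dir_deriv_def .
  qed
  have "2 * F.y 1 (\<phi> p) + \<sigma> * F.m11 (\<phi> p) > \<sigma> / 4"
    using \<sigma>(2)[OF y(2) F.expander_jets(1)[OF u y(1)]] unfolding F.m11_def .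
  then show False using lower unfolding unit deriv by linarith
qed

lemma S_eq_0: "S = 0"
  using S_nonneg S_not_positive by linarith

lemma flat_frame:
  assumes ch: "(U, \<phi>) \<in> A" and ef: "expander_frame (\<phi> ` U) (rep U \<phi>) v S" and u: "u \<in> \<phi> ` U"
  shows "lagrangian_frame.h (rep U \<phi>) v i j k u = 0"
proof -
  interpret F: expander_frame "\<phi> ` U" "rep U \<phi>" v S by (rule ef)
  have "(\<Sum>i\<in>UNIV. \<Sum>j\<in>UNIV. \<Sum>p\<in>UNIV. (F.h i j p u)\<^sup>2) = 0" using F.const_norm[OF u] S_eq_0 by simp
  then show ?thesis by (simp add: sum_nonneg_eq_0_iff sum_nonneg)
qed

lemma position_in_tangent_space: "x q \<in> tangent_space q"
proof -
  obtain U \<phi> where ch: "(U, \<phi>) \<in> A" "q \<in> U" using chart_at by blast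
  then have u: "\<phi> q \<in> \<phi> ` U" by blast
  obtain v where ef: "expander_frame (\<phi> ` U) (rep U \<phi>) v S" using adapted_frame[OF ch(1) u] by blast
  interpret F: expander_frame "\<phi> ` U" "rep U \<phi>" v S by (rule ef)
  have "F.nu p (\<phi> q) = 0" for p unfolding F.expander[OF u] flat_frame[OF ch(1) ef u] by simp
  then have "rep U \<phi> (\<phi> q) = F.y 1 (\<phi> q) *\<^sub>R F.e 1 (\<phi> q) + F.y 2 (\<phi> q) *\<^sub>R F.e 2 (\<phi> q)"
    using F.position_decomp[OF u] by simp
  then show ?thesis
    unfolding tangent_space_eq[OF ch] F.tangent_plane_eq_span[OF u] local_rep_chart[OF ch] by blast
qed

text \<open>For a fixed vector \<open>n\<close>, the squared norm of its projection to the tangent plane has zero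
  derivative when the second fundamental form vanishes, so the normal space is locally constant.\<close>

lemma tangent_space_locally_constant:
  obtains T where "open T" "p \<in> T" "\<And>q. q \<in> T \<Longrightarrow> tangent_space q = tangent_space p"
proof -
  obtain U \<phi> where ch: "(U, \<phi>) \<in> A" "p \<in> U" using chart_at by blast
  then have u0: "\<phi> p \<in> \<phi> ` U" by blast
  define X where "X = rep U \<phi>"
  obtain v where ef: "expander_frame (\<phi> ` U) X v S" using adapted_frame[OF ch(1) u0] unfolding X_def by blast
  interpret F: expander_frame "\<phi> ` U" X v S by (rule ef)
  have h0: "F.h i j k u = 0" if "u \<in> \<phi> ` U" for i j k u
    using flat_frame[OF ch(1) ef[unfolded X_def] that] unfolding X_def .
  obtain r where r: "r > 0" "ball (\<phi> p) r \<subseteq> \<phi> ` U"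
    using F.open_dom u0 open_contains_ball by blast
  define g where "g = (\<lambda>n u. (F.e 1 u \<bullet> n)\<^sup>2 + (F.e 2 u \<bullet> n)\<^sup>2)"
  have s1: "smooth_on (\<phi> ` U) (\<lambda>u. F.e i u \<bullet> n)" for i n
    by (intro smooth_on_inner smooth_on_const F.open_dom F.smooth_e)
  have sg: "smooth_on (\<phi> ` U) (g n)" for n unfolding g_def by (intro smooth_on_add smooth_on_power2 s1 F.open_dom)
  have Dg: "F.D i (g n) u = 0" if u: "u \<in> \<phi> ` U" for i n u
  proof -
    have de: "F.D i (\<lambda>u. F.e k u \<bullet> n) u = F.\<omega> i k 1 u * (F.e 1 u \<bullet> n) + F.\<omega> i k 2 u * (F.e 2 u \<bullet> n)" for k
    proof -
      have "F.D i (\<lambda>u. F.e k u \<bullet> n) u = F.D i (F.e k) u \<bullet> n"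
        unfolding F.D_inner[OF F.smooth_e smooth_on_const[OF F.open_dom] u] dir_deriv_const by simp
      also have "\<dots> = F.\<omega> i k 1 u * (F.e 1 u \<bullet> n) + F.\<omega> i k 2 u * (F.e 2 u \<bullet> n)"
        by (subst F.parseval[OF u])
          (simp add: sum_2 F.\<omega>_def[symmetric] F.h_def[symmetric] h0[OF u] inner_commute[of n])
      finally show ?thesis .
    qed
    have "F.D i (g n) u = 2 * (F.e 1 u \<bullet> n) * F.D i (\<lambda>u. F.e 1 u \<bullet> n) u + 2 * (F.e 2 u \<bullet> n) * F.D i (\<lambda>u. F.e 2 u \<bullet> n) u"
      unfolding g_def dir_deriv_add[OF smooth_on_power2[OF F.open_dom s1] smooth_on_power2[OF F.open_dom s1] u]
        dir_deriv_power2[OF s1 u] ..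
    then show ?thesis unfolding de using F.\<omega>_normal[OF u, of i] by simp
  qed
  have g_const: "g n u = g n (\<phi> p)" if "u \<in> ball (\<phi> p) r" for n u
  proof (rule has_derivative_zero_unique[OF convex_ball _ that])
    fix z assume "z \<in> ball (\<phi> p) r"
    then have z: "z \<in> \<phi> ` U" using r(2) by blast
    have hd: "(g n has_derivative frechet_derivative (g n) (at z)) (at z)" by (rule smooth_on_has_derivative[OF sg z])
    have "frechet_derivative (g n) (at z) w = 0" for w
    proof -
      obtain a b where "w = a *\<^sub>R v 1 z + b *\<^sub>R v 2 z" using F.frame_independent[OF z] by blast
      then show ?thesis
        using Dg[OF z, of 1 n] Dg[OF z, of 2 n] unfolding dir_deriv_def
        by (simp add: linear_add[OF has_derivative_linear[OF hd]] linear_cmul[OF has_derivative_linear[OF hd]])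
    qed
    then have "frechet_derivative (g n) (at z) = (\<lambda>w. 0)" by blast
    with has_derivative_at_withinI[OF hd, of "ball (\<phi> p) r"]
    show "(g n has_derivative (\<lambda>w. 0)) (at z within ball (\<phi> p) r)" by simp
  qed (use r in auto)
  have normal: "n \<in> orthogonal_comp (tangent_plane X u) \<longleftrightarrow> g n u = 0" if "u \<in> \<phi> ` U" for n u
    unfolding F.normal_space_iff[OF that] g_def by (simp add: sum_power2_eq_zero_iff)
  have eq: "tangent_plane X u = tangent_plane X (\<phi> p)" if "u \<in> ball (\<phi> p) r" for u
  proof -
    have u: "u \<in> \<phi> ` U" using that r(2) by blast
    have oc: "orthogonal_comp (tangent_plane X u) = orthogonal_comp (tangent_plane X (\<phi> p))"
      using normal[OF u] normal[OF u0] g_const[OF that] by (intro set_eqI) simp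
    show ?thesis
      using orthogonal_comp_self[OF F.subspace_tangent_plane[OF u]]
      unfolding oc orthogonal_comp_self[OF F.subspace_tangent_plane[OF u0]] by (rule sym)
  qed
  show ?thesis
  proof
    show "open (U \<inter> \<phi> -` ball (\<phi> p) r)"
      using homeomorphism_cont1[OF chart_homeo[OF ch(1)]] open_chart[OF ch(1)]
      by (simp add: continuous_open_preimage)
    show "p \<in> U \<inter> \<phi> -` ball (\<phi> p) r" using ch r by simp
    show "tangent_space q = tangent_space p" if "q \<in> U \<inter> \<phi> -` ball (\<phi> p) r" for q
      using that eq[of "\<phi> q"] tangent_space_eq[OF ch] tangent_space_eq[OF ch(1), of q] unfolding X_def by simp
  qed
qed

lemma tangent_space_constant: "tangent_space q = tangent_space p"
proof (rule connected_equivalence_relation[OF conn, where R = "\<lambda>q p. tangent_space q = tangent_space p"])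
  show "\<exists>T. openin (top_of_set UNIV) T \<and> q \<in> T \<and> (\<forall>p\<in>T. tangent_space q = tangent_space p)" for q
    using tangent_space_locally_constant[of q] by (metis open_openin subtopology_UNIV)
qed auto

text \<open>For surjectivity, Ekeland's principle with slope 1/2 is applied to the distance from
  \<open>z\<close>. If \<open>x p \<noteq> z\<close>, then \<open>z - x p\<close> is tangent at
  \<open>p\<close>, as both points lie in the one constant plane, and in its direction the distance
  decreases with slope 1, steeper than allowed.\<close>

lemma range_eq_tangent_space: "range x = tangent_space p0"
proof
  show "range x \<subseteq> tangent_space p0"
    using position_in_tangent_space tangent_space_constant by blast
  show "tangent_space p0 \<subseteq> range x"
  proof
    fix z assume z: "z \<in> tangent_space p0"
    have cont: "continuous_on UNIV (\<lambda>q. norm (x q - z))" by (intro continuous_intros continuous_position)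
    obtain p where p: "\<And>q. norm (x p - z) - 1 / 2 * d p q \<le> norm (x q - z)"
      using ekeland[OF cont, of 0 "1 / 2"] by auto
    obtain U \<phi> where ch: "(U, \<phi>) \<in> A" "p \<in> U" using chart_at by blast
    then have u: "\<phi> p \<in> \<phi> ` U" by blast
    define X where "X = rep U \<phi>"
    have dX: "(X has_derivative frechet_derivative X (at (\<phi> p))) (at (\<phi> p))"
      unfolding X_def by (rule smooth_on_has_derivative[OF smooth_rep[OF ch(1)] u])
    have ts: "tangent_space p = range (frechet_derivative X (at (\<phi> p)))"
      unfolding tangent_space_eq[OF ch] tangent_plane_def X_def ..
    have sub: "subspace (tangent_space p)"
      unfolding ts by (intro linear_subspace_image has_derivative_linear[OF dX] subspace_UNIV)
    have Xq: "X (\<phi> q) = x q" if "q \<in> U" for q unfolding X_def by (rule local_rep_chart[OF ch(1) that])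
    have "x p = z"
    proof (rule ccontr)
      assume ne: "x p \<noteq> z"
      have "z - x p \<in> tangent_space p"
        using z tangent_space_constant[of p0 p] position_in_tangent_space[of p] subspace_diff[OF sub] by simp
      then obtain w where w: "z - x p = frechet_derivative X (at (\<phi> p)) w" unfolding ts by blast
      have nz: "X (\<phi> p) - z \<noteq> 0" using ne Xq[OF ch(2)] by simp
      have "((\<lambda>u. X u - z) has_derivative frechet_derivative X (at (\<phi> p))) (at (\<phi> p))"
        by (auto intro!: derivative_eq_intros dX)
      from has_derivative_compose[OF this has_derivative_norm[OF nz]]
      have dF: "((\<lambda>u. norm (X u - z)) has_derivative (\<lambda>w. frechet_derivative X (at (\<phi> p)) w \<bullet> sgn (X (\<phi> p) - z))) (at (\<phi> p))" .
      have "- (1 / 2 * norm (frechet_derivative X (at (\<phi> p)) w)) \<le> frechet_derivative X (at (\<phi> p)) w \<bullet> sgn (X (\<phi> p) - z)"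
        using ekeland_derivative[OF p _ ch dF] Xq ch(2) unfolding X_def by simp
      moreover have "(z - x p) \<bullet> sgn (x p - z) = - norm (x p - z)"
      proof -
        have "(x p - z) \<bullet> sgn (x p - z) = norm (x p - z)"
          using ne by (simp add: sgn_div_norm power2_norm_eq_inner[symmetric] power2_eq_square)
        then show ?thesis using inner_minus_left[of "x p - z" "sgn (x p - z)"] by simp
      qed
      ultimately have "- (1 / 2 * norm (z - x p)) \<le> - norm (x p - z)"
        unfolding w[symmetric] Xq[OF ch(2)] by simp
      then show False using ne by (simp add: norm_minus_commute)
    qed
    then show "z \<in> range x" by blast
  qed
qed

lemma range_plane: "subspace (range x) \<and> dim (range x) = 2"
proof -
  obtain U \<phi> where ch: "(U, \<phi>) \<in> A" "undefined \<in> U" using chart_at by blast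
  then have u: "\<phi> undefined \<in> \<phi> ` U" by blast
  define L where "L = frechet_derivative (rep U \<phi>) (at (\<phi> undefined))"
  have lin: "linear L" unfolding L_def by (rule has_derivative_linear[OF smooth_on_has_derivative[OF smooth_rep[OF ch(1)] u]])
  have "inj L" unfolding L_def by (rule inj_rep[OF ch(1) u])
  then have "dim (range L) = 2" using dim_image_eq[OF lin, of UNIV] by simp
  moreover have "range x = range L"
    unfolding range_eq_tangent_space[of undefined] tangent_space_eq[OF ch] tangent_plane_def L_def ..
  ultimately show ?thesis using linear_subspace_image[OF lin subspace_UNIV] by simp
qed

end

theorem theorem1p2:
  fixes A :: "'m::{t2_space, second_countable_topology} chart set"
    and x :: "'m \<Rightarrow> complex^2"
  assumes "smooth_surface_atlas A"
    and "connected (UNIV :: 'm set)"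
    and "smooth_immersion A x"
    and "complete_induced_metric A x"
    and "lagrangian A x"
    and "self_expander A x"
    and "constant_squared_norm_h A x"
  shows "subspace (range x) \<and> dim (range x) = 2"
proof -
  obtain c where "\<forall>(U, \<phi>)\<in>A. \<forall>u\<in>\<phi> ` U. \<forall>v. orthonormal_frame (local_rep (U, \<phi>) x) u v \<longrightarrow>
      squared_norm_h (local_rep (U, \<phi>) x) u v = c"
    using assms(7) unfolding constant_squared_norm_h_def by blast
  then have c: "squared_norm_h (local_rep (U, \<phi>) x) u v = c"
    if "(U, \<phi>) \<in> A" "u \<in> \<phi> ` U" "orthonormal_frame (local_rep (U, \<phi>) x) u v" for U \<phi> u v
    using that by blast
  interpret expander_surface A x c
    by unfold_locales (use assms c in blast)+
  show ?thesis by (rule range_plane)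
qed

end
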